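(* Consider one of the following five regression models: Poisson regression with log-linear link, exponential regression with log-linear link, normal linear regression with known variance, binary logistic regression, or binary probit regression, with i.i.d. data $D^n$ from the true density $p^*(y|x)=f(y,x^T\beta^* )$ and with the truncated i.i.d.-binary / Gaussian variable selection prior with parameters $r_n,\bar r_n,\{V_\gamma\}$, all as described in the context. Assume that for some positive constants $B$ and $v$, $$\max\Big\{\sup_{\gamma:|\gamma|\le\bar r_n}\mathrm{ch}_1(V_\gamma),\ \sup_{\gamma:|\gamma|\le\bar r_n}\mathrm{ch}_1(V_\gamma^{-1})\Big\}\le B\,\bar r_n^{\,v}$$ for all large enough $\bar r_n$. Suppose $|x_j|\le1$ for all $j$. Suppose $K_n$ is nondecreasing in $n$, $K_n\succ n^\delta$ for some $\delta>0$, and $K_n\le e^{Cn^\xi}$ for some $C>0$ and some $\xi\in(0,1)$, for all large enough $n$. Suppose $\lim_{n\to\infty}\sum_{j=1}^{K_n}|\beta_j^*|<\infty$. Suppose also that for some $C'>0$, $\Delta(r_n)\equiv\inf_{\gamma:|\gamma|=r_n}\sum_{j:j\notin\gamma}|\beta_j^*|\le e^{-C'r_n}$ for all large enough $n$, and that $$(C')^{-1}\ln n\le r_n\le\bar r_n\prec(\ln n)^k$$ for some $k>1$. Let $d(p,p^* )^2=\int\int|p(y,x|\gamma,\beta_\gamma)^{1/2}-p^*(y,x)^{1/2}|^2\,\nu_y(dy)\,\nu_x(dx)$. Then, with $\varepsilon_n\in(0,1]$, $\varepsilon_n\sim n^{-(1-\xi)/2}(\ln n)^{k/2}$, the following hold: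 (i) for some $r_0>0$, $\lim_{n\to\infty}P^*\{\pi[d(p,p^* )\le\varepsilon_n|D^n]\ge1-e^{-r_0n\varepsilon_n^2}\}=1$; (ii) for some $c_1>0$ and all sufficiently large $n$, $P^*\{\pi[d(p,p^* )>\varepsilon_n|D^n]\ge e^{-0.5c_1n\varepsilon_n^2}\}\le e^{-0.5c_1n\varepsilon_n^2}$; (iii) for some $c_1>0$ and all sufficiently large $n$, $E^*_{D^n}\,\pi[d(p,p^* )>\varepsilon_n|D^n]\le e^{-c_1n\varepsilon_n^2}$.
   Context: Notation. For sequences, $a_n\prec b_n$ (equivalently $b_n\succ a_n$) means $\lim_{n\to\infty}a_n/b_n=0$; $a_n\sim b_n$ means $\lim_{n\to\infty}a_n/b_n=1$. $\mathrm{ch}_1$ denotes the largest eigenvalue of a symmetric matrix. Model. For each $n$, $x=(x_1,\dots,x_{K_n})^T$ is a random vector with probability law $\nu_x(dx)$, and $y$ is a real response with dominating measure $\nu_y(dy)$ (counting measure for discrete responses, Lebesgue measure for continuous ones). The conditional density of $y$ given linear parameter $h\in\mathbb R$ is $f(y,h)$, one of: Poisson regression: $f(y,h)=\exp\{hy-e^h-\ln(y!)\}$, $y\in\{0,1,2,\dots\}$; normal linear regression: $f(y,h)=(2\pi\sigma^2)^{-1/2}e^{-(y-h)^2/(2\sigma^2)}$, $y\in\mathbb R$, with $\sigma^2>0$ known; exponential regression: $f(y,h)=\exp\{-e^{-h}y-h\}$, $y\in(0,\infty)$; binary logistic regression: $f(y,h)=\exp\{hy-\ln(1+e^h)\}$,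 $y\in\{0,1\}$; binary probit regression: $f(y,h)=\Phi(h)^y(1-\Phi(h))^{1-y}$, $y\in\{0,1\}$, $\Phi$ the standard normal distribution function. The true conditional density of $y$ given $x$ is $p^*(y|x)=f(y,x^T\beta^* )$ for a true vector $\beta^*=(\beta_1^*,\dots,\beta_{K_n}^* )^T$; it is also the joint density $p^*(y,x)$ with respect to $\nu_x(dx)\nu_y(dy)$. The data $D^n=(x^{(i)},y^{(i)})_{i=1}^n$ are i.i.d. from $p^*\,\nu_x(dx)\nu_y(dy)$; $P^*$ and $E^*_{D^n}$ denote probability and expectation for $D^n$. Fitted models. A model is $\gamma=(\gamma_1,\dots,\gamma_{K_n})\in\{0,1\}^{K_n}$, identified with the index set $\{j:\gamma_j=1\}$; $|\gamma|$ is its size; $v_\gamma$ is the subvector of $v$ with indices in $\gamma$. With coefficients $\beta_\gamma\in\mathbb R^{|\gamma|}$ the fitted density is $p(y,x|\gamma,\beta_\gamma)=f(y,x_\gamma^T\beta_\gamma)$ (linear parameter $0$ for the empty model). Suprema of eigenvalues of $V_\gamma$ and $V_\gamma^{-1}$ are over nonempty $\gamma\subset\{1,\dots,K_n\}$. Prior. $r_n,\bar r_n$ are integers with $1\le r_n\le\bar r_n<K_n$. Let $\tilde\gamma_1,\dots,\tilde\gamma_{K_n}$ be i.i.d. binary with $\pi(\tilde\gamma_j=1)=\lambda_n=r_n/K_n$; $\gamma$ is distributed as $\tilde\gamma$ conditioned on $\sum_j\tilde\gamma_j\le\bar r_n$, i.e. $\pi(\gamma)\propto\prod_{j=1}^{K_n}\lambda_n^{\gamma_j}(1-\lambda_n)^{1-\gamma_j}\,I[\sum_l\gamma_l\le\bar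 r_n]$. Conditional on $\gamma$, $\beta_\gamma\sim N(0,V_\gamma)$ with $V_\gamma$ a given $|\gamma|\times|\gamma|$ (positive definite) covariance matrix. The posterior is $$\pi(\gamma,d\beta_\gamma|D^n)=\frac{\prod_{i=1}^np(y^{(i)},x^{(i)}|\gamma,\beta_\gamma)\,\pi(\gamma,d\beta_\gamma)}{\sum_{\gamma'}\int\prod_{i=1}^np(y^{(i)},x^{(i)}|\gamma',\beta'_{\gamma'})\,\pi(\gamma',d\beta'_{\gamma'})},$$ and it induces a posterior distribution on densities $p=p(\cdot|\gamma,\beta_\gamma)$. *)

theory Defs
  imports
    "HOL-Probability.Probability"
    "Jordan_Normal_Form.DL_Submatrix"
    "Jordan_Normal_Form.Char_Poly"
    "Jordan_Normal_Form.Gauss_Jordan_Elimination"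
begin

text \<open>The argument of \<open>Normal_reg\<close> is the known standard deviation.\<close>

datatype regression =
  Poisson_reg | Normal_reg real | Exponential_reg | Logistic_reg | Probit_reg

fun admissible :: "regression \<Rightarrow> bool" where
  "admissible (Normal_reg \<sigma>) \<longleftrightarrow> \<sigma> > 0"
| "admissible _ \<longleftrightarrow> True"

text \<open>Responses are always reals; the support of the response is the space of the
  dominating measure, so counts are the elements of \<open>\<nat> :: real set\<close>.\<close>

fun resp_measure :: "regression \<Rightarrow> real measure" where
  "resp_measure Poisson_reg = count_space \<nat>"
| "resp_measure (Normal_reg \<sigma>) = lborel"
| "resp_measure Exponential_reg = restrict_space lborel {0<..}"
| "resp_measure Logistic_reg = count_space {0, 1}"
| "resp_measure Probit_reg = count_space {0, 1}"

definition std_normal_cdf :: "real \<Rightarrow> real" where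
  "std_normal_cdf h = cdf std_normal_distribution h"

text \<open>\<open>resp_density M y h\<close> is $f(y,h)$; it is only meaningful for \<open>y\<close> in the space of
  \<open>resp_measure M\<close>.\<close>

fun resp_density :: "regression \<Rightarrow> real \<Rightarrow> real \<Rightarrow> real" where
  "resp_density Poisson_reg y h = exp (h * y - exp h - ln (fact (nat \<lfloor>y\<rfloor>)))"
| "resp_density (Normal_reg \<sigma>) y h = normal_density h \<sigma> y"
| "resp_density Exponential_reg y h = exp (- exp (- h) * y - h)"
| "resp_density Logistic_reg y h = exp (h * y - ln (1 + exp h))"
| "resp_density Probit_reg y h =
     std_normal_cdf h powr y * (1 - std_normal_cdf h) powr (1 - y)"

text \<open>A model \<open>\<gamma>\<close> is its index set, and a subvector indexed by \<open>\<gamma>\<close> is a function that is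
  only evaluated on \<open>\<gamma>\<close>. The true density is the fitted density for the full index set
  and the true coefficients.\<close>

definition fitted_density ::
  "regression \<Rightarrow> nat set \<Rightarrow> (nat \<Rightarrow> real) \<Rightarrow> real \<Rightarrow> (nat \<Rightarrow> real) \<Rightarrow> real" where
  "fitted_density M \<gamma> \<beta> y x = resp_density M y (\<Sum>j\<in>\<gamma>. x j * \<beta> j)"

abbreviation true_density ::
  "regression \<Rightarrow> nat \<Rightarrow> (nat \<Rightarrow> real) \<Rightarrow> real \<Rightarrow> (nat \<Rightarrow> real) \<Rightarrow> real" where
  "true_density M K \<beta>s \<equiv> fitted_density M {1..K} \<beta>s"

definition hellinger ::
  "regression \<Rightarrow> (nat \<Rightarrow> real) measure \<Rightarrow> (real \<Rightarrow> (nat \<Rightarrow> real) \<Rightarrow> real) \<Rightarrow>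
    (real \<Rightarrow> (nat \<Rightarrow> real) \<Rightarrow> real) \<Rightarrow> real" where
  "hellinger M \<nu>x p q =
     sqrt (\<integral>x. (\<integral>y. \<bar>sqrt (p y x) - sqrt (q y x)\<bar>\<^sup>2 \<partial>resp_measure M) \<partial>\<nu>x)"

text \<open>Law of one observation \<open>(x, y)\<close>, and of the sample \<open>(D i)\<close> for \<open>i = 1, \<dots>, n\<close>.\<close>

definition obs_law ::
  "regression \<Rightarrow> (nat \<Rightarrow> real) measure \<Rightarrow> nat \<Rightarrow> (nat \<Rightarrow> real) \<Rightarrow> ((nat \<Rightarrow> real) \<times> real) measure"
  where
  "obs_law M \<nu>x K \<beta>s =
     density (\<nu>x \<Otimes>\<^sub>M resp_measure M) (\<lambda>(x, y). ennreal (true_density M K \<beta>s y x))"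

definition data_law ::
  "regression \<Rightarrow> (nat \<Rightarrow> real) measure \<Rightarrow> nat \<Rightarrow> (nat \<Rightarrow> real) \<Rightarrow> nat \<Rightarrow>
    (nat \<Rightarrow> (nat \<Rightarrow> real) \<times> real) measure" where
  "data_law M \<nu>x K \<beta>s n = PiM {1..n} (\<lambda>_. obs_law M \<nu>x K \<beta>s)"

definition pos_def :: "nat \<Rightarrow> real mat \<Rightarrow> bool" where
  "pos_def m A \<longleftrightarrow> A \<in> carrier_mat m m \<and> transpose_mat A = A \<and>
     (\<forall>v\<in>carrier_vec m. v \<noteq> 0\<^sub>v m \<longrightarrow> scalar_prod v (A *\<^sub>v v) > 0)"

text \<open>Only meaningful for invertible square matrices.\<close>

definition inv_mat :: "real mat \<Rightarrow> real mat" where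
  "inv_mat A = the (mat_inverse A)"

text \<open>Only meaningful for symmetric matrices of positive dimension, where the set of real
  eigenvalues is finite and nonempty.\<close>

definition ch1 :: "real mat \<Rightarrow> real" where
  "ch1 A = Max {l. eigenvalue A l}"

text \<open>Rows and columns of a covariance matrix for \<open>\<gamma>\<close> are numbered from 0 and refer to
  the elements of \<open>\<gamma>\<close> in increasing order.\<close>

definition subvec :: "nat set \<Rightarrow> (nat \<Rightarrow> real) \<Rightarrow> real Matrix.vec" where
  "subvec \<gamma> \<beta> = Matrix.vec (card \<gamma>) (\<lambda>i. \<beta> (pick \<gamma> i))"

text \<open>For the empty \<open>\<gamma>\<close> this is the unit mass at the only point of the empty product.\<close>

definition gaussian :: "nat set \<Rightarrow> real mat \<Rightarrow> (nat \<Rightarrow> real) measure" where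
  "gaussian \<gamma> A = density (PiM \<gamma> (\<lambda>_. lborel))
     (\<lambda>\<beta>. ennreal (exp (- scalar_prod (subvec \<gamma> \<beta>) (inv_mat A *\<^sub>v subvec \<gamma> \<beta>) / 2)
        / sqrt ((2 * pi) ^ card \<gamma> * Determinant.det A)))"

definition model_weight :: "nat \<Rightarrow> nat \<Rightarrow> nat \<Rightarrow> nat set \<Rightarrow> real" where
  "model_weight K r rbar \<gamma> =
     (\<Prod>j\<in>{1..K}. if j \<in> \<gamma> then real r / real K else 1 - real r / real K) *
     (if card \<gamma> \<le> rbar then 1 else 0)"

definition model_prior :: "nat \<Rightarrow> nat \<Rightarrow> nat \<Rightarrow> nat set \<Rightarrow> real" where
  "model_prior K r rbar \<gamma> =
     model_weight K r rbar \<gamma> / (\<Sum>\<gamma>'\<in>Pow {1..K}. model_weight K r rbar \<gamma>')"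

definition likelihood ::
  "regression \<Rightarrow> nat \<Rightarrow> (nat \<Rightarrow> (nat \<Rightarrow> real) \<times> real) \<Rightarrow> nat set \<Rightarrow> (nat \<Rightarrow> real) \<Rightarrow> real" where
  "likelihood M n D \<gamma> \<beta> = (\<Prod>i\<in>{1..n}. fitted_density M \<gamma> \<beta> (snd (D i)) (fst (D i)))"

text \<open>Posterior probability, given \<open>D\<close>, of the event that \<open>(\<gamma>, \<beta>)\<close> satisfies \<open>A\<close>.\<close>

definition posterior ::
  "regression \<Rightarrow> nat \<Rightarrow> nat \<Rightarrow> nat \<Rightarrow> (nat set \<Rightarrow> real mat) \<Rightarrow> nat \<Rightarrow>
    (nat \<Rightarrow> (nat \<Rightarrow> real) \<times> real) \<Rightarrow> (nat set \<Rightarrow> (nat \<Rightarrow> real) \<Rightarrow> bool) \<Rightarrow> real" where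
  "posterior M K r rbar V n D A =
     (\<Sum>\<gamma>\<in>Pow {1..K}. model_prior K r rbar \<gamma> *
        (\<integral>\<beta>. indicator {b. A \<gamma> b} \<beta> * likelihood M n D \<gamma> \<beta> \<partial>gaussian \<gamma> (V \<gamma>))) /
     (\<Sum>\<gamma>\<in>Pow {1..K}. model_prior K r rbar \<gamma> *
        (\<integral>\<beta>. likelihood M n D \<gamma> \<beta> \<partial>gaussian \<gamma> (V \<gamma>)))"

text \<open>$\Delta(r)$: the smallest absolute sum of the coefficients left out by a model of size \<open>r\<close>.\<close>

definition tail_sum :: "nat \<Rightarrow> (nat \<Rightarrow> real) \<Rightarrow> nat \<Rightarrow> real" where
  "tail_sum K \<beta>s r =
     (INF \<gamma>\<in>{\<gamma>. \<gamma> \<subseteq> {1..K} \<and> card \<gamma> = r}. \<Sum>j\<in>{1..K} - \<gamma>. \<bar>\<beta>s j\<bar>)"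

definition nonempty_models :: "nat \<Rightarrow> nat \<Rightarrow> nat set set" where
  "nonempty_models K rbar = {\<gamma>. \<gamma> \<subseteq> {1..K} \<and> \<gamma> \<noteq> {} \<and> card \<gamma> \<le> rbar}"

end

theory Submission
  imports Defs "HOL-Real_Asymp.Real_Asymp"
begin

text \<open>Write \<open>s = n \<epsilon>\<^sup>2\<close>, which is of order \<open>n\<^sup>\<xi> (ln n)\<^sup>k\<close>, and let \<open>p\<^sup>*\<close> be the true density. The
  posterior mass of \<open>{d > \<epsilon>}\<close> is a quotient of two integrals of the likelihood ratio against the prior.
  The prior puts enough mass near \<open>p\<^sup>*\<close> to keep the denominator (the evidence) above \<open>exp (- s / 8)\<close>, up to
  an exponentially small expected loss. For the numerator, the prior is concentrated on a set that
  splits into few pieces of small diameter, and the numerator over one piece is exponentially small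
  because its points with \<open>d > \<epsilon>\<close> are separated from the truth.

  All five families are treated through one property of the response density,
  \<open>log_lipschitz_chi_exists\<close>: on linear predictors in \<open>[-H, H]\<close> the chi-square divergence is at most
  \<open>exp (A (1 + H))\<close> times the distance of the predictors. As the covariates are bounded by 1, this
  distance is at most the absolute sum of the differences of the coefficients.

  The denominator. A model \<open>g0\<close> attaining \<open>\<Delta>(r)\<close> leaves out coefficients of absolute sum at most
  \<open>exp (- C' r) \<le> 1 / n\<close>, because \<open>r \<ge> ln n / C'\<close>. For coefficients within \<open>1 / (r n)\<close> of \<open>\<beta>\<^sup>*\<close> on \<open>g0\<close>,
  the linear predictor is within \<open>2 / n\<close> of the true one, so that the chi-square divergence
  over the whole sample stays bounded. The prior mass of this box is at least \<open>exp (- s / 16)\<close>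
  (\<open>prior_mass_lower\<close>): the largest term in its exponent is \<open>r ln K \<le> C r n\<^sup>\<xi>\<close>, and \<open>r\<close> is \<open>o((ln n)\<^sup>k)\<close>.
  A small evidence would make reciprocal likelihood ratios large on average over the box, which is
  rare (\<open>small_evidence\<close>).

  The numerator. Coefficients outside the box \<open>\<bar>\<beta>\<^sub>j\<bar> \<le> T\<close> with \<open>T = n powr (3 \<xi> / 4)\<close> have prior mass
  at most about \<open>exp (- T\<^sup>2 / (4 \<Lambda>))\<close>, where \<open>\<Lambda>\<close> bounds the spectra and is polylogarithmic in \<open>n\<close>; as
  \<open>T\<^sup>2\<close> exceeds \<open>n\<^sup>\<xi>\<close> by a power of \<open>n\<close>, this is below \<open>exp (- s)\<close>. Inside, the box is cut into
  cells on which the chi-square divergence between any two densities is at most \<open>(\<epsilon>\<^sup>2 / 4)\<^sup>2\<close>. Although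
  the side of a cell is exponentially small in \<open>T\<close>, the logarithm of their number over all
  models is \<open>rbar ln K\<close> plus a polylogarithm times \<open>T\<close>. Both are \<open>o(s)\<close>, the first because
  \<open>ln K \<le> C n\<^sup>\<xi>\<close> and \<open>rbar = o((ln n)\<^sup>k)\<close> (\<open>covering_number_upper\<close>).

  The square root of a likelihood ratio takes the place of a test. If \<open>S\<close> is the root of the
  likelihood ratio of a density in the cell and \<open>x\<close> is the posterior mass of the cell, then
  \<open>x \<le> S + x / S\<close>, because \<open>x \<le> 1\<close>. The expectation of \<open>S\<close> is the \<open>n\<close>-th power of a Hellinger affinity,
  at most \<open>(1 - \<epsilon>\<^sup>2 / 2)\<^sup>n\<close>, and after the denominator has been bounded below, \<open>x / S\<close> has an
  expectation governed by \<open>(1 - \<epsilon>\<^sup>2 / 4)\<^sup>n\<close> (\<open>cross_affinity\<close>). The theorem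
  \<open>finite_sample_bound\<close> assembles these estimates for a general Bayesian model.

  The Gaussian priors enter through two-sided bounds for their densities in terms of the extreme
  eigenvalues of \<open>V\<^sub>\<gamma>\<close>. With the rates of the theorem inserted (\<open>rates_at\<close>, \<open>combine_bounds\<close>) the expected
  posterior mass of \<open>{d > \<epsilon>}\<close> is at most \<open>exp (- s / 64)\<close>, which is (iii); (i) and (ii) follow by Markov's
  inequality (\<open>posterior_consequences\<close>).\<close>

section \<open>The standard normal distribution function\<close>

lemma std_normal_cdf_diff:
  assumes "a \<le> b"
  shows "ennreal (std_normal_cdf b - std_normal_cdf a) =
    (\<integral>\<^sup>+x. ennreal (std_normal_density x) * indicator {a<..b} x \<partial>lborel)"
proof -
  interpret N: real_distribution std_normal_distribution
    by (rule real_dist_normal_dist)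
  have "std_normal_cdf b - std_normal_cdf a = measure std_normal_distribution {a<..b}"
    unfolding std_normal_cdf_def
    using N.cdf_diff_eq[of a b] assms by (cases "a = b") auto
  also have "ennreal \<dots> = emeasure std_normal_distribution {a<..b}"
    by (simp add: N.emeasure_eq_measure)
  also have "\<dots> = (\<integral>\<^sup>+x. ennreal (std_normal_density x) * indicator {a<..b} x \<partial>lborel)"
    by (subst emeasure_density) auto
  finally show ?thesis .
qed

lemma std_normal_cdf_diff_upper:
  assumes "a \<le> b" "0 \<le> c" "\<And>x. a < x \<Longrightarrow> x \<le> b \<Longrightarrow> std_normal_density x \<le> c"
  shows "std_normal_cdf b - std_normal_cdf a \<le> c * (b - a)"
proof -
  have "ennreal (std_normal_cdf b - std_normal_cdf a)
      \<le> (\<integral>\<^sup>+x. ennreal c * indicator {a<..b} x \<partial>lborel)"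
    unfolding std_normal_cdf_diff[OF assms(1)]
    using assms by (intro nn_integral_mono) (auto simp: indicator_def intro!: ennreal_leI)
  also have "\<dots> = ennreal (c * (b - a))"
    using assms by (subst nn_integral_cmult_indicator) (auto simp: ennreal_mult)
  finally show ?thesis using assms by (simp add: ennreal_le_iff)
qed

lemma std_normal_cdf_diff_lower:
  assumes "a \<le> b" "0 \<le> c" "\<And>x. a < x \<Longrightarrow> x \<le> b \<Longrightarrow> c \<le> std_normal_density x"
  shows "c * (b - a) \<le> std_normal_cdf b - std_normal_cdf a"
proof -
  have nn: "0 \<le> std_normal_cdf b - std_normal_cdf a"
  proof -
    interpret N: real_distribution std_normal_distribution
      by (rule real_dist_normal_dist)
    show ?thesis unfolding std_normal_cdf_def using N.cdf_nondecreasing[OF assms(1)] by simp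
  qed
  have "ennreal (c * (b - a)) = (\<integral>\<^sup>+x. ennreal c * indicator {a<..b} x \<partial>lborel)"
    using assms by (subst nn_integral_cmult_indicator) (auto simp: ennreal_mult)
  also have "\<dots> \<le> ennreal (std_normal_cdf b - std_normal_cdf a)"
    unfolding std_normal_cdf_diff[OF assms(1)]
    using assms by (intro nn_integral_mono) (auto simp: indicator_def intro!: ennreal_leI)
  finally show ?thesis using assms nn by (simp add: ennreal_le_iff)
qed

lemma std_normal_cdf_mono: "a \<le> b \<Longrightarrow> std_normal_cdf a \<le> std_normal_cdf b"
  using std_normal_cdf_diff_lower[of a b 0] by simp

lemma std_normal_cdf_strict_mono:
  assumes "a < b" shows "std_normal_cdf a < std_normal_cdf b"
proof -
  define c where "c = std_normal_density (\<bar>a\<bar> + \<bar>b\<bar>)"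
  have c: "c > 0" unfolding c_def by (simp add: normal_density_pos)
  have "c \<le> std_normal_density x" if "a < x" "x \<le> b" for x
  proof -
    have "x\<^sup>2 \<le> (\<bar>a\<bar> + \<bar>b\<bar>)\<^sup>2" using that by (intro abs_le_square_iff[THEN iffD1]) auto
    then show ?thesis unfolding c_def std_normal_density_def by (auto simp: field_simps)
  qed
  then have "c * (b - a) \<le> std_normal_cdf b - std_normal_cdf a"
    using assms c by (intro std_normal_cdf_diff_lower) auto
  moreover have "c * (b - a) > 0" using c assms by simp
  ultimately show ?thesis by simp
qed

lemma std_normal_cdf_pos: "0 < std_normal_cdf h"
proof -
  have "0 \<le> std_normal_cdf (h - 1)" unfolding std_normal_cdf_def cdf_def by simp
  then show ?thesis using std_normal_cdf_strict_mono[of "h - 1" h] by simp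
qed

lemma std_normal_cdf_less_1: "std_normal_cdf h < 1"
proof -
  interpret N: real_distribution std_normal_distribution
    by (rule real_dist_normal_dist)
  have "std_normal_cdf (h + 1) \<le> 1" unfolding std_normal_cdf_def by (rule N.cdf_bounded_prob)
  then show ?thesis using std_normal_cdf_strict_mono[of h "h + 1"] by simp
qed

text \<open>The difference \<open>u\<^sup>2 - t\<^sup>2\<close> of the exponents is at most the product of \<open>\<bar>u - t\<bar> \<le> 2 / (1 + H)\<close> and
  \<open>\<bar>u + t\<bar> \<le> 2 (1 + H)\<close>. This fixes the scale \<open>1 / (1 + H)\<close> on which the normal density is almost constant.\<close>

lemma std_normal_density_ratio:
  assumes "\<bar>t\<bar> \<le> H + 1" "\<bar>u\<bar> \<le> H + 1" "\<bar>t - u\<bar> \<le> 2 / (1 + H)" "0 \<le> H"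
  shows "std_normal_density t \<le> exp 2 * std_normal_density u"
proof -
  have "u\<^sup>2 - t\<^sup>2 \<le> \<bar>u - t\<bar> * \<bar>u + t\<bar>"
    by (metis abs_ge_self abs_mult mult.commute power2_eq_square square_diff_square_factored)
  also have "\<dots> \<le> (2 / (1 + H)) * (2 * (H + 1))"
    using assms by (intro mult_mono) auto
  also have "\<dots> = 4" using assms by (simp add: field_simps)
  finally have "- t\<^sup>2 / 2 \<le> 2 + (- u\<^sup>2 / 2)" by simp
  then have "exp (- t\<^sup>2 / 2) \<le> exp 2 * exp (- u\<^sup>2 / 2)" by (simp flip: exp_add)
  then show ?thesis unfolding std_normal_density_def
    by (simp add: divide_right_mono)
qed

text \<open>The distribution function at \<open>h0\<close> is at least the mass of the interval of length \<open>1 / (1 + H)\<close> to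
  the left of \<open>h0\<close>, on which the density is comparable to that on \<open>[h0, h]\<close>. This replaces the Mills
  ratio bound \<open>\<phi>(t) = O((1 + \<bar>t\<bar>) \<Phi>(t))\<close>.\<close>

lemma std_normal_cdf_ratio:
  assumes "0 \<le> H" "\<bar>h\<bar> \<le> H" "\<bar>h0\<bar> \<le> H" "\<bar>h - h0\<bar> \<le> 1 / (1 + H)"
  shows "std_normal_cdf h \<le> (1 + exp 2 * (1 + H) * \<bar>h - h0\<bar>) * std_normal_cdf h0"
proof -
  define s where "s = 1 / (1 + H)"
  have s: "0 < s" "s \<le> 1" "(1 + H) * s = 1" "s * (1 + H) = 1" using assms unfolding s_def by auto
  have two: "2 / (1 + H) = 2 * s" unfolding s_def by simp
  show ?thesis
  proof (cases "h \<le> h0")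
    case True
    have "std_normal_cdf h \<le> 1 * std_normal_cdf h0" using std_normal_cdf_mono[OF True] by simp
    also have "\<dots> \<le> (1 + exp 2 * (1 + H) * \<bar>h - h0\<bar>) * std_normal_cdf h0"
      using std_normal_cdf_pos[of h0] assms by (intro mult_right_mono) auto
    finally show ?thesis .
  next
    case False
    \<comment> \<open>The density is unimodal, so its minimum over an interval is attained at an end point.\<close>
    define c where "c = Min (std_normal_density ` {h0 - s, h0})"
    have c: "c > 0" unfolding c_def by (auto simp: normal_density_pos)
    have c2: "c * s \<le> std_normal_cdf h0"
    proof -
      have "c * (h0 - (h0 - s)) \<le> std_normal_cdf h0 - std_normal_cdf (h0 - s)"
      proof (rule std_normal_cdf_diff_lower)
        fix x assume x: "h0 - s < x" "x \<le> h0"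
        have "x\<^sup>2 \<le> max ((h0 - s)\<^sup>2) (h0\<^sup>2)"
        proof (cases "x \<ge> 0")
          case True then show ?thesis using x by (intro max.coboundedI2 power_mono) auto
        next
          case False
          have "(- x)\<^sup>2 \<le> (- (h0 - s))\<^sup>2" using x False by (intro power_mono) auto
          then show ?thesis by (intro max.coboundedI1) (simp add: power2_commute)
        qed
        then show "c \<le> std_normal_density x"
          unfolding c_def std_normal_density_def
          by (auto simp: min_le_iff_disj le_max_iff_disj field_simps)
      qed (use s c in auto)
      then show ?thesis using std_normal_cdf_pos[of "h0 - s"] by simp
    qed
    have "std_normal_cdf h - std_normal_cdf h0 \<le> (exp 2 * c) * (h - h0)"
    proof (rule std_normal_cdf_diff_upper)
      fix x assume x: "h0 < x" "x \<le> h"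
      have "std_normal_density x \<le> exp 2 * std_normal_density u" if "u \<in> {h0 - s, h0}" for u
        using that x assms s two by (intro std_normal_density_ratio[where H=H]) (auto simp: s_def[symmetric])
      then show "std_normal_density x \<le> exp 2 * c" unfolding c_def by (auto simp: min_def)
    qed (use False c in auto)
    also have "\<dots> = exp 2 * c * (h - h0) * ((1 + H) * s)" using s by simp
    also have "\<dots> = exp 2 * (1 + H) * (h - h0) * (c * s)" by (simp only: ac_simps)
    also have "\<dots> \<le> exp 2 * (1 + H) * (h - h0) * std_normal_cdf h0"
      using c2 False assms by (intro mult_left_mono) auto
    finally show ?thesis using False by (simp add: algebra_simps)
  qed
qed

lemma std_normal_cdf_minus: "std_normal_cdf (- h) = 1 - std_normal_cdf h"
proof -
  interpret N: real_distribution std_normal_distribution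
    by (rule real_dist_normal_dist)
  have "emeasure std_normal_distribution {..- h}
      = (\<integral>\<^sup>+x. ennreal (std_normal_density x) * indicator {..- h} x \<partial>lborel)"
    by (subst emeasure_density) auto
  also have "\<dots> = (\<integral>\<^sup>+x. ennreal (std_normal_density (- x)) * indicator {..- h} (- x) \<partial>lborel)"
    by (subst nn_integral_real_affine[where c = "- 1" and t = 0]) auto
  also have "\<dots> = (\<integral>\<^sup>+x. ennreal (std_normal_density x) * indicator {h<..} x \<partial>lborel)"
    by (intro nn_integral_cong_AE AE_I[where N = "{h}"])
      (auto simp: std_normal_density_def indicator_def split: if_splits)
  also have "\<dots> = emeasure std_normal_distribution {h<..}" by (subst emeasure_density) auto
  finally have "measure std_normal_distribution {..- h} = measure std_normal_distribution {h<..}"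
    by (simp add: measure_def)
  also have "{h<..} = space std_normal_distribution - {..h}" by auto
  also have "measure std_normal_distribution \<dots> = 1 - measure std_normal_distribution {..h}"
    by (rule N.prob_compl) simp
  finally show ?thesis unfolding std_normal_cdf_def cdf_def .
qed

section \<open>Chi-square divergence in the response families\<close>

lemma nn_integral_poisson_series:
  "(\<integral>\<^sup>+y. ennreal (exp (a * y) / fact (nat \<lfloor>y\<rfloor>)) \<partial>count_space (\<nat> :: real set)) = ennreal (exp (exp a))"
proof -
  have bij: "bij_betw (of_nat :: nat \<Rightarrow> real) UNIV \<nat>"
    by (auto simp: bij_betw_def inj_on_def Nats_def)
  have "(\<integral>\<^sup>+y. ennreal (exp (a * y) / fact (nat \<lfloor>y\<rfloor>)) \<partial>count_space (\<nat> :: real set)) =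
     (\<Sum>k. ennreal (exp (a * real k) / fact k))"
    by (subst nn_integral_bij_count_space[OF bij, symmetric]) (simp add: nn_integral_count_space_nat)
  also have "\<dots> = (\<Sum>k. ennreal (exp a ^ k / fact k))"
    by (simp add: exp_of_nat_mult[symmetric] mult.commute)
  also have "\<dots> = ennreal (\<Sum>k. exp a ^ k / fact k)"
  proof (rule suminf_ennreal2)
    show "summable (\<lambda>k. exp a ^ k / fact k)"
      using summable_exp[of "exp a"] by (simp add: divide_inverse mult.commute)
  qed simp
  also have "(\<Sum>k. exp a ^ k / fact k) = exp (exp a)"
    using exp_converges[of "exp a", THEN sums_unique]
    by (simp add: divide_inverse mult.commute scaleR_conv_of_real)
  finally show ?thesis .
qed

lemma nn_integral_exp_decay:
  fixes c :: real
  assumes "c > 0"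
  shows "(\<integral>\<^sup>+y. ennreal (exp (- c * y)) \<partial>restrict_space lborel {0<..}) = ennreal (1 / c)"
proof -
  interpret E: prob_space "density lborel (exponential_density c)"
    by (rule prob_space_exponential_density[OF assms])
  have one: "(\<integral>\<^sup>+y. ennreal (exponential_density c y) \<partial>lborel) = 1"
    using E.emeasure_space_1 by (simp add: emeasure_density)
  have "(\<integral>\<^sup>+y. ennreal (exp (- c * y)) \<partial>restrict_space lborel {0<..})
     = (\<integral>\<^sup>+y. ennreal (exp (- c * y)) * indicator {0<..} y \<partial>lborel)"
    by (subst nn_integral_restrict_space) auto
  also have "\<dots> = (\<integral>\<^sup>+y. ennreal (1 / c) * ennreal (exponential_density c y) \<partial>lborel)"
    by (intro nn_integral_cong_AE AE_I[where N="{0}"])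
      (use assms in \<open>auto simp: exponential_density_def indicator_def ennreal_mult[symmetric] less_imp_le split: if_splits\<close>)
  also have "\<dots> = ennreal (1 / c)"
    by (subst nn_integral_cmult) (auto simp: one)
  finally show ?thesis .
qed

lemma nn_integral_normal_density:
  "\<sigma> > 0 \<Longrightarrow> (\<integral>\<^sup>+y. ennreal (normal_density m \<sigma> y) \<partial>lborel) = 1"
  using prob_space.emeasure_space_1[OF prob_space_normal_density[of \<sigma> m]]
  by (simp add: emeasure_density)

text \<open>The integral is 1 plus the chi-square divergence of the response densities at \<open>h\<close> and \<open>h0\<close>. The
  Lipschitz constant may grow exponentially in \<open>H\<close>, as it does for Poisson regression, where the
  mean is \<open>e\<^sup>h\<close>: only the logarithm of the constant enters the covering number. One parameter \<open>A\<close>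
  serves both the constant and the range of validity.\<close>

definition log_lipschitz_chi :: "real \<Rightarrow> regression \<Rightarrow> bool" where
  "log_lipschitz_chi A M \<longleftrightarrow> (\<forall>H h h0. 0 \<le> H \<longrightarrow> \<bar>h\<bar> \<le> H \<longrightarrow> \<bar>h0\<bar> \<le> H \<longrightarrow> \<bar>h - h0\<bar> \<le> exp (- A * (1 + H)) \<longrightarrow>
     (\<integral>\<^sup>+y. ennreal ((resp_density M y h)\<^sup>2 / resp_density M y h0) \<partial>resp_measure M)
       \<le> ennreal (1 + exp (A * (1 + H)) * \<bar>h - h0\<bar>))"

lemma sigma_finite_resp: "sigma_finite_measure (resp_measure M)"
proof (cases M)
  case Exponential_reg
  then show ?thesis
    using sigma_finite_measure_restrict_space[OF lborel.sigma_finite_measure_axioms, of "{0::real<..}"] by simp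
next
  case Poisson_reg
  have "countable (\<nat> :: real set)" unfolding Nats_def by (rule countable_image) simp
  then show ?thesis using Poisson_reg by (simp add: sigma_finite_measure_count_space_countable)
qed (auto intro!: sigma_finite_measure_count_space_countable lborel.sigma_finite_measure_axioms countable_finite)

lemma measurable_resp_id: "(\<lambda>y. y) \<in> resp_measure M \<rightarrow>\<^sub>M borel"
  by (cases M) (auto intro: measurable_restrict_space1)

lemma measurable_resp_density_borel:
  "(\<lambda>z. resp_density M (fst z) (snd z)) \<in> borel_measurable (borel \<Otimes>\<^sub>M borel)"
proof -
  have [measurable]: "std_normal_cdf \<in> borel_measurable borel"
    by (intro borel_measurable_mono monoI std_normal_cdf_mono)
  show ?thesis
  proof (cases M)
    case Poisson_reg then show ?thesis by simp
  next
    case (Normal_reg s) then show ?thesis by (simp add: normal_density_def)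
  next
    case Exponential_reg then show ?thesis by simp
  next
    case Logistic_reg then show ?thesis by simp
  next
    case Probit_reg then show ?thesis by simp
  qed
qed

lemma measurable_resp_density [measurable (raw)]:
  assumes "f \<in> N \<rightarrow>\<^sub>M resp_measure M" "g \<in> borel_measurable N"
  shows "(\<lambda>x. resp_density M (f x) (g x)) \<in> borel_measurable N"
proof -
  have "f \<in> borel_measurable N" using measurable_compose[OF assms(1) measurable_resp_id] by simp
  then have "(\<lambda>x. (f x, g x)) \<in> N \<rightarrow>\<^sub>M borel \<Otimes>\<^sub>M borel" using assms(2) by simp
  from measurable_compose[OF this measurable_resp_density_borel[of M]] show ?thesis by simp
qed

lemma resp_density_pos:
  assumes "admissible M" shows "0 < resp_density M y h"
  using assms std_normal_cdf_pos[of h] std_normal_cdf_less_1[of h]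
  by (cases M) (auto simp: normal_density_pos)

lemma nn_integral_resp_density:
  assumes "admissible M"
  shows "(\<integral>\<^sup>+y. ennreal (resp_density M y h) \<partial>resp_measure M) = 1"
proof (cases M)
  case Poisson_reg
  have "(\<integral>\<^sup>+y. ennreal (resp_density M y h) \<partial>resp_measure M)
    = (\<integral>\<^sup>+y. ennreal (exp (- exp h)) * ennreal (exp (h * y) / fact (nat \<lfloor>y\<rfloor>)) \<partial>count_space (\<nat> :: real set))"
    using Poisson_reg by (auto intro!: nn_integral_cong simp: ennreal_mult[symmetric] exp_diff exp_minus exp_add field_simps)
  also have "\<dots> = 1"
    by (subst nn_integral_cmult) (auto simp: nn_integral_poisson_series ennreal_mult[symmetric] exp_minus)
  finally show ?thesis .
next
  case (Normal_reg s) then show ?thesis using assms by (simp add: nn_integral_normal_density)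
next
  case Exponential_reg
  have "(\<integral>\<^sup>+y. ennreal (resp_density M y h) \<partial>resp_measure M)
    = (\<integral>\<^sup>+y. ennreal (exp (- h)) * ennreal (exp (- exp (- h) * y)) \<partial>restrict_space lborel {0<..})"
    using Exponential_reg by (auto intro!: nn_integral_cong simp: ennreal_mult[symmetric] mult_exp_exp add.commute)
  also have "\<dots> = 1"
    by (subst nn_integral_cmult)
       (simp_all only: nn_integral_exp_decay[OF exp_gt_zero], auto simp: ennreal_mult[symmetric] intro!: measurable_restrict_space1)
  finally show ?thesis .
next
  case Logistic_reg
  have "1 + exp h > 0" by (simp add: add_pos_pos)
  then show ?thesis using Logistic_reg
    by (simp add: nn_integral_count_space_finite ennreal_plus[symmetric] exp_diff exp_minus field_simps
          del: ennreal_plus)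
next
  case Probit_reg
  then show ?thesis using std_normal_cdf_pos[of h] std_normal_cdf_less_1[of h]
    by (simp add: nn_integral_count_space_finite ennreal_plus[symmetric] del: ennreal_plus)
qed

text \<open>For a fixed response the likelihood is bounded in the linear predictor. This makes it integrable
  under every finite prior, so that the Bochner integrals in the posterior have their intended value.\<close>

lemma resp_density_bounded:
  assumes "admissible M" "y \<in> space (resp_measure M)"
  shows "\<exists>c. \<forall>h. resp_density M y h \<le> c"
proof (cases M)
  case Poisson_reg
  then obtain k where y: "y = real k" using assms by (auto simp: Nats_def)
  have "resp_density M y h \<le> 1" for h
  proof -
    have "exp (h * real k - exp h - ln (fact k)) = exp h ^ k / fact k / exp (exp h)"
      by (simp add: exp_diff exp_of_nat_mult[symmetric] mult.commute)
    also have "exp h ^ k / fact k \<le> exp (exp h)"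
    proof -
      \<comment> \<open>One term of the exponential series.\<close>
      have "exp h ^ k /\<^sub>R fact k \<le> (\<Sum>n. exp h ^ n /\<^sub>R fact n)"
        using sum_le_suminf[OF summable_exp_generic[of "exp h"], of "{k}"] by simp
      then show ?thesis by (simp add: exp_def[symmetric] divide_inverse mult.commute) (simp add: exp_def)
    qed
    then have "exp h ^ k / fact k / exp (exp h) \<le> 1" by (subst divide_le_eq_1_pos) auto
    finally show ?thesis using Poisson_reg y by simp
  qed
  then show ?thesis by blast
next
  case (Normal_reg s)
  have "resp_density M y h \<le> 1 / sqrt (2 * pi * s\<^sup>2)" for h
    using Normal_reg assms by (simp add: normal_density_def divide_right_mono)
  then show ?thesis by blast
next
  case Exponential_reg
  have "resp_density M y h \<le> 1 / y" for h
  proof -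
    have y: "y > 0" using assms Exponential_reg by (simp add: space_restrict_space)
    have "exp (- h) * y \<le> exp (exp (- h) * y)" using exp_ge_add_one_self[of "exp (- h) * y"] by linarith
    moreover have "resp_density M y h = exp (- h) / exp (exp (- h) * y)"
      using Exponential_reg by (simp add: exp_diff[symmetric] algebra_simps)
    ultimately show ?thesis using y by (simp add: divide_le_eq le_divide_eq mult.commute)
  qed
  then show ?thesis by blast
next
  case Logistic_reg
  have "resp_density M y h \<le> 1" for h
  proof -
    have "1 + exp h > 0" by (simp add: add_pos_pos)
    then show ?thesis using assms Logistic_reg by (auto simp: exp_diff)
  qed
  then show ?thesis by blast
next
  case Probit_reg
  have "resp_density M y h \<le> 1" for h
    using assms Probit_reg std_normal_cdf_pos[of h] std_normal_cdf_less_1[of h] by auto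
  then show ?thesis by blast
qed

text \<open>Two-point responses have likelihood ratios bounded by \<open>1 + k\<close>, and the chi-square integral is the
  mean of the likelihood ratio under the density at \<open>h\<close>.\<close>

lemma chi_from_ratio:
  assumes M: "admissible M" and k: "0 \<le> k"
    and le: "\<And>y. y \<in> space (resp_measure M) \<Longrightarrow> resp_density M y h \<le> (1 + k) * resp_density M y h0"
  shows "(\<integral>\<^sup>+y. ennreal ((resp_density M y h)\<^sup>2 / resp_density M y h0) \<partial>resp_measure M) \<le> ennreal (1 + k)"
proof -
  have "(\<integral>\<^sup>+y. ennreal ((resp_density M y h)\<^sup>2 / resp_density M y h0) \<partial>resp_measure M)
      \<le> (\<integral>\<^sup>+y. ennreal (1 + k) * ennreal (resp_density M y h) \<partial>resp_measure M)"
  proof (rule nn_integral_mono)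
    fix y assume y: "y \<in> space (resp_measure M)"
    note pos = resp_density_pos[OF M, of y h] resp_density_pos[OF M, of y h0]
    have "(resp_density M y h)\<^sup>2 / resp_density M y h0
        = resp_density M y h * (resp_density M y h / resp_density M y h0)"
      by (simp add: power2_eq_square)
    also have "\<dots> \<le> resp_density M y h * (1 + k)"
      using le[OF y] pos by (intro mult_left_mono) (auto simp: divide_le_eq)
    finally show "ennreal ((resp_density M y h)\<^sup>2 / resp_density M y h0)
        \<le> ennreal (1 + k) * ennreal (resp_density M y h)"
      using pos k by (simp add: ennreal_mult[symmetric] mult.commute ennreal_leI del: ennreal_plus)
  qed
  also have "\<dots> = ennreal (1 + k)"
    by (subst nn_integral_cmult) (auto simp: nn_integral_resp_density[OF M] intro!: measurable_compose[OF measurable_resp_density] )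
  finally show ?thesis .
qed

lemma exp_le_1_plus_2x: "0 \<le> x \<Longrightarrow> x \<le> 1 \<Longrightarrow> exp x \<le> 1 + 2 * (x::real)"
proof -
  assume x: "0 \<le> x" "x \<le> 1"
  have "exp x \<le> 1 + x + x\<^sup>2" by (rule exp_bound) fact+
  moreover have "x\<^sup>2 \<le> x * 1" unfolding power2_eq_square using x by (intro mult_left_mono) auto
  ultimately show ?thesis by simp
qed

lemma mult_exp_le_1:
  fixes d x :: real
  assumes "d \<le> exp (- x)"
  shows "d * exp x \<le> 1"
  using mult_right_mono[OF assms, of "exp x"] by (simp add: mult_exp_exp)

lemma exp_3_ge_8: "8 \<le> exp (3::real)"
proof -
  have "2 ^ 3 \<le> exp (1::real) ^ 3" by (intro power_mono) (use exp_ge_add_one_self[of 1] in auto)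
  then show ?thesis by (simp flip: exp_of_nat_mult)
qed

text \<open>In the Poisson, normal and exponential families the integral is known in closed form, being the
  normalising constant of the member of the family with natural parameter extrapolated beyond \<open>h\<close>:
  \<open>exp (exp h0 * (exp (h - h0) - 1)\<^sup>2)\<close>, \<open>exp ((h - h0)\<^sup>2 / \<sigma>\<^sup>2)\<close> and \<open>exp a / (2 - exp (- a))\<close> with \<open>a = h0 - h\<close>. The binary
  families are covered by a bound on the likelihood ratio.\<close>

lemma log_lipschitz_chi_exists:
  assumes "admissible M" shows "\<exists>A\<ge>1. log_lipschitz_chi A M"
proof (cases M)
  case Poisson_reg
  have "log_lipschitz_chi 3 M" unfolding log_lipschitz_chi_def
  proof (intro allI impI)
    fix H h h0 :: real
    assume H: "0 \<le> H" "\<bar>h\<bar> \<le> H" "\<bar>h0\<bar> \<le> H" and d: "\<bar>h - h0\<bar> \<le> exp (- 3 * (1 + H))"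
    define D where "D = \<bar>h - h0\<bar>"
    define E where "E = exp H"
    have E: "1 \<le> E" unfolding E_def using H by simp
    have L: "exp (3 * (1 + H)) = exp 3 * E ^ 3" unfolding E_def
      by (simp add: exp_add[symmetric] exp_of_nat_mult[symmetric] algebra_simps)
    have LE: "8 * E \<le> exp (3 * (1 + H))" unfolding L
      using exp_3_ge_8 E by (intro mult_mono self_le_power) auto
    have D: "0 \<le> D" "D * exp (3 * (1 + H)) \<le> 1"
      using mult_exp_le_1[of D "3 * (1 + H)"] d unfolding D_def by auto
    have D8: "8 * E * D \<le> 1" using LE D mult_right_mono[OF LE D(1)] by (simp add: mult.commute)
    have D1: "D \<le> 1" using D8 E D(1) mult_right_mono[OF E D(1)] by linarith
    have "(\<integral>\<^sup>+y. ennreal ((resp_density M y h)\<^sup>2 / resp_density M y h0) \<partial>resp_measure M)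
       = (\<integral>\<^sup>+y. ennreal (exp (exp h0 - 2 * exp h)) * ennreal (exp ((2 * h - h0) * y) / fact (nat \<lfloor>y\<rfloor>)) \<partial>count_space (\<nat> :: real set))"
    proof -
      have "(resp_density M y h)\<^sup>2 / resp_density M y h0
          = exp (exp h0 - 2 * exp h) * (exp ((2 * h - h0) * y) / fact (nat \<lfloor>y\<rfloor>))" for y
      proof -
        define l where "l = ln (fact (nat \<lfloor>y\<rfloor>) :: real)"
        have f: "fact (nat \<lfloor>y\<rfloor>) = exp l" unfolding l_def by simp
        have "(resp_density M y h)\<^sup>2 / resp_density M y h0
            = exp (2 * (h * y - exp h - l) - (h0 * y - exp h0 - l))"
          unfolding exp_diff[of "2 * _"] exp_double using Poisson_reg by (simp add: l_def)
        also have "2 * (h * y - exp h - l) - (h0 * y - exp h0 - l)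
            = (exp h0 - 2 * exp h) + ((2 * h - h0) * y - l)" by (simp add: algebra_simps)
        also have "exp \<dots> = exp (exp h0 - 2 * exp h) * (exp ((2 * h - h0) * y) / fact (nat \<lfloor>y\<rfloor>))"
          unfolding f by (simp only: exp_add exp_diff)
        finally show ?thesis .
      qed
      then show ?thesis using Poisson_reg by (auto simp: ennreal_mult[symmetric])
    qed
    also have "\<dots> = ennreal (exp (exp h0 - 2 * exp h) * exp (exp (2 * h - h0)))"
      by (subst nn_integral_cmult) (auto simp: nn_integral_poisson_series ennreal_mult[symmetric])
    also have "exp (exp h0 - 2 * exp h) * exp (exp (2 * h - h0)) = exp (exp h0 * (exp (h - h0) - 1)\<^sup>2)"
    proof -
      have "exp h0 * (exp (h - h0) - 1)\<^sup>2 = (exp h0 - 2 * exp h) + exp (2 * h - h0)"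
        by (simp add: power2_eq_square exp_diff exp_double field_simps) (simp add: mult_exp_exp)
      then show ?thesis by (simp only: exp_add)
    qed
    also have "ennreal \<dots> \<le> ennreal (1 + exp (3 * (1 + H)) * D)"
    proof (rule ennreal_leI)
      have up: "exp (h - h0) - 1 \<le> 2 * D"
        using exp_le_1_plus_2x[of D] D D1 unfolding D_def
        by (smt (verit) exp_le_cancel_iff)
      have lo: "- (2 * D) \<le> exp (h - h0) - 1"
        proof -
        have "- D \<le> h - h0" unfolding D_def by linarith
        then show ?thesis using exp_ge_add_one_self[of "h - h0"] D(1) by linarith
      qed
      have "(exp (h - h0) - 1)\<^sup>2 \<le> (2 * D)\<^sup>2" using up lo by (intro power2_le_iff_abs_le[THEN iffD2]) auto
      then have "exp h0 * (exp (h - h0) - 1)\<^sup>2 \<le> E * (2 * D)\<^sup>2"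
        using H unfolding E_def by (intro mult_mono) auto
      also have "\<dots> = 4 * E * D * D" by (simp add: power2_eq_square)
      also have "\<dots> \<le> 4 * E * D * 1" using D D1 E by (intro mult_left_mono) auto
      finally have x: "exp h0 * (exp (h - h0) - 1)\<^sup>2 \<le> 4 * E * D" by simp
      have "exp (exp h0 * (exp (h - h0) - 1)\<^sup>2) \<le> exp (4 * E * D)" using x by simp
      also have "\<dots> \<le> 1 + 2 * (4 * E * D)" using D8 E D by (intro exp_le_1_plus_2x) auto
      also have "\<dots> \<le> 1 + exp (3 * (1 + H)) * D" using mult_right_mono[OF LE D(1)] by simp
      finally show "exp (exp h0 * (exp (h - h0) - 1)\<^sup>2) \<le> 1 + exp (3 * (1 + H)) * D" .
    qed
    finally show "(\<integral>\<^sup>+y. ennreal ((resp_density M y h)\<^sup>2 / resp_density M y h0) \<partial>resp_measure M)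
       \<le> ennreal (1 + exp (3 * (1 + H)) * \<bar>h - h0\<bar>)" unfolding D_def .
  qed
  then show ?thesis by (intro exI[of _ 3]) auto
next
  case (Normal_reg s)
  then have s: "s > 0" using assms by simp
  define A where "A = 1 + ln (1 + 2 / s\<^sup>2)"
  have A1: "A \<ge> 1" unfolding A_def using s by simp
  have eA: "2 / s\<^sup>2 \<le> exp A" "1 \<le> exp A"
  proof -
    have "0 < 1 + 2 / s\<^sup>2" using s by (simp add: add_pos_pos)
    then have "1 + 2 / s\<^sup>2 = exp (A - 1)" unfolding A_def by simp
    also have "\<dots> \<le> exp A" by simp
    finally show "2 / s\<^sup>2 \<le> exp A" "1 \<le> exp A" using A1 by auto
  qed
  have "log_lipschitz_chi A M" unfolding log_lipschitz_chi_def
  proof (intro allI impI)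
    fix H h h0 :: real
    assume H: "0 \<le> H" and d: "\<bar>h - h0\<bar> \<le> exp (- A * (1 + H))"
    define D where "D = \<bar>h - h0\<bar>"
    define L where "L = exp (A * (1 + H))"
    have "exp A \<le> L" unfolding L_def using H A1 by (simp add: mult_left_mono[of 1 "1 + H" A, simplified])
    then have L: "2 / s\<^sup>2 \<le> L" "1 \<le> L" using eA by linarith+
    have D: "0 \<le> D" "D * L \<le> 1" using mult_exp_le_1[of D "A * (1 + H)"] d unfolding D_def L_def by auto
    have D1: "D \<le> 1" using D mult_left_mono[OF L(2) D(1)] by simp
    have D2: "2 / s\<^sup>2 * D \<le> L * D" using L D by (intro mult_right_mono) auto
    have "(\<integral>\<^sup>+y. ennreal ((resp_density M y h)\<^sup>2 / resp_density M y h0) \<partial>resp_measure M)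
       = (\<integral>\<^sup>+y. ennreal (exp ((h - h0)\<^sup>2 / s\<^sup>2)) * ennreal (normal_density (2 * h - h0) s y) \<partial>lborel)"
    proof -
      have "(resp_density M y h)\<^sup>2 / resp_density M y h0
          = exp ((h - h0)\<^sup>2 / s\<^sup>2) * normal_density (2 * h - h0) s y" for y
      proof -
        define q where "q = sqrt (2 * pi * s\<^sup>2)"
        have q: "q > 0" unfolding q_def using s by simp
        have "(resp_density M y h)\<^sup>2 / resp_density M y h0
           = exp (2 * (- (y - h)\<^sup>2 / (2 * s\<^sup>2)) - (- (y - h0)\<^sup>2 / (2 * s\<^sup>2))) / q"
          using Normal_reg q unfolding exp_diff exp_double by (simp add: normal_density_def q_def[symmetric]) (simp add: power2_eq_square)
        also have "2 * (- (y - h)\<^sup>2 / (2 * s\<^sup>2)) - (- (y - h0)\<^sup>2 / (2 * s\<^sup>2))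
           = (h - h0)\<^sup>2 / s\<^sup>2 + - (y - (2 * h - h0))\<^sup>2 / (2 * s\<^sup>2)"
          using s by (simp add: field_simps) (simp add: power2_eq_square algebra_simps)
        finally show ?thesis unfolding exp_add by (simp add: normal_density_def q_def)
      qed
      then show ?thesis using Normal_reg by (auto simp: ennreal_mult[symmetric])
    qed
    also have "\<dots> = ennreal (exp ((h - h0)\<^sup>2 / s\<^sup>2))"
      by (subst nn_integral_cmult) (auto simp: nn_integral_normal_density[OF s])
    also have "\<dots> \<le> ennreal (1 + L * D)"
    proof (rule ennreal_leI)
      have "(h - h0)\<^sup>2 = D * D" unfolding D_def by (simp add: power2_eq_square)
      also have "\<dots> \<le> D * 1" using D D1 by (intro mult_left_mono) auto
      finally have "(h - h0)\<^sup>2 / s\<^sup>2 \<le> D / s\<^sup>2" by (simp add: divide_right_mono)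
      also have "\<dots> = (2 / s\<^sup>2 * D) / 2" by simp
      also have "\<dots> \<le> L * D / 2" using D2 by (intro divide_right_mono) auto
      finally have x: "(h - h0)\<^sup>2 / s\<^sup>2 \<le> L * D / 2" .
      have "exp ((h - h0)\<^sup>2 / s\<^sup>2) \<le> 1 + 2 * ((h - h0)\<^sup>2 / s\<^sup>2)"
        using x D by (intro exp_le_1_plus_2x) (auto simp: mult.commute)
      then show "exp ((h - h0)\<^sup>2 / s\<^sup>2) \<le> 1 + L * D" using x by linarith
    qed
    finally show "(\<integral>\<^sup>+y. ennreal ((resp_density M y h)\<^sup>2 / resp_density M y h0) \<partial>resp_measure M)
       \<le> ennreal (1 + exp (A * (1 + H)) * \<bar>h - h0\<bar>)" unfolding D_def L_def .
  qed
  then show ?thesis using A1 by blast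
next
  case Exponential_reg
  have "log_lipschitz_chi 3 M" unfolding log_lipschitz_chi_def
  proof (intro allI impI)
    fix H h h0 :: real
    assume H: "0 \<le> H" and d: "\<bar>h - h0\<bar> \<le> exp (- 3 * (1 + H))"
    define D where "D = \<bar>h - h0\<bar>"
    define a where "a = h0 - h"
    have L: "8 \<le> exp (3 * (1 + H))" using exp_3_ge_8 H by (smt (verit) exp_le_cancel_iff)
    have D: "0 \<le> D" "D * exp (3 * (1 + H)) \<le> 1"
      using mult_exp_le_1[of D "3 * (1 + H)"] d unfolding D_def by auto
    have D8: "8 * D \<le> 1" using mult_left_mono[OF L D(1)] D by linarith
    have e: "exp D \<le> 1 + 2 * D" using D8 D by (intro exp_le_1_plus_2x) auto
    have ea: "exp a \<le> 1 + 2 * D" "exp (- a) \<le> 1 + 2 * D"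
      using e unfolding a_def D_def by (smt (verit) exp_le_cancel_iff)+
    define c where "c = 2 * exp (- h) - exp (- h0)"
    have c: "c = exp (- h) * (2 - exp (- a))" unfolding c_def a_def
      by (simp add: algebra_simps mult_exp_exp)
    have two: "2 - exp (- a) \<ge> 3 / 4" using ea D8 by linarith
    have c0: "c > 0" unfolding c using two by (intro mult_pos_pos) auto
    have "(\<integral>\<^sup>+y. ennreal ((resp_density M y h)\<^sup>2 / resp_density M y h0) \<partial>resp_measure M)
       = (\<integral>\<^sup>+y. ennreal (exp (h0 - 2 * h)) * ennreal (exp (- c * y)) \<partial>restrict_space lborel {0<..})"
    proof -
      have "(resp_density M y h)\<^sup>2 / resp_density M y h0 = exp (h0 - 2 * h) * exp (- c * y)" for y
        using Exponential_reg unfolding c_def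
        by (simp only: resp_density.simps exp_double[symmetric] exp_diff[symmetric] exp_add[symmetric])
           (simp add: algebra_simps)
      then show ?thesis using Exponential_reg by (auto simp: ennreal_mult[symmetric])
    qed
    also have "\<dots> = ennreal (exp (h0 - 2 * h) * (1 / c))"
      by (subst nn_integral_cmult)
        (simp_all only: nn_integral_exp_decay[OF c0], use c0 in \<open>auto simp: ennreal_mult[symmetric] intro!: measurable_restrict_space1\<close>)
    also have "exp (h0 - 2 * h) * (1 / c) = exp a / (2 - exp (- a))"
      proof -
      have "exp (h0 - 2 * h) = exp (- h) * exp a" unfolding a_def by (simp add: mult_exp_exp)
      then show ?thesis unfolding c by simp
    qed
    also have "ennreal \<dots> \<le> ennreal (1 + exp (3 * (1 + H)) * D)"
    proof (rule ennreal_leI)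
      have "(1 + 8 * D) * (1 - 2 * D) - (1 + 2 * D) = 2 * D * (2 - 8 * D)" by (simp add: algebra_simps)
      moreover have "2 * D * (2 - 8 * D) \<ge> 0" using D8 D by (intro mult_nonneg_nonneg) auto
      ultimately have "1 + 2 * D \<le> (1 + 8 * D) * (1 - 2 * D)" by linarith
      also have "\<dots> \<le> (1 + 8 * D) * (2 - exp (- a))" using ea D by (intro mult_left_mono) auto
      finally have "exp a \<le> (1 + 8 * D) * (2 - exp (- a))" using ea by linarith
      then have "exp a / (2 - exp (- a)) \<le> 1 + 8 * D" using two by (simp add: divide_le_eq)
      also have "\<dots> \<le> 1 + exp (3 * (1 + H)) * D" using mult_right_mono[OF L D(1)] by simp
      finally show "exp a / (2 - exp (- a)) \<le> 1 + exp (3 * (1 + H)) * D" .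
    qed
    finally show "(\<integral>\<^sup>+y. ennreal ((resp_density M y h)\<^sup>2 / resp_density M y h0) \<partial>resp_measure M)
       \<le> ennreal (1 + exp (3 * (1 + H)) * \<bar>h - h0\<bar>)" unfolding D_def .
  qed
  then show ?thesis by (intro exI[of _ 3]) auto
next
  case Logistic_reg
  have "log_lipschitz_chi 3 M" unfolding log_lipschitz_chi_def
  proof (intro allI impI)
    fix H h h0 :: real
    assume H: "0 \<le> H" and d: "\<bar>h - h0\<bar> \<le> exp (- 3 * (1 + H))"
    define D where "D = \<bar>h - h0\<bar>"
    have L: "8 \<le> exp (3 * (1 + H))" using exp_3_ge_8 H by (smt (verit) exp_le_cancel_iff)
    have D: "0 \<le> D" "D \<le> 1" using d H unfolding D_def by (auto elim: order_trans)
    have e: "exp D \<le> 1 + 2 * D" using D by (intro exp_le_1_plus_2x) auto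
    have "(\<integral>\<^sup>+y. ennreal ((resp_density M y h)\<^sup>2 / resp_density M y h0) \<partial>resp_measure M)
        \<le> ennreal (1 + 2 * D)"
    proof (rule chi_from_ratio[OF assms])
      fix y assume y: "y \<in> space (resp_measure M)"
      have p: "1 + exp h > 0" "1 + exp h0 > 0" by (auto simp: add_pos_pos)
      have s: "exp h \<le> exp D * exp h0" "exp h0 \<le> exp D * exp h"
        unfolding D_def by (simp_all flip: exp_add)
      have e1: "1 \<le> exp D" using D by simp
      have "resp_density M y h \<le> exp D * resp_density M y h0"
      proof (cases "y = 0")
        case True
        have "1 + exp h0 \<le> exp D * (1 + exp h)" using add_mono[OF e1 s(2)] by (simp add: algebra_simps)
        then show ?thesis using True Logistic_reg p by (simp add: exp_minus field_simps)
      next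
        case False
        then have y1: "y = 1" using y Logistic_reg by auto
        have "exp h * (1 + exp h0) \<le> exp D * exp h0 * (1 + exp h)"
          using s e1 by (simp add: algebra_simps add_mono mult_right_mono)
        then show ?thesis using y1 Logistic_reg p by (simp add: exp_diff field_simps)
      qed
      also have "\<dots> \<le> (1 + 2 * D) * resp_density M y h0"
        using e resp_density_pos[OF assms, of y h0] by (intro mult_right_mono) auto
      finally show "resp_density M y h \<le> (1 + 2 * D) * resp_density M y h0" .
    qed (use D in auto)
    also have "\<dots> \<le> ennreal (1 + exp (3 * (1 + H)) * D)"
      using L D by (intro ennreal_leI add_left_mono mult_right_mono) auto
    finally show "(\<integral>\<^sup>+y. ennreal ((resp_density M y h)\<^sup>2 / resp_density M y h0) \<partial>resp_measure M)
       \<le> ennreal (1 + exp (3 * (1 + H)) * \<bar>h - h0\<bar>)" unfolding D_def .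
  qed
  then show ?thesis by (intro exI[of _ 3]) auto
next
  case Probit_reg
  have "log_lipschitz_chi 3 M" unfolding log_lipschitz_chi_def
  proof (intro allI impI)
    fix H h h0 :: real
    assume H: "0 \<le> H" "\<bar>h\<bar> \<le> H" "\<bar>h0\<bar> \<le> H" and d: "\<bar>h - h0\<bar> \<le> exp (- 3 * (1 + H))"
    have eH: "1 + H \<le> exp H" by (rule exp_ge_add_one_self)
    have "exp (- 3 * (1 + H)) \<le> exp (- H)" using H by simp
    also have "\<dots> = 1 / exp H" by (simp add: exp_minus divide_inverse)
    also have "\<dots> \<le> 1 / (1 + H)" using H eH by (intro divide_left_mono) (auto intro!: mult_pos_pos)
    finally have d1: "\<bar>h - h0\<bar> \<le> 1 / (1 + H)" using d by linarith
    \<comment> \<open>A failure at \<open>h\<close> has the probability of a success at \<open>- h\<close>.\<close>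
    have minus: "1 - std_normal_cdf h \<le> (1 + exp 2 * (1 + H) * \<bar>h - h0\<bar>) * (1 - std_normal_cdf h0)"
      using std_normal_cdf_ratio[of H "- h" "- h0"] H d1 by (simp add: std_normal_cdf_minus abs_minus_commute)
    have L: "exp 2 * (1 + H) \<le> exp (3 * (1 + H))"
    proof -
      have "exp 2 * (1 + H) \<le> exp 2 * exp H" using eH by (intro mult_left_mono) auto
      also have "\<dots> \<le> exp (3 * (1 + H))" using H by (simp flip: exp_add)
      finally show ?thesis .
    qed
    have "(\<integral>\<^sup>+y. ennreal ((resp_density M y h)\<^sup>2 / resp_density M y h0) \<partial>resp_measure M)
        \<le> ennreal (1 + exp 2 * (1 + H) * \<bar>h - h0\<bar>)"
    proof (rule chi_from_ratio[OF assms])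
      fix y assume "y \<in> space (resp_measure M)"
      then have y: "y = 0 \<or> y = 1" using Probit_reg by auto
      show "resp_density M y h \<le> (1 + exp 2 * (1 + H) * \<bar>h - h0\<bar>) * resp_density M y h0"
        using y std_normal_cdf_ratio[OF H d1] minus Probit_reg std_normal_cdf_pos[of h] std_normal_cdf_less_1[of h]
          std_normal_cdf_pos[of h0] std_normal_cdf_less_1[of h0] by auto
    qed (use H in auto)
    also have "\<dots> \<le> ennreal (1 + exp (3 * (1 + H)) * \<bar>h - h0\<bar>)"
      using L by (intro ennreal_leI add_left_mono mult_right_mono) auto
    finally show "(\<integral>\<^sup>+y. ennreal ((resp_density M y h)\<^sup>2 / resp_density M y h0) \<partial>resp_measure M)
       \<le> ennreal (1 + exp (3 * (1 + H)) * \<bar>h - h0\<bar>)" .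
  qed
  then show ?thesis by (intro exI[of _ 3]) auto
qed

section \<open>Spectral bounds for symmetric matrices\<close>

definition psd :: "nat \<Rightarrow> real mat \<Rightarrow> bool" where
  "psd m A \<longleftrightarrow> A \<in> carrier_mat m m \<and> transpose_mat A = A \<and>
     (\<forall>v\<in>carrier_vec m. 0 \<le> scalar_prod v (A *\<^sub>v v))"

lemma psdD:
  assumes "psd m A"
  shows "A \<in> carrier_mat m m" "transpose_mat A = A" "v \<in> carrier_vec m \<Longrightarrow> 0 \<le> scalar_prod v (A *\<^sub>v v)"
  using assms unfolding psd_def by auto

lemma pos_defD:
  assumes "pos_def m A"
  shows "A \<in> carrier_mat m m" "transpose_mat A = A"
    "v \<in> carrier_vec m \<Longrightarrow> v \<noteq> 0\<^sub>v m \<Longrightarrow> 0 < scalar_prod v (A *\<^sub>v v)"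
  using assms unfolding pos_def_def by auto

lemma pos_def_imp_psd:
  assumes "pos_def m A" shows "psd m A"
  unfolding psd_def
proof (intro conjI ballI)
  fix v :: "real Matrix.vec" assume v: "v \<in> carrier_vec m"
  show "0 \<le> scalar_prod v (A *\<^sub>v v)"
  proof (cases "v = 0\<^sub>v m")
    case True
    then show ?thesis using pos_defD(1)[OF assms] by (auto simp: scalar_prod_def)
  next
    case False
    then show ?thesis using pos_defD(3)[OF assms v] by simp
  qed
qed (use pos_defD[OF assms] in auto)

lemma square_le_of_quadratic_nonneg:
  fixes a b c :: real
  assumes "\<And>t. 0 \<le> a + 2 * t * b + t\<^sup>2 * c" "0 \<le> c"
  shows "b\<^sup>2 \<le> a * c"
proof (cases "c = 0")
  case True
  have "b = 0"
  proof (rule ccontr)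
    assume "b \<noteq> 0"
    then show False using assms(1)[of "- (a + 1) / (2 * b)"] True by (simp add: field_simps)
  qed
  then show ?thesis using True by simp
next
  case False
  then have c: "c > 0" using assms(2) by simp
  have "0 \<le> a + 2 * (- b / c) * b + (- b / c)\<^sup>2 * c" by (rule assms(1))
  also have "\<dots> = a - b\<^sup>2 / c" using c by (simp add: power2_eq_square field_simps)
  finally show ?thesis using c by (simp add: field_simps)
qed

text \<open>The quadratic form of \<open>u + t v\<close> is nonnegative for every \<open>t\<close>, so its discriminant is not positive.\<close>

lemma psd_cauchy_schwarz:
  assumes A: "psd m A" and u: "u \<in> carrier_vec m" and v: "v \<in> carrier_vec m"
  shows "(scalar_prod u (A *\<^sub>v v))\<^sup>2 \<le> scalar_prod u (A *\<^sub>v u) * scalar_prod v (A *\<^sub>v v)"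
proof (rule square_le_of_quadratic_nonneg)
  note c = psdD(1)[OF A]
  have Au: "A *\<^sub>v u \<in> carrier_vec m" and Av: "A *\<^sub>v v \<in> carrier_vec m" using c u v by auto
  show "0 \<le> scalar_prod v (A *\<^sub>v v)" by (rule psdD(3)[OF A v])
  have sym: "scalar_prod v (A *\<^sub>v u) = scalar_prod u (A *\<^sub>v v)"
  proof -
    have "scalar_prod (transpose_mat A *\<^sub>v v) u = scalar_prod v (A *\<^sub>v u)"
      by (rule transpose_vec_mult_scalar[OF c u v])
    then have "scalar_prod (A *\<^sub>v v) u = scalar_prod v (A *\<^sub>v u)" using psdD(2)[OF A] by simp
    then show ?thesis using comm_scalar_prod[OF Av u] by simp
  qed
  fix t :: real
  have tv: "t \<cdot>\<^sub>v v \<in> carrier_vec m" using v by simp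
  have "A *\<^sub>v (u + t \<cdot>\<^sub>v v) = A *\<^sub>v u + t \<cdot>\<^sub>v (A *\<^sub>v v)"
    by (simp add: mult_add_distrib_mat_vec[OF c u tv] mult_mat_vec[OF c v])
  then have "scalar_prod (u + t \<cdot>\<^sub>v v) (A *\<^sub>v (u + t \<cdot>\<^sub>v v)) =
      scalar_prod u (A *\<^sub>v u) + 2 * t * scalar_prod u (A *\<^sub>v v) + t\<^sup>2 * scalar_prod v (A *\<^sub>v v)"
    using u v tv Au Av
    by (simp add: add_scalar_prod_distrib[of _ m] scalar_prod_add_distrib[of _ m] sym power2_eq_square algebra_simps
          smult_scalar_prod_distrib[of _ m] scalar_prod_smult_distrib[of _ m])
  moreover have "0 \<le> scalar_prod (u + t \<cdot>\<^sub>v v) (A *\<^sub>v (u + t \<cdot>\<^sub>v v))"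
    by (rule psdD(3)[OF A]) (use u tv in auto)
  ultimately show "0 \<le> scalar_prod u (A *\<^sub>v u) + 2 * t * scalar_prod u (A *\<^sub>v v) + t\<^sup>2 * scalar_prod v (A *\<^sub>v v)"
    by simp
qed

lemma scalar_prod_self_nonneg: "0 \<le> scalar_prod v (v :: real Matrix.vec)"
  unfolding scalar_prod_def by (intro sum_nonneg) auto

lemma scalar_prod_self_pos:
  fixes v :: "real Matrix.vec"
  assumes "v \<in> carrier_vec m" "v \<noteq> 0\<^sub>v m"
  shows "0 < scalar_prod v v"
proof -
  obtain i where i: "i < m" "v $ i \<noteq> 0" using assms by (metis carrier_vecD eq_vecI index_zero_vec)
  have "0 < v $ i * v $ i" using i by (metis not_real_square_gt_zero)
  also have "\<dots> \<le> scalar_prod v v"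
    unfolding scalar_prod_def using assms i by (intro member_le_sum) auto
  finally show ?thesis .
qed

lemma scalar_prod_cauchy_schwarz:
  fixes u v :: "real Matrix.vec"
  assumes "u \<in> carrier_vec m" "v \<in> carrier_vec m"
  shows "(scalar_prod u v)\<^sup>2 \<le> scalar_prod u u * scalar_prod v v"
  using Cauchy_Schwarz_ineq_sum[of "\<lambda>i. u $ i" "\<lambda>i. v $ i" "{0..<m}"] assms
  by (simp add: scalar_prod_def power2_eq_square)

lemma mult_mat_vec_bounded:
  fixes N :: "real mat"
  assumes N: "N \<in> carrier_mat m m"
  obtains c where "0 < c" "\<And>w. w \<in> carrier_vec m \<Longrightarrow> scalar_prod (N *\<^sub>v w) (N *\<^sub>v w) \<le> c * scalar_prod w w"
proof
  define c where "c = (\<Sum>i<m. scalar_prod (row N i) (row N i)) + 1"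
  show "0 < c" unfolding c_def using sum_nonneg[of "{..<m}" "\<lambda>i. scalar_prod (row N i) (row N i)"]
    by (simp add: scalar_prod_self_nonneg add_nonneg_pos)
  fix w :: "real Matrix.vec" assume w: "w \<in> carrier_vec m"
  have "scalar_prod (N *\<^sub>v w) (N *\<^sub>v w) = (\<Sum>i<m. (scalar_prod (row N i) w)\<^sup>2)"
    using N by (simp add: scalar_prod_def[of "N *\<^sub>v w"] power2_eq_square lessThan_atLeast0)
  also have "\<dots> \<le> (\<Sum>i<m. scalar_prod (row N i) (row N i) * scalar_prod w w)"
    using N w by (intro sum_mono scalar_prod_cauchy_schwarz[of _ m]) auto
  also have "\<dots> = (\<Sum>i<m. scalar_prod (row N i) (row N i)) * scalar_prod w w"
    by (simp add: sum_distrib_right)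
  also have "\<dots> \<le> c * scalar_prod w w" unfolding c_def
    using scalar_prod_self_nonneg[of w] by (intro mult_right_mono) auto
  finally show "scalar_prod (N *\<^sub>v w) (N *\<^sub>v w) \<le> c * scalar_prod w w" .
qed

lemma quadratic_form_bounded:
  fixes N :: "real mat"
  assumes N: "N \<in> carrier_mat m m"
  obtains c where "0 < c" "\<And>w. w \<in> carrier_vec m \<Longrightarrow> \<bar>scalar_prod w (N *\<^sub>v w)\<bar> \<le> c * scalar_prod w w"
proof -
  obtain c where c: "0 < c" "\<And>w. w \<in> carrier_vec m \<Longrightarrow> scalar_prod (N *\<^sub>v w) (N *\<^sub>v w) \<le> c * scalar_prod w w"
    using mult_mat_vec_bounded[OF N] by blast
  show thesis
  proof (rule that[of "sqrt c"])
    fix w :: "real Matrix.vec" assume w: "w \<in> carrier_vec m"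
    have "(scalar_prod w (N *\<^sub>v w))\<^sup>2 \<le> scalar_prod w w * scalar_prod (N *\<^sub>v w) (N *\<^sub>v w)"
      using w N by (intro scalar_prod_cauchy_schwarz) auto
    also have "\<dots> \<le> scalar_prod w w * (c * scalar_prod w w)"
      using c(2)[OF w] scalar_prod_self_nonneg by (intro mult_left_mono)
    finally have "(scalar_prod w (N *\<^sub>v w))\<^sup>2 \<le> c * (scalar_prod w w)\<^sup>2"
      by (simp add: power2_eq_square ac_simps)
    from real_sqrt_le_mono[OF this] show "\<bar>scalar_prod w (N *\<^sub>v w)\<bar> \<le> sqrt c * scalar_prod w w"
      using scalar_prod_self_nonneg[of w] by (simp add: real_sqrt_mult)
  qed (use c in auto)
qed

lemma inverse_exists:
  fixes A :: "real mat"
  assumes A: "A \<in> carrier_mat m m" and d: "Determinant.det A \<noteq> 0"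
  shows "inv_mat A \<in> carrier_mat m m" "A * inv_mat A = 1\<^sub>m m" "inv_mat A * A = 1\<^sub>m m"
proof -
  obtain B where B: "mat_inverse A = Some B"
    using mat_inverse(1)[OF A, where b = "()"] det_non_zero_imp_unit[OF A d, where b = "()"] by (cases "mat_inverse A") auto
  from mat_inverse(2)[OF A B] B
  show "inv_mat A \<in> carrier_mat m m" "A * inv_mat A = 1\<^sub>m m" "inv_mat A * A = 1\<^sub>m m"
    by (auto simp: inv_mat_def)
qed

text \<open>With \<open>w = M u\<close>, Cauchy-Schwarz for the form of \<open>M\<close> bounds \<open>w \<bullet> w\<close> by a multiple of \<open>u \<bullet> M u\<close>, and
  \<open>u = M\<inverse> w\<close> is bounded by a multiple of \<open>w\<close>. This is where invertibility turns into a quantitative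
  lower bound without a spectral decomposition.\<close>

lemma invertible_psd_coercive:
  assumes M: "psd m M" and d: "Determinant.det M \<noteq> 0"
  obtains \<kappa> where "0 < \<kappa>" "\<And>u. u \<in> carrier_vec m \<Longrightarrow> \<kappa> * scalar_prod u u \<le> scalar_prod u (M *\<^sub>v u)"
proof -
  note Mc = psdD(1)[OF M]
  note N = inverse_exists[OF Mc d]
  obtain c where c: "0 < c" "\<And>w. w \<in> carrier_vec m \<Longrightarrow>
      scalar_prod (inv_mat M *\<^sub>v w) (inv_mat M *\<^sub>v w) \<le> c * scalar_prod w w"
    using mult_mat_vec_bounded[OF N(1)] by blast
  obtain b where b: "0 < b" "\<And>w. w \<in> carrier_vec m \<Longrightarrow> \<bar>scalar_prod w (M *\<^sub>v w)\<bar> \<le> b * scalar_prod w w"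
    using quadratic_form_bounded[OF Mc] by blast
  show thesis
  proof (rule that[of "1 / (c * b)"])
    fix u :: "real Matrix.vec" assume u: "u \<in> carrier_vec m"
    define w where "w = M *\<^sub>v u"
    have w: "w \<in> carrier_vec m" unfolding w_def using Mc u by simp
    have uw: "inv_mat M *\<^sub>v w = u" unfolding w_def using N Mc u
      by (simp flip: assoc_mult_mat_vec)
    have q0: "0 \<le> scalar_prod u (M *\<^sub>v u)" by (rule psdD(3)[OF M u])
    have ww: "scalar_prod w w \<le> b * scalar_prod u (M *\<^sub>v u)"
    proof (cases "scalar_prod w w = 0")
      case True then show ?thesis using q0 b by simp
    next
      case False
      then have p: "scalar_prod w w > 0" using scalar_prod_self_nonneg[of w] by simp
      have "(scalar_prod w w)\<^sup>2 \<le> scalar_prod w (M *\<^sub>v w) * scalar_prod u (M *\<^sub>v u)"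
        using psd_cauchy_schwarz[OF M w u] unfolding w_def .
      also have "\<dots> \<le> (b * scalar_prod w w) * scalar_prod u (M *\<^sub>v u)"
        using b(2)[OF w] q0 by (intro mult_right_mono) auto
      finally have "scalar_prod w w * scalar_prod w w \<le> scalar_prod w w * (b * scalar_prod u (M *\<^sub>v u))"
        by (simp add: power2_eq_square ac_simps)
      then show ?thesis using p by (simp add: mult_le_cancel_left)
    qed
    have "scalar_prod u u \<le> c * scalar_prod w w" using c(2)[OF w] uw by simp
    also have "\<dots> \<le> c * (b * scalar_prod u (M *\<^sub>v u))" using ww c by (intro mult_left_mono) auto
    finally show "1 / (c * b) * scalar_prod u u \<le> scalar_prod u (M *\<^sub>v u)"
      using b c by (simp add: field_simps)
  qed (use b c in auto)
qed

lemma finite_eigenvalues: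
  fixes A :: "real mat"
  assumes "A \<in> carrier_mat m m" shows "finite {l. eigenvalue A l}"
proof -
  have "char_poly A \<noteq> 0"
    using degree_monic_char_poly[OF assms] by (metis coeff_0 zero_neq_one)
  then have "finite {l. poly (char_poly A) l = 0}" by (rule poly_roots_finite)
  then show ?thesis using eigenvalue_root_char_poly[OF assms] by simp
qed

text \<open>The supremum \<open>l\<close> of the Rayleigh quotient is an eigenvalue: otherwise \<open>l I - A\<close>, which is positive
  semidefinite, would be invertible and hence coercive, and the supremum could be lowered.\<close>

lemma quadratic_form_le_ch1:
  assumes A: "A \<in> carrier_mat m m" "transpose_mat A = A" and v: "v \<in> carrier_vec m"
  shows "scalar_prod v (A *\<^sub>v v) \<le> ch1 A * scalar_prod v v"
proof (cases "v = 0\<^sub>v m")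
  case True then show ?thesis using A by (simp add: scalar_prod_def)
next
  case v0: False
  define Q where "Q = {scalar_prod u (A *\<^sub>v u) / scalar_prod u u | u. u \<in> carrier_vec m \<and> u \<noteq> 0\<^sub>v m}"
  obtain b where b: "0 < b" "\<And>w. w \<in> carrier_vec m \<Longrightarrow> \<bar>scalar_prod w (A *\<^sub>v w)\<bar> \<le> b * scalar_prod w w"
    using quadratic_form_bounded[OF A(1)] by blast
  have bdd: "bdd_above Q"
  proof (rule bdd_aboveI[of _ b])
    fix q assume "q \<in> Q"
    then obtain u where u: "u \<in> carrier_vec m" "u \<noteq> 0\<^sub>v m" and q: "q = scalar_prod u (A *\<^sub>v u) / scalar_prod u u"
      unfolding Q_def by auto
    show "q \<le> b" using b(2)[OF u(1)] scalar_prod_self_pos[OF u] q by (simp add: divide_le_eq)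
  qed
  have ne: "Q \<noteq> {}" unfolding Q_def using v v0 by auto
  define l where "l = Sup Q"
  have le: "scalar_prod u (A *\<^sub>v u) \<le> l * scalar_prod u u" if u: "u \<in> carrier_vec m" for u
  proof (cases "u = 0\<^sub>v m")
    case True then show ?thesis using A by (simp add: scalar_prod_def)
  next
    case False
    have "scalar_prod u (A *\<^sub>v u) / scalar_prod u u \<le> l" unfolding l_def
      by (rule cSup_upper[OF _ bdd]) (use u False in \<open>auto simp: Q_def\<close>)
    then show ?thesis using scalar_prod_self_pos[OF u False] by (simp add: divide_le_eq)
  qed
  define M where "M = - char_matrix A l"
  have Mc: "M \<in> carrier_mat m m" unfolding M_def char_matrix_def using A by auto
  have Mq: "scalar_prod u (M *\<^sub>v u) = l * scalar_prod u u - scalar_prod u (A *\<^sub>v u)" if u: "u \<in> carrier_vec m" for u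
  proof -
    have "(M *\<^sub>v u) $ i = l * u $ i - (A *\<^sub>v u) $ i" if i: "i < m" for i
    proof -
      have "(M *\<^sub>v u) $ i = (\<Sum>j<m. (l * (if i = j then 1 else 0) - A $$ (i, j)) * u $ j)"
        using i A u unfolding M_def char_matrix_def
        by (auto simp: scalar_prod_def lessThan_atLeast0 sum_negf[symmetric] intro!: sum.cong) (simp add: algebra_simps)
      also have "\<dots> = (\<Sum>j<m. (if i = j then l * u $ j else 0)) - (\<Sum>j<m. A $$ (i, j) * u $ j)"
        unfolding sum_subtractf[symmetric] by (intro sum.cong) (auto simp: algebra_simps)
      also have "\<dots> = l * u $ i - (A *\<^sub>v u) $ i"
        using i A u by (simp add: scalar_prod_def lessThan_atLeast0)
      finally show ?thesis .
    qed
    then have "scalar_prod u (M *\<^sub>v u) = (\<Sum>i = 0..<m. u $ i * (l * u $ i - (A *\<^sub>v u) $ i))"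
      using u Mc by (auto simp: scalar_prod_def[of u] simp del: index_mult_mat_vec intro!: sum.cong)
    then show ?thesis using u A
      by (simp add: scalar_prod_def[of u] algebra_simps sum_subtractf sum_distrib_left del: index_mult_mat_vec)
  qed
  have sym: "transpose_mat M = M"
  proof (rule eq_matI)
    fix i j assume ij: "i < dim_row M" "j < dim_col M"
    have "A $$ (j, i) = A $$ (i, j)"
      using arg_cong[OF A(2), of "\<lambda>X. X $$ (i, j)"] ij Mc A(1) by simp
    then show "transpose_mat M $$ (i, j) = M $$ (i, j)"
      using ij Mc A(1) unfolding M_def char_matrix_def by auto
  qed (use Mc in auto)
  have "psd m M" unfolding psd_def using Mc sym Mq le by simp
  have "Determinant.det M = 0"
  proof (rule ccontr)
    assume "Determinant.det M \<noteq> 0"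
    then obtain \<kappa> where \<kappa>: "0 < \<kappa>" "\<And>u. u \<in> carrier_vec m \<Longrightarrow> \<kappa> * scalar_prod u u \<le> scalar_prod u (M *\<^sub>v u)"
      using invertible_psd_coercive[OF \<open>psd m M\<close>] by blast
    have "l \<le> l - \<kappa>"
    proof -
      have "Sup Q \<le> l - \<kappa>"
      proof (rule cSup_least[OF ne])
        fix q assume "q \<in> Q"
        then obtain u where u: "u \<in> carrier_vec m" "u \<noteq> 0\<^sub>v m" and q: "q = scalar_prod u (A *\<^sub>v u) / scalar_prod u u"
          unfolding Q_def by auto
        have "scalar_prod u (A *\<^sub>v u) \<le> (l - \<kappa>) * scalar_prod u u"
          using \<kappa>(2)[OF u(1)] Mq[OF u(1)] by (simp add: algebra_simps)
        then show "q \<le> l - \<kappa>" using q scalar_prod_self_pos[OF u] by (simp add: divide_le_eq)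
      qed
      then show "l \<le> l - \<kappa>" by (simp add: l_def)
    qed
    then show False using \<kappa>(1) by simp
  qed
  then have "eigenvalue A l"
    unfolding M_def eigenvalue_det[OF A(1)] using det_0_negate[of "char_matrix A l" m] A(1)
    by (auto simp: char_matrix_def)
  then have "l \<le> ch1 A" unfolding ch1_def using finite_eigenvalues[OF A(1)] by (intro Max_ge) auto
  then show ?thesis using le[OF v] scalar_prod_self_nonneg[of v]
    by (meson mult_right_mono order_trans)
qed

lemma pos_def_det_nonzero:
  assumes "pos_def m A" shows "Determinant.det A \<noteq> 0"
proof
  note A = pos_defD[OF assms]
  assume "Determinant.det A = 0"
  then obtain v where "v \<in> carrier_vec m" "v \<noteq> 0\<^sub>v m" "A *\<^sub>v v = 0\<^sub>v m"
    using det_0_iff_vec_prod_zero[OF A(1)] by auto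
  then show False using A(3)[of v] by (simp add: scalar_prod_def)
qed

text \<open>The segment from the identity to \<open>A\<close> consists of positive definite matrices. Their determinants do
  not vanish, and at the identity the determinant is 1, so it cannot change sign on the way.\<close>

lemma pos_def_det_pos:
  assumes "pos_def m A" shows "0 < Determinant.det A"
proof (rule ccontr)
  assume neg: "\<not> 0 < Determinant.det A"
  note A = pos_defD[OF assms]
  define F where "F t = Matrix.mat m m (\<lambda>(i, j). t * A $$ (i, j) + (1 - t) * (if i = j then 1 else 0))" for t :: real
  have Fc: "F t \<in> carrier_mat m m" for t unfolding F_def by simp
  have F0: "F 0 = 1\<^sub>m m" unfolding F_def by (intro eq_matI) auto
  have F1: "F 1 = A" unfolding F_def using A(1) by (intro eq_matI) auto
  have cont: "isCont (\<lambda>t. Determinant.det (F t)) t" for t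
  proof -
    have "Determinant.det (F t) = (\<Sum>p\<in>{p. p permutes {0..<m}}.
        signof p * (\<Prod>i = 0..<m. t * A $$ (i, p i) + (1 - t) * (if i = p i then 1 else 0)))" for t
      unfolding det_def'[OF Fc]
    proof (intro sum.cong refl arg_cong2[where f="(*)"] prod.cong)
      fix p i assume "p \<in> {p. p permutes {0..<m}}" "i \<in> {0..<m}"
      then have "p i < m" "i < m" using permutes_in_image[of p "{0..<m}" i] by auto
      then show "F t $$ (i, p i) = t * A $$ (i, p i) + (1 - t) * (if i = p i then 1 else 0)"
        unfolding F_def by simp
    qed
    then show ?thesis by (simp only:) (intro continuous_intros)
  qed
  obtain t where t: "0 \<le> t" "t \<le> 1" "Determinant.det (F t) = 0"
    using IVT2[of "\<lambda>t. Determinant.det (F t)" 1 0 0] neg cont unfolding F0 F1 by auto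
  have "pos_def m (F t)" unfolding pos_def_def
  proof (intro conjI ballI impI Fc)
    show "transpose_mat (F t) = F t"
    proof (rule eq_matI)
      fix i j assume ij: "i < dim_row (F t)" "j < dim_col (F t)"
      have "A $$ (j, i) = A $$ (i, j)"
        using arg_cong[OF A(2), of "\<lambda>X. X $$ (i, j)"] ij Fc A(1) by (simp add: F_def)
      then show "transpose_mat (F t) $$ (i, j) = F t $$ (i, j)" using ij unfolding F_def by auto
    qed (auto simp: F_def)
    fix v :: "real Matrix.vec" assume v: "v \<in> carrier_vec m" "v \<noteq> 0\<^sub>v m"
    have "(F t *\<^sub>v v) $ i = t * (A *\<^sub>v v) $ i + (1 - t) * v $ i" if i: "i < m" for i
    proof -
      have "(F t *\<^sub>v v) $ i = (\<Sum>j<m. (t * A $$ (i, j) + (1 - t) * (if i = j then 1 else 0)) * v $ j)"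
        using i v unfolding F_def by (auto simp: scalar_prod_def lessThan_atLeast0 intro!: sum.cong)
      also have "\<dots> = t * (\<Sum>j<m. A $$ (i, j) * v $ j) + (\<Sum>j<m. (if i = j then (1 - t) * v $ j else 0))"
        unfolding sum_distrib_left sum.distrib[symmetric] by (intro sum.cong) (auto simp: algebra_simps)
      also have "\<dots> = t * (A *\<^sub>v v) $ i + (1 - t) * v $ i"
        using i A(1) v by (simp add: scalar_prod_def lessThan_atLeast0)
      finally show ?thesis .
    qed
    then have "scalar_prod v (F t *\<^sub>v v) = (\<Sum>i = 0..<m. v $ i * (t * (A *\<^sub>v v) $ i + (1 - t) * v $ i))"
      using v Fc[of t] by (auto simp: scalar_prod_def[of v] simp del: index_mult_mat_vec intro!: sum.cong)
    then have "scalar_prod v (F t *\<^sub>v v) = t * scalar_prod v (A *\<^sub>v v) + (1 - t) * scalar_prod v v"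
      using v A(1) Fc[of t] by (simp add: scalar_prod_def[of v] algebra_simps sum.distrib sum_distrib_left sum_subtractf del: index_mult_mat_vec)
    moreover have "0 < t * scalar_prod v (A *\<^sub>v v) + (1 - t) * scalar_prod v v"
      using A(3)[OF v] scalar_prod_self_pos[OF v] t
      by (cases "t = 0") (auto intro!: add_pos_nonneg mult_nonneg_nonneg)
    ultimately show "0 < scalar_prod v (F t *\<^sub>v v)" by simp
  qed
  then show False using pos_def_det_nonzero t by blast
qed

text \<open>The entries of a positive definite matrix are at most its largest eigenvalue, by
  Cauchy-Schwarz applied to coordinate vectors; the Leibniz formula then bounds the determinant.
  The factor \<open>m ^ m\<close> lost against the product of the eigenvalues is harmless for polylogarithmic \<open>m\<close>.\<close>

lemma pos_def_det_le:
  assumes pd: "pos_def m A" and L: "ch1 A \<le> L"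
  shows "Determinant.det A \<le> (real m * L) ^ m"
proof -
  note A = pos_defD[OF pd]
  have unit: "scalar_prod (unit_vec m i) (A *\<^sub>v unit_vec m j) = A $$ (i, j)" if "i < m" "j < m" for i j
    using that A(1) by (simp add: scalar_prod_left_unit scalar_prod_right_unit)
  have diag: "0 \<le> A $$ (i, i)" "A $$ (i, i) \<le> L" if i: "i < m" for i
  proof -
    show "0 \<le> A $$ (i, i)" using psdD(3)[OF pos_def_imp_psd[OF pd], of "unit_vec m i"] unit[OF i i] by simp
    have "A $$ (i, i) \<le> ch1 A * scalar_prod (unit_vec m i) (unit_vec m i)"
      using quadratic_form_le_ch1[OF A(1,2), of "unit_vec m i"] unit[OF i i] by simp
    also have "\<dots> = ch1 A" using i by (simp add: scalar_prod_left_unit)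
    finally show "A $$ (i, i) \<le> L" using L by simp
  qed
  have entry: "\<bar>A $$ (i, j)\<bar> \<le> L" if ij: "i < m" "j < m" for i j
  proof -
    have "(A $$ (i, j))\<^sup>2 \<le> A $$ (i, i) * A $$ (j, j)"
      using psd_cauchy_schwarz[OF pos_def_imp_psd[OF pd], of "unit_vec m i" "unit_vec m j"] unit ij by simp
    also have "\<dots> \<le> L * L" using diag[OF ij(1)] diag[OF ij(2)] by (intro mult_mono) linarith+
    finally show ?thesis using diag[OF ij(1)] abs_le_square_iff[of "A $$ (i, j)" L] by (simp add: power2_eq_square)
  qed
  have "Determinant.det A \<le> \<bar>\<Sum>p\<in>{p. p permutes {0..<m}}. signof p * (\<Prod>i = 0..<m. A $$ (i, p i))\<bar>"
    using det_def'[OF A(1)] by simp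
  also have "\<dots> \<le> (\<Sum>p\<in>{p. p permutes {0..<m}}. \<bar>signof p * (\<Prod>i = 0..<m. A $$ (i, p i))\<bar>)"
    by (rule sum_abs)
  also have "\<dots> \<le> (\<Sum>p\<in>{p. p permutes {0..<m}}. L ^ m)"
  proof (rule sum_mono)
    fix p assume "p \<in> {p. p permutes {0..<m}}"
    then have p: "i < m \<Longrightarrow> p i < m" for i by (auto dest: permutes_in_image[of p _ i])
    have "\<bar>signof p * (\<Prod>i = 0..<m. A $$ (i, p i))\<bar> = (\<Prod>i = 0..<m. \<bar>A $$ (i, p i)\<bar>)"
      by (simp add: abs_mult abs_prod sign_def)
    also have "\<dots> \<le> (\<Prod>i = 0..<m. L)" using entry p by (intro prod_mono) auto
    finally show "\<bar>signof p * (\<Prod>i = 0..<m. A $$ (i, p i))\<bar> \<le> L ^ m" by simp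
  qed
  also have "\<dots> = fact m * L ^ m" by (simp add: card_permutations)
  also have "\<dots> \<le> real m ^ m * L ^ m"
  proof (rule mult_right_mono)
    show "(fact m :: real) \<le> real m ^ m" using fact_le_power[of m] by simp
    have "0 \<le> L" if "0 < m" using diag[OF that] by linarith
    then show "0 \<le> L ^ m" by (cases m) auto
  qed
  finally show ?thesis by (simp add: power_mult_distrib)
qed

section \<open>Gaussian densities\<close>

lemma pos_def_inv_mat:
  assumes V: "pos_def m V" shows "pos_def m (inv_mat V)"
  unfolding pos_def_def
proof (intro conjI ballI impI)
  note V' = pos_defD[OF V]
  note I = inverse_exists[OF V'(1) pos_def_det_nonzero[OF V]]
  show "inv_mat V \<in> carrier_mat m m" by (rule I)
  have tc: "transpose_mat (inv_mat V) \<in> carrier_mat m m" using I by simp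
  have "transpose_mat (inv_mat V) * V = 1\<^sub>m m"
    using transpose_mult[OF V'(1) I(1)] I(2) V'(2) by simp
  have "transpose_mat (inv_mat V) = transpose_mat (inv_mat V) * (V * inv_mat V)"
    using I tc by simp
  also have "\<dots> = (transpose_mat (inv_mat V) * V) * inv_mat V"
    using assoc_mult_mat[OF tc V'(1) I(1)] by simp
  also have "\<dots> = inv_mat V" using \<open>transpose_mat (inv_mat V) * V = 1\<^sub>m m\<close> I by simp
  finally show "transpose_mat (inv_mat V) = inv_mat V" .
  fix u :: "real Matrix.vec" assume u: "u \<in> carrier_vec m" "u \<noteq> 0\<^sub>v m"
  define w where "w = inv_mat V *\<^sub>v u"
  have w: "w \<in> carrier_vec m" unfolding w_def using I u by simp
  have Vw: "V *\<^sub>v w = u" unfolding w_def using I u V' by (simp flip: assoc_mult_mat_vec)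
  have "w \<noteq> 0\<^sub>v m" using Vw u V'(1) by auto
  then have "0 < scalar_prod w (V *\<^sub>v w)" using V'(3) w by blast
  then show "0 < scalar_prod u (inv_mat V *\<^sub>v u)"
    unfolding Vw w_def[symmetric] using comm_scalar_prod[OF u(1) w] by simp
qed

text \<open>Cauchy-Schwarz in the inner product of \<open>V\<close>, applied to \<open>u\<close> and \<open>V\<inverse> u\<close>, turns the upper bound for
  \<open>V\<close> into a lower bound for its inverse.\<close>

lemma inv_mat_quadratic_lower:
  assumes V: "pos_def m V" and u: "u \<in> carrier_vec m"
  shows "scalar_prod u u \<le> ch1 V * scalar_prod u (inv_mat V *\<^sub>v u)"
proof (cases "u = 0\<^sub>v m")
  case True
  then show ?thesis using pos_defD(1)[OF pos_def_inv_mat[OF V]] by (simp add: scalar_prod_def)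
next
  case False
  note V' = pos_defD[OF V]
  note I = inverse_exists[OF V'(1) pos_def_det_nonzero[OF V]]
  define w where "w = inv_mat V *\<^sub>v u"
  have w: "w \<in> carrier_vec m" unfolding w_def using I u by simp
  have Vw: "V *\<^sub>v w = u" unfolding w_def using I u V' by (simp flip: assoc_mult_mat_vec)
  have uu: "0 < scalar_prod u u" by (rule scalar_prod_self_pos[OF u False])
  have uw: "0 < scalar_prod u w" unfolding w_def
    using pos_defD(3)[OF pos_def_inv_mat[OF V] u False] .
  have "(scalar_prod u u)\<^sup>2 \<le> scalar_prod u (V *\<^sub>v u) * scalar_prod w (V *\<^sub>v w)"
    using psd_cauchy_schwarz[OF pos_def_imp_psd[OF V] u w] unfolding Vw .
  also have "\<dots> = scalar_prod u (V *\<^sub>v u) * scalar_prod u w"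
    unfolding Vw using comm_scalar_prod[OF u w] by simp
  also have "\<dots> \<le> (ch1 V * scalar_prod u u) * scalar_prod u w"
    using quadratic_form_le_ch1[OF V'(1,2) u] uw by (intro mult_right_mono) auto
  finally have "scalar_prod u u * scalar_prod u u \<le> scalar_prod u u * (ch1 V * scalar_prod u w)"
    by (simp add: power2_eq_square ac_simps)
  then show ?thesis using uu unfolding w_def by (simp add: mult_le_cancel_left)
qed

lemma bij_betw_pick:
  assumes "finite \<gamma>" shows "bij_betw (pick \<gamma>) {0..<card \<gamma>} \<gamma>"
proof -
  have "inj_on (pick \<gamma>) {0..<card \<gamma>}"
    by (rule inj_onI) (metis atLeastLessThan_iff nat_neq_iff pick_mono_le)
  moreover have "pick \<gamma> ` {0..<card \<gamma>} \<subseteq> \<gamma>" using pick_in_set_le by auto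
  ultimately show ?thesis
    using card_image[of "pick \<gamma>" "{0..<card \<gamma>}"] card_subset_eq[OF assms]
    by (auto simp: bij_betw_def)
qed

lemma subvec_norm:
  assumes "finite \<gamma>"
  shows "scalar_prod (subvec \<gamma> \<beta>) (subvec \<gamma> \<beta>) = (\<Sum>j\<in>\<gamma>. (\<beta> j)\<^sup>2)"
proof -
  have "scalar_prod (subvec \<gamma> \<beta>) (subvec \<gamma> \<beta>) = (\<Sum>i\<in>{0..<card \<gamma>}. (\<beta> (pick \<gamma> i))\<^sup>2)"
    unfolding scalar_prod_def subvec_def by (auto simp: power2_eq_square)
  also have "\<dots> = (\<Sum>j\<in>\<gamma>. (\<beta> j)\<^sup>2)" by (rule sum.reindex_bij_betw[OF bij_betw_pick[OF assms]])
  finally show ?thesis .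
qed

definition gaussian_density :: "nat set \<Rightarrow> real mat \<Rightarrow> (nat \<Rightarrow> real) \<Rightarrow> real" where
  "gaussian_density \<gamma> A \<beta> = exp (- scalar_prod (subvec \<gamma> \<beta>) (inv_mat A *\<^sub>v subvec \<gamma> \<beta>) / 2)
        / sqrt ((2 * pi) ^ card \<gamma> * Determinant.det A)"

text \<open>The empty model is exempt because a matrix of dimension 0 has no eigenvalues and \<open>ch1\<close> is then
  unspecified.\<close>

definition spectrum_within :: "real \<Rightarrow> nat set \<Rightarrow> real mat \<Rightarrow> bool" where
  "spectrum_within \<Lambda> \<gamma> A \<longleftrightarrow> pos_def (card \<gamma>) A \<and> (\<gamma> \<noteq> {} \<longrightarrow> ch1 A \<le> \<Lambda> \<and> ch1 (inv_mat A) \<le> \<Lambda>)"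

lemma spectrum_within_facts:
  assumes \<gamma>: "finite \<gamma>" and S: "spectrum_within \<Lambda> \<gamma> A" and L: "1 \<le> \<Lambda>"
  defines "m \<equiv> card \<gamma>"
  shows "scalar_prod (subvec \<gamma> \<beta>) (inv_mat A *\<^sub>v subvec \<gamma> \<beta>) \<le> \<Lambda> * (\<Sum>j\<in>\<gamma>. (\<beta> j)\<^sup>2)" (is ?up)
    and "(\<Sum>j\<in>\<gamma>. (\<beta> j)\<^sup>2) / \<Lambda> \<le> scalar_prod (subvec \<gamma> \<beta>) (inv_mat A *\<^sub>v subvec \<gamma> \<beta>)" (is ?lo)
    and "0 < Determinant.det A"
    and "Determinant.det A \<le> (real m * \<Lambda>) ^ m" (is ?det_up)
    and "1 \<le> (real m * \<Lambda>) ^ m * Determinant.det A" (is ?det_lo)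
proof -
  have A: "pos_def m A" using S unfolding spectrum_within_def m_def by simp
  note I = inverse_exists[OF pos_defD(1)[OF A] pos_def_det_nonzero[OF A]]
  note iA = pos_def_inv_mat[OF A]
  have v: "subvec \<gamma> \<beta> \<in> carrier_vec m" unfolding subvec_def m_def by simp
  note s = subvec_norm[OF \<gamma>, of \<beta>, symmetric]
  show d: "0 < Determinant.det A" by (rule pos_def_det_pos[OF A])
  have dd: "Determinant.det A * Determinant.det (inv_mat A) = 1"
    using det_mult[OF pos_defD(1)[OF A] I(1)] I(2) by simp
  have "?up \<and> ?lo \<and> ?det_up \<and> ?det_lo"
  proof (cases "\<gamma> = {}")
    case True
    then have m0: "m = 0" unfolding m_def by simp
    have "Determinant.det A = 1" using pos_defD(1)[OF A] unfolding m0 by (simp add: det_dim_zero)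
    moreover have "scalar_prod (subvec \<gamma> \<beta>) w = 0" if "w \<in> carrier_vec m" for w
      using that m0 by (simp add: scalar_prod_def)
    ultimately show ?thesis using True m0 I(1) v by simp
  next
    case False
    then have ch: "ch1 A \<le> \<Lambda>" "ch1 (inv_mat A) \<le> \<Lambda>" using S unfolding spectrum_within_def by auto
    have q0: "0 \<le> scalar_prod (subvec \<gamma> \<beta>) (inv_mat A *\<^sub>v subvec \<gamma> \<beta>)"
      by (rule psdD(3)[OF pos_def_imp_psd[OF iA] v])
    have ?up unfolding s
      using quadratic_form_le_ch1[OF pos_defD(1,2)[OF iA] v] mult_right_mono[OF ch(2) scalar_prod_self_nonneg]
      by (rule order_trans)
    moreover have ?lo unfolding s
      using order_trans[OF inv_mat_quadratic_lower[OF A v] mult_right_mono[OF ch(1) q0]] L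
      by (simp add: divide_le_eq mult.commute)
    moreover have ?det_up by (rule pos_def_det_le[OF A ch(1)])
    moreover have ?det_lo
      using mult_right_mono[OF pos_def_det_le[OF iA ch(2)], of "Determinant.det A"] d dd
      by (simp add: mult.commute)
    ultimately show ?thesis by simp
  qed
  then show ?up ?lo ?det_up ?det_lo by auto
qed

text \<open>The bounds for the determinant and its reciprocal are at least 1, so they also bound the square
  roots in the normalising constant. This avoids roots and costs only a power.\<close>

lemma gaussian_density_upper:
  assumes \<gamma>: "finite \<gamma>" and S: "spectrum_within \<Lambda> \<gamma> A" and L: "1 \<le> \<Lambda>"
  shows "gaussian_density \<gamma> A \<beta> \<le> exp (- (\<Sum>j\<in>\<gamma>. (\<beta> j)\<^sup>2) / (2 * \<Lambda>)) * (real (card \<gamma>) * \<Lambda>) ^ card \<gamma>"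
proof -
  define m where "m = card \<gamma>"
  define D where "D = (2 * pi) ^ m * Determinant.det A"
  define c where "c = (real m * \<Lambda>) ^ m"
  note f = spectrum_within_facts[OF assms, folded m_def]
  have c1: "1 \<le> c"
  proof (cases "m = 0")
    case True then show ?thesis unfolding c_def by simp
  next
    case False
    have "1 * 1 \<le> real m * \<Lambda>" using False L by (intro mult_mono) auto
    then show ?thesis unfolding c_def by simp
  qed
  have "1 \<le> c * Determinant.det A" using f(5) unfolding c_def .
  also have "\<dots> \<le> c * D"
  proof -
    have "1 \<le> (2 * pi) ^ m" using pi_ge_two by (intro one_le_power) linarith
    from mult_right_mono[OF this, of "Determinant.det A"] f(3) c1
    show ?thesis unfolding D_def by (intro mult_left_mono) auto
  qed
  finally have cD: "1 \<le> c * D" .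
  have D: "0 < D" unfolding D_def using f(3) by simp
  have "1 * 1 \<le> c * (c * D)" using cD c1 by (intro mult_mono) auto
  then have "1 \<le> sqrt (c\<^sup>2 * D)" by (simp add: power2_eq_square mult.assoc)
  then have "1 \<le> c * sqrt D" using c1 by (simp add: real_sqrt_mult)
  then have inv: "1 / sqrt D \<le> c" using D by (simp add: divide_le_eq)
  have "gaussian_density \<gamma> A \<beta> = exp (- scalar_prod (subvec \<gamma> \<beta>) (inv_mat A *\<^sub>v subvec \<gamma> \<beta>) / 2) * (1 / sqrt D)"
    unfolding gaussian_density_def D_def m_def by simp
  also have "\<dots> \<le> exp (- (\<Sum>j\<in>\<gamma>. (\<beta> j)\<^sup>2) / (2 * \<Lambda>)) * c"
  proof (intro mult_mono inv)
    have "(\<Sum>j\<in>\<gamma>. (\<beta> j)\<^sup>2) / (2 * \<Lambda>) = (\<Sum>j\<in>\<gamma>. (\<beta> j)\<^sup>2) / \<Lambda> / 2" by simp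
    also have "\<dots> \<le> scalar_prod (subvec \<gamma> \<beta>) (inv_mat A *\<^sub>v subvec \<gamma> \<beta>) / 2"
      by (rule divide_right_mono[OF f(2)]) simp
    finally show "exp (- scalar_prod (subvec \<gamma> \<beta>) (inv_mat A *\<^sub>v subvec \<gamma> \<beta>) / 2) \<le> exp (- (\<Sum>j\<in>\<gamma>. (\<beta> j)\<^sup>2) / (2 * \<Lambda>))"
      by simp
  qed (use D in auto)
  finally show ?thesis unfolding c_def m_def .
qed

lemma gaussian_density_lower:
  assumes \<gamma>: "finite \<gamma>" and S: "spectrum_within \<Lambda> \<gamma> A" and L: "1 \<le> \<Lambda>"
  shows "exp (- \<Lambda> * (\<Sum>j\<in>\<gamma>. (\<beta> j)\<^sup>2) / 2) / (2 * pi * real (card \<gamma>) * \<Lambda>) ^ card \<gamma> \<le> gaussian_density \<gamma> A \<beta>"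
proof -
  define m where "m = card \<gamma>"
  define D where "D = (2 * pi) ^ m * Determinant.det A"
  define c where "c = (2 * pi * real m * \<Lambda>) ^ m"
  note f = spectrum_within_facts[OF assms, folded m_def]
  have c1: "1 \<le> c"
  proof (cases "m = 0")
    case True then show ?thesis unfolding c_def by simp
  next
    case False
    have "1 * 1 * 1 \<le> (2 * pi) * real m * \<Lambda>" using False L pi_ge_two by (intro mult_mono) auto
    then show ?thesis unfolding c_def by simp
  qed
  have D: "0 < D" unfolding D_def using f(3) by simp
  have "D \<le> (2 * pi) ^ m * (real m * \<Lambda>) ^ m" unfolding D_def using f(4) by (intro mult_left_mono) auto
  also have "\<dots> = c" unfolding c_def by (simp only: power_mult_distrib[symmetric] mult.assoc)
  finally have "D \<le> c" .
  also have "c \<le> c\<^sup>2" using c1 by (simp add: power2_eq_square mult_le_cancel_left1)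
  finally have "sqrt D \<le> c" using c1 by (intro real_le_lsqrt) auto
  have "exp (- \<Lambda> * (\<Sum>j\<in>\<gamma>. (\<beta> j)\<^sup>2) / 2) / c \<le> exp (- \<Lambda> * (\<Sum>j\<in>\<gamma>. (\<beta> j)\<^sup>2) / 2) / sqrt D"
    using \<open>sqrt D \<le> c\<close> D c1 by (intro divide_left_mono mult_pos_pos) auto
  also have "\<dots> \<le> exp (- scalar_prod (subvec \<gamma> \<beta>) (inv_mat A *\<^sub>v subvec \<gamma> \<beta>) / 2) / sqrt D"
    using f(1) D by (intro divide_right_mono) auto
  finally show ?thesis unfolding gaussian_density_def c_def D_def m_def .
qed

interpretation lborel_product: product_sigma_finite "\<lambda>_::nat. lborel :: real measure"
  by standard

lemma gaussian_eq: "gaussian \<gamma> A = density (PiM \<gamma> (\<lambda>_. lborel)) (\<lambda>\<beta>. ennreal (gaussian_density \<gamma> A \<beta>))"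
  unfolding gaussian_def gaussian_density_def ..

lemma gaussian_density_measurable [measurable]:
  assumes \<gamma>: "finite \<gamma>" and A: "pos_def (card \<gamma>) A"
  shows "gaussian_density \<gamma> A \<in> borel_measurable (PiM \<gamma> (\<lambda>_. lborel))"
proof -
  define m where "m = card \<gamma>"
  have I: "inv_mat A \<in> carrier_mat m m"
    unfolding m_def using inverse_exists[OF pos_defD(1)[OF A] pos_def_det_nonzero[OF A]] by simp
  have q: "scalar_prod (subvec \<gamma> \<beta>) (inv_mat A *\<^sub>v subvec \<gamma> \<beta>)
     = (\<Sum>i<m. \<Sum>j<m. \<beta> (pick \<gamma> i) * (inv_mat A $$ (i, j) * \<beta> (pick \<gamma> j)))" for \<beta>
    using I by (auto simp: scalar_prod_def subvec_def m_def sum_distrib_left lessThan_atLeast0 intro!: sum.cong)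
  have [measurable]: "(\<lambda>\<beta> :: nat \<Rightarrow> real. \<beta> (pick \<gamma> i)) \<in> borel_measurable (PiM \<gamma> (\<lambda>_. lborel))" if "i < m" for i
  proof -
    have "pick \<gamma> i \<in> \<gamma>" using pick_in_set_le that unfolding m_def by blast
    from measurable_component_singleton[OF this, of "\<lambda>_. lborel :: real measure"] show ?thesis by simp
  qed
  show ?thesis unfolding gaussian_density_def q by measurable
qed

lemma nn_integral_exp_neg_square:
  fixes L :: real
  assumes L: "1 \<le> L"
  shows "(\<integral>\<^sup>+b. ennreal (exp (- b\<^sup>2 / (4 * L))) \<partial>lborel) \<le> ennreal (4 * L)"
proof -
  have "(\<integral>\<^sup>+b. ennreal (exp (- b\<^sup>2 / (4 * L))) \<partial>lborel)
     = (\<integral>\<^sup>+b. ennreal (sqrt (4 * (pi * L))) * ennreal (normal_density 0 (sqrt (2 * L)) b) \<partial>lborel)"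
    using L by (intro nn_integral_cong) (simp add: normal_density_def ennreal_mult[symmetric])
  also have "\<dots> = ennreal (sqrt (4 * (pi * L)))"
    using L by (subst nn_integral_cmult) (auto simp: nn_integral_normal_density)
  also have "\<dots> \<le> ennreal (4 * L)"
  proof (rule ennreal_leI)
    have "4 * (pi * L) \<le> 4 * (4 * (L * L))" using L pi_less_4 by (intro mult_mono) auto
    then show "sqrt (4 * (pi * L)) \<le> 4 * L" using L by (intro real_le_lsqrt) (auto simp: power2_eq_square)
  qed
  finally show ?thesis .
qed

lemma nn_integral_product_gaussian:
  assumes \<gamma>: "finite (\<gamma> :: nat set)" and L: "1 \<le> L"
  shows "(\<integral>\<^sup>+\<beta>. ennreal (exp (- (\<Sum>j\<in>\<gamma>. (\<beta> j)\<^sup>2) / (4 * L))) \<partial>PiM \<gamma> (\<lambda>_. lborel)) \<le> ennreal ((4 * L) ^ card \<gamma>)"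
proof -
  have "(\<integral>\<^sup>+\<beta>. ennreal (exp (- (\<Sum>j\<in>\<gamma>. (\<beta> j)\<^sup>2) / (4 * L))) \<partial>PiM \<gamma> (\<lambda>_. lborel))
     = (\<integral>\<^sup>+\<beta>. (\<Prod>j\<in>\<gamma>. ennreal (exp (- (\<beta> j)\<^sup>2 / (4 * L)))) \<partial>PiM \<gamma> (\<lambda>_. lborel))"
    using \<gamma> by (intro nn_integral_cong) (simp add: prod_ennreal exp_sum[symmetric] sum_negf sum_divide_distrib)
  also have "\<dots> = (\<Prod>j\<in>\<gamma>. \<integral>\<^sup>+b. ennreal (exp (- b\<^sup>2 / (4 * L))) \<partial>lborel)"
    by (rule lborel_product.product_nn_integral_prod[OF \<gamma>]) measurable
  also have "\<dots> \<le> (\<Prod>j\<in>\<gamma>. ennreal (4 * L))"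
    using nn_integral_exp_neg_square[OF L] by (intro prod_mono_ennreal)
  also have "\<dots> = ennreal ((4 * L) ^ card \<gamma>)" using L by (simp add: ennreal_power)
  finally show ?thesis .
qed

text \<open>Makes the constants of the Gaussian bounds uniform over models of size at most \<open>R\<close>.\<close>

lemma power_self_le:
  assumes "m \<le> (R::nat)" "1 \<le> a" "1 \<le> R" shows "(a * real m) ^ m \<le> (a * real R) ^ R"
proof -
  have "1 * 1 \<le> a * real R" using assms by (intro mult_mono) auto
  have "(a * real m) ^ m \<le> (a * real R) ^ m" using assms by (intro power_mono) auto
  also have "\<dots> \<le> (a * real R) ^ R" using assms \<open>1 * 1 \<le> a * real R\<close> by (intro power_increasing) auto
  finally show ?thesis .
qed

text \<open>Half of the exponent of the density is spent on the tail factor \<open>exp (- t\<^sup>2 / (4 \<Lambda>))\<close>; the other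
  half is integrated over the whole space. For \<open>t = 0\<close> this also bounds the total mass.\<close>

lemma gaussian_tail_mass:
  assumes \<gamma>: "finite \<gamma>" and S: "spectrum_within \<Lambda> \<gamma> A" and L: "1 \<le> \<Lambda>" and R: "card \<gamma> \<le> R" "1 \<le> R"
    and E: "E \<in> sets (PiM \<gamma> (\<lambda>_. lborel))" and T: "\<And>\<beta>. \<beta> \<in> E \<Longrightarrow> t\<^sup>2 \<le> (\<Sum>j\<in>\<gamma>. (\<beta> j)\<^sup>2)"
  shows "emeasure (gaussian \<gamma> A) E \<le> ennreal (exp (- t\<^sup>2 / (4 * \<Lambda>)) * (4 * \<Lambda>\<^sup>2 * real R) ^ R)"
proof -
  define m where "m = card \<gamma>"
  note [measurable] = gaussian_density_measurable[OF \<gamma>] E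
  have A: "pos_def (card \<gamma>) A" using S unfolding spectrum_within_def by simp
  have "emeasure (gaussian \<gamma> A) E = (\<integral>\<^sup>+\<beta>. ennreal (gaussian_density \<gamma> A \<beta>) * indicator E \<beta> \<partial>PiM \<gamma> (\<lambda>_. lborel))"
    unfolding gaussian_eq using A E by (subst emeasure_density) auto
  also have "\<dots> \<le> (\<integral>\<^sup>+\<beta>. ennreal (exp (- t\<^sup>2 / (4 * \<Lambda>)) * (real m * \<Lambda>) ^ m) *
        ennreal (exp (- (\<Sum>j\<in>\<gamma>. (\<beta> j)\<^sup>2) / (4 * \<Lambda>))) \<partial>PiM \<gamma> (\<lambda>_. lborel))"
  proof (rule nn_integral_mono)
    fix \<beta>
    show "ennreal (gaussian_density \<gamma> A \<beta>) * indicator E \<beta> \<le> ennreal (exp (- t\<^sup>2 / (4 * \<Lambda>)) * (real m * \<Lambda>) ^ m) *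
        ennreal (exp (- (\<Sum>j\<in>\<gamma>. (\<beta> j)\<^sup>2) / (4 * \<Lambda>)))"
    proof (cases "\<beta> \<in> E")
      case True
      define s where "s = (\<Sum>j\<in>\<gamma>. (\<beta> j)\<^sup>2)"
      have "gaussian_density \<gamma> A \<beta> \<le> exp (- s / (2 * \<Lambda>)) * (real m * \<Lambda>) ^ m"
        using gaussian_density_upper[OF \<gamma> S L] unfolding s_def m_def .
      also have "\<dots> \<le> exp (- t\<^sup>2 / (4 * \<Lambda>) + - s / (4 * \<Lambda>)) * (real m * \<Lambda>) ^ m"
        using T[OF True, folded s_def] L by (intro mult_right_mono) (auto simp: field_simps)
      finally show ?thesis using True L unfolding exp_add s_def
        by (simp add: ennreal_mult[symmetric] ennreal_leI ac_simps)
    qed simp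
  qed
  also have "\<dots> \<le> ennreal (exp (- t\<^sup>2 / (4 * \<Lambda>)) * (real m * \<Lambda>) ^ m) * ennreal ((4 * \<Lambda>) ^ m)"
    unfolding m_def
    using mult_left_mono[OF nn_integral_product_gaussian[OF \<gamma> L]]
    by (subst nn_integral_cmult) (auto intro!: borel_measurable_sum)
  also have "\<dots> = ennreal (exp (- t\<^sup>2 / (4 * \<Lambda>)) * (4 * \<Lambda>\<^sup>2 * real m) ^ m)"
    using L by (simp add: ennreal_mult[symmetric] power_mult_distrib power2_eq_square ac_simps)
  also have "\<dots> \<le> ennreal (exp (- t\<^sup>2 / (4 * \<Lambda>)) * (4 * \<Lambda>\<^sup>2 * real R) ^ R)"
  proof (intro ennreal_leI mult_left_mono)
    have "1 \<le> \<Lambda>\<^sup>2" using L by simp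
    then show "(4 * \<Lambda>\<^sup>2 * real m) ^ m \<le> (4 * \<Lambda>\<^sup>2 * real R) ^ R"
      using R unfolding m_def by (intro power_self_le) linarith+
  qed simp
  finally show ?thesis .
qed

text \<open>The density is at least its lower bound at the largest norm in the box, and the absolute sum of
  the coordinates dominates the Euclidean norm.\<close>

lemma gaussian_box_mass:
  assumes \<gamma>: "finite \<gamma>" and S: "spectrum_within \<Lambda> \<gamma> A" and L: "1 \<le> \<Lambda>"
    and \<eta>: "0 < \<eta>" and b: "(\<Sum>j\<in>\<gamma>. \<bar>b j\<bar> + \<eta>) \<le> S1"
  shows "ennreal (exp (- \<Lambda> * S1\<^sup>2 / 2) / (2 * pi * real (card \<gamma>) * \<Lambda>) ^ card \<gamma> * \<eta> ^ card \<gamma>)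
    \<le> emeasure (gaussian \<gamma> A) (PiE \<gamma> (\<lambda>j. {b j - \<eta>..b j + \<eta>}))"
proof -
  define m where "m = card \<gamma>"
  define E where "E = PiE \<gamma> (\<lambda>j. {b j - \<eta>..b j + \<eta>})"
  define c where "c = exp (- \<Lambda> * S1\<^sup>2 / 2) / (2 * pi * real m * \<Lambda>) ^ m"
  have c0: "0 \<le> c" unfolding c_def using L by simp
  have E: "E \<in> sets (PiM \<gamma> (\<lambda>_. lborel))" unfolding E_def by (rule sets_PiM_I_finite[OF \<gamma>]) auto
  note [measurable] = gaussian_density_measurable[OF \<gamma>] E
  have A: "pos_def (card \<gamma>) A" using S unfolding spectrum_within_def by simp
  have "ennreal (c * \<eta> ^ m) \<le> ennreal c * ennreal ((2 * \<eta>) ^ m)"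
  proof -
    have "c * \<eta> ^ m \<le> c * (2 * \<eta>) ^ m" using \<eta> c0 by (intro mult_left_mono power_mono) auto
    from ennreal_leI[OF this] show ?thesis using \<eta> c0 by (simp only: ennreal_mult zero_le_power mult_nonneg_nonneg)
  qed
  also have "ennreal ((2 * \<eta>) ^ m) = emeasure (PiM \<gamma> (\<lambda>_. lborel)) E"
    unfolding E_def using \<eta>
    by (subst lborel_product.emeasure_PiM[OF \<gamma>]) (auto simp: m_def prod_ennreal ennreal_power)
  also have "ennreal c * emeasure (PiM \<gamma> (\<lambda>_. lborel)) E = (\<integral>\<^sup>+\<beta>. ennreal c * indicator E \<beta> \<partial>PiM \<gamma> (\<lambda>_. lborel))"
    by (subst nn_integral_cmult_indicator) (auto simp: E)
  also have "\<dots> \<le> (\<integral>\<^sup>+\<beta>. ennreal (gaussian_density \<gamma> A \<beta>) * indicator E \<beta> \<partial>PiM \<gamma> (\<lambda>_. lborel))"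
  proof (rule nn_integral_mono)
    fix \<beta>
    show "ennreal c * indicator E \<beta> \<le> ennreal (gaussian_density \<gamma> A \<beta>) * indicator E \<beta>"
    proof (cases "\<beta> \<in> E")
      case True
      then have bj: "\<bar>\<beta> j\<bar> \<le> \<bar>b j\<bar> + \<eta>" if "j \<in> \<gamma>" for j
      proof -
        have "\<beta> j \<in> {b j - \<eta>..b j + \<eta>}" using PiE_mem[OF True[unfolded E_def] that] .
        then show ?thesis by auto
      qed
      have "(\<Sum>j\<in>\<gamma>. (\<beta> j)\<^sup>2) = (\<Sum>j\<in>\<gamma>. \<bar>\<beta> j\<bar> * \<bar>\<beta> j\<bar>)" by (simp add: power2_eq_square)
      also have "\<dots> \<le> (\<Sum>j\<in>\<gamma>. \<bar>\<beta> j\<bar> * (\<Sum>j\<in>\<gamma>. \<bar>\<beta> j\<bar>))"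
        using \<gamma> by (intro sum_mono mult_left_mono member_le_sum) auto
      also have "\<dots> = (\<Sum>j\<in>\<gamma>. \<bar>\<beta> j\<bar>)\<^sup>2" by (simp add: sum_distrib_right[symmetric] power2_eq_square)
      also have "\<dots> \<le> S1\<^sup>2"
        using order_trans[OF sum_mono[OF bj] b] by (intro power_mono sum_nonneg) auto
      finally have "c \<le> exp (- \<Lambda> * (\<Sum>j\<in>\<gamma>. (\<beta> j)\<^sup>2) / 2) / (2 * pi * real m * \<Lambda>) ^ m"
        unfolding c_def using L by (intro divide_right_mono) auto
      also have "\<dots> \<le> gaussian_density \<gamma> A \<beta>"
        unfolding m_def by (rule gaussian_density_lower[OF \<gamma> S L])
      finally show ?thesis by (intro mult_right_mono ennreal_leI) auto
    qed simp
  qed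
  also have "\<dots> = emeasure (gaussian \<gamma> A) E"
    unfolding gaussian_eq using A E by (subst emeasure_density) auto
  finally show ?thesis unfolding c_def E_def m_def .
qed

section \<open>Exponential bounds and growth rates\<close>

lemma one_minus_power_le_exp:
  fixes x :: real
  assumes "x \<le> 1" shows "(1 - x) ^ n \<le> exp (- (real n * x))"
proof -
  have "(1 - x) ^ n \<le> exp (- x) ^ n"
    using assms exp_ge_add_one_self[of "- x"] by (intro power_mono) auto
  also have "\<dots> = exp (- (real n * x))" by (simp flip: exp_of_nat_mult)
  finally show ?thesis .
qed

lemma four_terms_le:
  fixes s :: real
  assumes "128 \<le> s"
  shows "4 * exp (- s / 32) \<le> exp (- s / 64)"
proof -
  have "2 \<le> exp (1::real)" using exp_ge_add_one_self[of 1] by simp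
  have "4 \<le> exp (1::real) * exp 1" using mult_mono[OF \<open>2 \<le> exp 1\<close> \<open>2 \<le> exp 1\<close>] by simp
  also have "\<dots> = exp 2" by (simp add: mult_exp_exp)
  also have "\<dots> \<le> exp (s / 64)" using assms by simp
  finally have "4 * exp (- s / 32) \<le> exp (s / 64) * exp (- s / 32)" by (intro mult_right_mono) auto
  also have "\<dots> = exp (- s / 64)" by (simp add: mult_exp_exp)
  finally show ?thesis .
qed

text \<open>Here \<open>t\<close> is the expected loss from small evidence, \<open>x\<close> and \<open>y\<close> are the powers of the affinities, \<open>d\<close> is
  the lower bound for the evidence, \<open>Nc\<close> the number of cells, \<open>Ms\<close> the total prior mass of the
  coefficients and \<open>Q\<close> the tail factor. Each of the four terms \<open>t\<close>, \<open>Nc x\<close>, \<open>Nc Ms y / d\<close>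
  and \<open>Q Ms / d\<close> is at most \<open>exp (- s / 32)\<close>; the largest product is the third, with exponent
  \<open>1/32 + 1/32 - 1/4 + 1/8 = -1/16\<close> in units of \<open>s\<close>.\<close>

lemma combine_exponentials:
  fixes s t x y d Nc Ms Q :: real
  assumes s: "128 \<le> s" and t: "t \<le> exp (- s / 32)" and x: "x \<le> exp (- s / 2)"
    and y: "0 \<le> y" "y \<le> exp (- s / 4)" and d: "exp (- s / 8) \<le> d"
    and Nc: "0 \<le> Nc" "Nc \<le> exp (s / 32)" and Ms: "0 \<le> Ms" "Ms \<le> exp (s / 32)" and Q: "0 \<le> Q" "Q \<le> exp (- s)"
  shows "t + Nc * (x + Ms * y / d) + Q * Ms / d \<le> exp (- s / 64)"
proof -
  have d0: "0 < d" by (rule less_le_trans[OF exp_gt_zero d])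
  have "1 / d \<le> 1 / exp (- s / 8)" by (rule divide_left_mono[OF d zero_le_one mult_pos_pos[OF d0 exp_gt_zero]])
  also have "\<dots> = exp (s / 8)"
  proof -
    have "exp (s / 8) * exp (- s / 8) = 1" unfolding mult_exp_exp by simp
    then show ?thesis by (metis exp_not_eq_zero nonzero_eq_divide_eq)
  qed
  finally have inv: "1 / d \<le> exp (s / 8)" .
  have inv0: "0 \<le> 1 / d" using d0 by simp
  have "Nc * x \<le> Nc * exp (- s / 2)" by (rule mult_left_mono[OF x Nc(1)])
  also have "\<dots> \<le> exp (s / 32) * exp (- s / 2)" by (rule mult_right_mono[OF Nc(2)]) simp
  also have "\<dots> \<le> exp (- s / 32)" unfolding mult_exp_exp exp_le_cancel_iff using s by linarith
  finally have 2: "Nc * x \<le> exp (- s / 32)" .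
  have "Ms * y \<le> exp (s / 32) * exp (- s / 4)" by (rule mult_mono[OF Ms(2) y(2) exp_ge_zero y(1)])
  then have "Ms * y * (1 / d) \<le> exp (s / 32) * exp (- s / 4) * exp (s / 8)"
    by (rule mult_mono[OF _ inv _ inv0]) simp
  then have "Nc * (Ms * y * (1 / d)) \<le> exp (s / 32) * (exp (s / 32) * exp (- s / 4) * exp (s / 8))"
    by (rule mult_mono[OF Nc(2) _ exp_ge_zero]) (intro mult_nonneg_nonneg Ms y inv0)
  also have "\<dots> \<le> exp (- s / 32)" unfolding mult_exp_exp exp_le_cancel_iff using s by linarith
  finally have 3: "Nc * (Ms * y / d) \<le> exp (- s / 32)" by (simp only: times_divide_eq_right mult_1_right)
  have "Q * Ms \<le> exp (- s) * exp (s / 32)" by (rule mult_mono[OF Q(2) Ms(2) exp_ge_zero Ms(1)])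
  then have "Q * Ms * (1 / d) \<le> exp (- s) * exp (s / 32) * exp (s / 8)"
    by (rule mult_mono[OF _ inv _ inv0]) simp
  also have "\<dots> \<le> exp (- s / 32)" unfolding mult_exp_exp exp_le_cancel_iff using s by linarith
  finally have 4: "Q * Ms / d \<le> exp (- s / 32)" by (simp only: times_divide_eq_right mult_1_right)
  have "Nc * (x + Ms * y / d) = Nc * x + Nc * (Ms * y / d)" by (rule distrib_left)
  then have "t + Nc * (x + Ms * y / d) + Q * Ms / d \<le> 4 * exp (- s / 32)" using t 2 3 4 by linarith
  also have "\<dots> \<le> exp (- s / 64)" by (rule four_terms_le[OF s])
  finally show ?thesis .
qed

text \<open>The threshold \<open>\<tau> = exp (- s / 16)\<close> for the evidence, relative to the prior mass \<open>w0 m0 \<ge> exp (- s / 16)\<close>, balances two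
  demands: the loss \<open>\<tau> (1 + 2 c0 / n)\<^sup>n \<le> \<tau> exp (2 c0)\<close> must be small, and the division by \<open>w0 \<tau> m0\<close>
  must not destroy the factor \<open>exp (- s / 4)\<close> of the affinities.\<close>

lemma combine_bounds:
  fixes s \<epsilon> w0 m0 c0 Nc Ms Q :: real
  assumes n: "1 \<le> n" and \<epsilon>: "0 < \<epsilon>" "\<epsilon> \<le> 1" and s: "s = real n * \<epsilon>\<^sup>2" "128 \<le> s" "64 * c0 \<le> s"
    and c0: "0 \<le> c0" and wm: "exp (- s / 16) \<le> w0 * m0"
    and Nc: "0 \<le> Nc" "Nc \<le> exp (s / 32)" and Ms: "0 \<le> Ms" "Ms \<le> exp (s / 32)" and Q: "0 \<le> Q" "Q \<le> exp (- s)"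
  defines "\<tau> \<equiv> exp (- s / 16)"
  shows "\<tau> * (1 + c0 * (2 / real n)) ^ n + Nc * ((1 - \<epsilon>\<^sup>2 / 2) ^ n + Ms * (1 - \<epsilon>\<^sup>2 / 4) ^ n / (w0 * \<tau> * m0))
    + Q * Ms / (w0 * \<tau> * m0) \<le> exp (- s / 64)"
proof (rule combine_exponentials[OF s(2) _ _ _ _ _ Nc Ms Q])
  have e: "\<epsilon>\<^sup>2 \<le> 1" using \<epsilon> by (simp add: power_le_one)
  have "\<tau> * \<tau> \<le> (w0 * m0) * \<tau>" using wm unfolding \<tau>_def by (rule mult_right_mono) simp
  also have "\<dots> = w0 * \<tau> * m0" by (simp only: ac_simps)
  finally show "exp (- s / 8) \<le> w0 * \<tau> * m0" unfolding \<tau>_def mult_exp_exp by simp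
  have "(1 + c0 * (2 / real n)) ^ n \<le> exp (c0 * (2 / real n)) ^ n"
    using c0 by (intro power_mono exp_ge_add_one_self) auto
  also have "\<dots> = exp (real n * (c0 * (2 / real n)))" by (rule exp_of_nat_mult[symmetric])
  also have "real n * (c0 * (2 / real n)) = 2 * c0" using n by simp
  finally have "\<tau> * (1 + c0 * (2 / real n)) ^ n \<le> \<tau> * exp (2 * c0)"
    unfolding \<tau>_def by (rule mult_left_mono) simp
  also have "\<dots> \<le> exp (- s / 32)" unfolding \<tau>_def mult_exp_exp exp_le_cancel_iff using s(3) by linarith
  finally show "\<tau> * (1 + c0 * (2 / real n)) ^ n \<le> exp (- s / 32)" .
  show "(1 - \<epsilon>\<^sup>2 / 2) ^ n \<le> exp (- s / 2)"
    using one_minus_power_le_exp[of "\<epsilon>\<^sup>2 / 2" n] e s(1) by simp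
  show "(1 - \<epsilon>\<^sup>2 / 4) ^ n \<le> exp (- s / 4)"
    using one_minus_power_le_exp[of "\<epsilon>\<^sup>2 / 4" n] e s(1) by simp
  show "0 \<le> (1 - \<epsilon>\<^sup>2 / 4) ^ n" using e by simp
qed

lemma power_le_exp:
  fixes x :: real
  assumes "0 \<le> x" "x \<le> exp y" shows "x ^ n \<le> exp (real n * y)"
  using power_mono[OF assms(2,1), of n] by (simp add: exp_of_nat_mult)

lemma le_exp_self: "(x::real) \<le> exp x"
  using exp_ge_add_one_self[of x] by linarith

text \<open>The factors are the prior weight of the model, the Gaussian mass per unit of volume, and the volume
  of the box. Each base is bounded by an exponential, very crudely by \<open>a \<le> e\<^sup>a\<close> for polylogarithmic
  \<open>a\<close>; only \<open>n = e\<^sup>l\<close> has to be treated exactly.\<close>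

lemma prior_mass_lower:
  fixes \<Lambda> S l K :: real
  assumes r: "1 \<le> r" and \<Lambda>: "1 \<le> \<Lambda>" and n: "1 \<le> n" and l: "l = ln (real n)"
    and le: "real r * ln K + real r + \<Lambda> * (S + 1)\<^sup>2 / 2 + real r * (2 * pi * real r * \<Lambda>) + real r * (real r + l) \<le> t"
  shows "exp (- t) \<le> exp (- real r * ln K - real r) * (exp (- \<Lambda> * (S + 1)\<^sup>2 / 2) / (2 * pi * real r * \<Lambda>) ^ r * (1 / (real r * real n)) ^ r)"
proof -
  define a b where "a = 2 * pi * real r * \<Lambda>" and "b = real r * real n"
  have a: "0 < a" "a ^ r \<le> exp (real r * a)" unfolding a_def
    using r \<Lambda> by (auto intro!: power_le_exp le_exp_self mult_nonneg_nonneg)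
  have b0: "0 < b" unfolding b_def using r n by simp
  have "b \<le> exp (real r) * exp l" unfolding b_def l using n by (intro mult_mono le_exp_self) auto
  then have b: "b ^ r \<le> exp (real r * (real r + l))" using b0 by (intro power_le_exp) (auto simp: exp_add)
  have "exp (- t) \<le> exp (- real r * ln K - real r) * (exp (- \<Lambda> * (S + 1)\<^sup>2 / 2) * exp (- (real r * a)) * exp (- (real r * (real r + l))))"
    using le unfolding a_def by (simp add: mult_exp_exp algebra_simps)
  also have "\<dots> \<le> exp (- real r * ln K - real r) * (exp (- \<Lambda> * (S + 1)\<^sup>2 / 2) * (1 / a ^ r) * (1 / b) ^ r)"
  proof (intro mult_left_mono mult_mono)
    show "exp (- (real r * a)) \<le> 1 / a ^ r"
      unfolding exp_minus divide_inverse mult_1 using a by (intro le_imp_inverse_le zero_less_power)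
    show "exp (- (real r * (real r + l))) \<le> (1 / b) ^ r"
      unfolding exp_minus divide_inverse mult_1 power_inverse using b b0 by (intro le_imp_inverse_le zero_less_power)
  qed (use a b0 in auto)
  finally show ?thesis unfolding a_def b_def by simp
qed

text \<open>The left-hand side bounds the number of models times the number of cells of side \<open>\<eta>\<close> in \<open>[-T, T]\<^sup>R\<close>.
  Since \<open>1 / \<epsilon> ^ 4 \<le> n\<^sup>2\<close>, the logarithm of \<open>1 / \<eta>\<close> is of order \<open>A R T\<close> up to logarithms.\<close>

lemma covering_number_upper:
  fixes A \<epsilon> T l K :: real
  assumes R: "1 \<le> R" and K: "1 \<le> K" and n: "1 \<le> n" and l: "l = ln (real n)" and A: "0 \<le> A" and \<epsilon>: "0 < \<epsilon>" "\<epsilon> \<le> 1"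
    and \<epsilon>n: "1 / real n \<le> \<epsilon>\<^sup>2" and T: "1 \<le> T" "T \<le> real n"
    and le: "real R * (1 + ln K) + real R * (5 + 3 * l + real R + A + A * real R * T) \<le> t"
  defines "\<eta> \<equiv> exp (- A * (1 + real R * T)) * \<epsilon> ^ 4 / (16 * real R)"
  shows "(K + 1) ^ R * (2 * of_int \<lceil>T / \<eta>\<rceil> + 1) ^ R \<le> exp t"
proof -
  have \<eta>0: "0 < \<eta>" unfolding \<eta>_def using \<epsilon> R by simp
  have "exp (- A * (1 + real R * T)) * \<epsilon> ^ 4 \<le> 1 * 1"
    using A T \<epsilon> by (intro mult_mono power_le_one) auto
  then have \<eta>1: "\<eta> \<le> 1" unfolding \<eta>_def using R by (simp add: divide_le_eq)
  have T\<eta>: "1 \<le> T / \<eta>" using \<eta>0 \<eta>1 T by (simp add: le_divide_eq)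
  have n0: "0 < real n" using n by simp
  have "T / \<eta> = 16 * T * real R * (1 / \<epsilon> ^ 4) * exp (A * (1 + real R * T))"
  proof -
    define E where "E = exp (A * (1 + real R * T))"
    have E: "exp (- A * (1 + real R * T)) = inverse E" unfolding E_def by (simp add: exp_minus[symmetric])
    show ?thesis unfolding \<eta>_def E E_def[symmetric] by (simp add: field_simps)
  qed
  also have "\<dots> \<le> 16 * exp l * exp (real R) * exp (2 * l) * exp (A * (1 + real R * T))"
  proof (intro mult_mono)
    show "T \<le> exp l" using T n0 unfolding l by simp
    show "real R \<le> exp (real R)" by (rule le_exp_self)
    have "(1 / real n)\<^sup>2 \<le> (\<epsilon>\<^sup>2)\<^sup>2" using \<epsilon>n by (intro power_mono) auto
    then have "1 / (real n)\<^sup>2 \<le> \<epsilon> ^ 4" by (simp add: power_divide power_mult[symmetric])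
    then have "1 / \<epsilon> ^ 4 \<le> (real n)\<^sup>2" using n0 \<epsilon> by (simp add: divide_le_eq mult.commute)
    also have "\<dots> = exp (2 * l)" unfolding l exp_double using n0 by simp
    finally show "1 / \<epsilon> ^ 4 \<le> exp (2 * l)" .
  qed (use T \<epsilon> in auto)
  finally have T\<eta>2: "T / \<eta> \<le> 16 * exp (l + real R + 2 * l + A * (1 + real R * T))"
    unfolding exp_add by (simp only: mult.assoc)
  have e5: "80 \<le> exp (5::real)"
  proof -
    have "(5 / 2) ^ 5 \<le> exp (1::real) ^ 5"
      using exp_lower_Taylor_quadratic[of 1] by (intro power_mono) auto
    moreover have "80 \<le> (5 / 2 :: real) ^ 5" by (simp add: power_divide)
    ultimately show ?thesis by (simp flip: exp_of_nat_mult)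
  qed
  \<comment> \<open>The ceiling is at most \<open>T / \<eta> + 1 \<le> 2 T / \<eta>\<close>.\<close>
  have "2 * of_int \<lceil>T / \<eta>\<rceil> + 1 \<le> 5 * (T / \<eta>)" using T\<eta> of_int_ceiling_le_add_one[of "T / \<eta>"] by linarith
  also have "\<dots> \<le> 80 * exp (l + real R + 2 * l + A * (1 + real R * T))" using T\<eta>2 by linarith
  also have "\<dots> \<le> exp 5 * exp (l + real R + 2 * l + A * (1 + real R * T))" using e5 by (intro mult_right_mono) auto
  also have "\<dots> = exp (5 + 3 * l + real R + A + A * real R * T)" by (simp add: mult_exp_exp algebra_simps)
  finally have c: "2 * of_int \<lceil>T / \<eta>\<rceil> + 1 \<le> exp (5 + 3 * l + real R + A + A * real R * T)" .
  have ceil0: "0 \<le> real_of_int \<lceil>T / \<eta>\<rceil>" using T\<eta> by linarith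
  have "K + 1 \<le> 2 * K" using K by simp
  also have "\<dots> \<le> exp 1 * exp (ln K)" using K exp_ge_add_one_self[of 1] by (intro mult_mono) auto
  finally have "K + 1 \<le> exp (1 + ln K)" by (simp add: exp_add)
  then have "(K + 1) ^ R \<le> exp (real R * (1 + ln K))" using K by (intro power_le_exp) auto
  moreover have "(2 * of_int \<lceil>T / \<eta>\<rceil> + 1) ^ R \<le> exp (real R * (5 + 3 * l + real R + A + A * real R * T))"
    using c ceil0 by (intro power_le_exp) auto
  ultimately have "(K + 1) ^ R * (2 * of_int \<lceil>T / \<eta>\<rceil> + 1) ^ R
      \<le> exp (real R * (1 + ln K)) * exp (real R * (5 + 3 * l + real R + A + A * real R * T))"
    using ceil0 by (intro mult_mono) auto
  also have "\<dots> \<le> exp t" using le by (simp add: mult_exp_exp)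
  finally show ?thesis .
qed

lemma polylog_le_power:
  fixes c q b :: real
  assumes "0 < c" "0 < q" "0 < b"
  shows "eventually (\<lambda>n::nat. c * ln (real n) powr q \<le> real n powr b) sequentially"
  using assms by real_asymp

text \<open>Every left-hand side is a polylogarithm times at most \<open>n powr (3 \<xi> / 4)\<close> (in the fourth bound
  \<open>n\<^sup>\<xi>\<close>), so it is absorbed by a positive power of \<open>n\<close>. The exponent \<open>3 \<xi> / 4\<close> of the sieve radius \<open>T\<close> lies
  strictly between \<open>\<xi> / 2\<close>, needed for \<open>T\<^sup>2 / \<Lambda>\<close> to exceed \<open>s\<close>, and \<open>\<xi>\<close>, needed for the covering number.
  The denominators 256 and 64 are the shares of the exponents in the later bounds.\<close>

lemma growth_facts:
  fixes B S k v \<xi> A :: real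
  assumes "0 < B" "1 < k" "0 < v" "0 < \<xi>" "\<xi> < 1" "1 \<le> A"
  shows "eventually (\<lambda>n::nat. ln (real n) powr k + B * ln (real n) powr (k * v) * (S + 1)\<^sup>2 / 2
           + 2 * pi * B * ln (real n) powr (2 * k + k * v) + ln (real n) powr (2 * k) + ln (real n) powr (k + 1)
           \<le> real n powr \<xi> * ln (real n) powr k / 256) sequentially" (is ?G1)
    and "eventually (\<lambda>n::nat. ln (real n) powr k * (5 + 3 * ln (real n) + ln (real n) powr k + A + A * ln (real n) powr k * real n powr (3 * \<xi> / 4))
           \<le> real n powr \<xi> * ln (real n) powr k / 256) sequentially" (is ?G2)
    and "eventually (\<lambda>n::nat. 4 * B\<^sup>2 * ln (real n) powr (2 * (k * v) + 2 * k) \<le> real n powr \<xi> * ln (real n) powr k / 64) sequentially" (is ?G3)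
    and "eventually (\<lambda>n::nat. 2 * (real n powr \<xi> * ln (real n) powr k) * (4 * (B * ln (real n) powr (k * v))) \<le> real n powr (3 * \<xi> / 2)) sequentially" (is ?G4)
    and "filterlim (\<lambda>n::nat. real n powr \<xi> * ln (real n) powr k) at_top sequentially"
proof -
  define q where "q = k * v"
  have q: "0 < q" unfolding q_def using assms by simp
  have ln1: "eventually (\<lambda>n::nat. 1 \<le> ln (real n)) sequentially" by real_asymp
  \<comment> \<open>As \<open>(ln n)\<^sup>k \<ge> 1\<close>, it suffices to compare with \<open>n\<^sup>\<xi>\<close>; the constant 1280 below is \<open>5 * 256\<close>, for five
    summands, and 768 is \<open>3 * 256\<close>.\<close>
  have up: "x \<le> real n powr \<xi> * ln (real n) powr k / c"
    if "1 \<le> ln (real n)" "c * x \<le> real n powr \<xi>" "0 < c" for x c :: real and n :: nat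
  proof -
    have "1 \<le> ln (real n) powr k" using that(1) assms by (intro ge_one_powr_ge_zero) auto
    then have "real n powr \<xi> * 1 \<le> real n powr \<xi> * ln (real n) powr k" by (intro mult_left_mono) auto
    then have "c * x \<le> real n powr \<xi> * ln (real n) powr k" using that(2) by linarith
    then show ?thesis using that(3) by (simp add: le_divide_eq mult.commute)
  qed
  note P = polylog_le_power
  have c2: "0 < 1280 * (B * (S + 1)\<^sup>2 / 2 + 1)" using assms by (simp add: add_nonneg_pos)
  have "eventually (\<lambda>n::nat. 1280 * ln (real n) powr (k) \<le> real n powr (\<xi>)) sequentially" "eventually (\<lambda>n::nat. 1280 * (B * (S + 1)\<^sup>2 / 2 + 1) * ln (real n) powr (q) \<le> real n powr (\<xi>)) sequentially" "eventually (\<lambda>n::nat. 1280 * (2 * pi * B) * ln (real n) powr (2 * k + q) \<le> real n powr (\<xi>)) sequentially" "eventually (\<lambda>n::nat. 1280 * ln (real n) powr (2 * k) \<le> real n powr (\<xi>)) sequentially" "eventually (\<lambda>n::nat. 1280 * ln (real n) powr (k + 1) \<le> real n powr (\<xi>)) sequentially"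
    using assms q c2 by (auto intro!: P)
  with ln1 show ?G1 unfolding q_def[symmetric]
  proof (eventually_elim)
    case (elim n)
    have "1280 * (B * (S + 1)\<^sup>2 / 2) * ln (real n) powr q \<le> 1280 * (B * (S + 1)\<^sup>2 / 2 + 1) * ln (real n) powr q"
      by (intro mult_right_mono) auto
    then have "1280 * (B * ln (real n) powr q * (S + 1)\<^sup>2 / 2) \<le> real n powr \<xi>"
      using elim(3) assms q by (simp add: ac_simps)
    moreover have "1280 * (2 * pi * B * ln (real n) powr (2 * k + q)) \<le> real n powr \<xi>"
      using elim(4) assms q by (simp add: ac_simps)
    ultimately have "256 * (ln (real n) powr k + B * ln (real n) powr q * (S + 1)\<^sup>2 / 2
           + 2 * pi * B * ln (real n) powr (2 * k + q) + ln (real n) powr (2 * k) + ln (real n) powr (k + 1)) \<le> real n powr \<xi>"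
      using elim(2,5,6) assms q by simp
    from up[OF elim(1) this] show ?case by simp
  qed
  have "eventually (\<lambda>n::nat. 768 * (8 + A) * ln (real n) powr (1) \<le> real n powr (\<xi>)) sequentially" by (rule P) (use assms in auto)
  moreover have "eventually (\<lambda>n::nat. 768 * ln (real n) powr (k) \<le> real n powr (\<xi>)) sequentially" by (rule P) (use assms in auto)
  moreover have "eventually (\<lambda>n::nat. 768 * A * ln (real n) powr (k) \<le> real n powr (\<xi> / 4)) sequentially" by (rule P) (use assms in auto)
  ultimately show ?G2 using ln1
  proof (eventually_elim)
    case (elim n)
    define L N where "L = ln (real n)" and "N = real n powr \<xi>"
    have n: "1 \<le> n" using elim(4) by (cases n) auto
    have L: "1 \<le> L" unfolding L_def by (rule elim(4))
    have a: "768 * (8 + A) * L \<le> N" "768 * L powr k \<le> N" using elim(1,2) L assms unfolding L_def N_def by auto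
    have a': "(5 + A) * 1 \<le> (5 + A) * L" using L assms by (intro mult_left_mono) auto
    have "768 * A * L powr k * real n powr (3 * \<xi> / 4) \<le> real n powr (\<xi> / 4) * real n powr (3 * \<xi> / 4)"
      using elim(3) assms unfolding L_def by (intro mult_right_mono) auto
    also have "\<dots> = N" unfolding N_def by (simp add: powr_add[symmetric])
    finally have b: "768 * (A * L powr k * real n powr (3 * \<xi> / 4)) \<le> N" by (simp add: mult.assoc)
    have a1: "768 * (8 * L + A * L) \<le> N" using a(1) by (simp add: algebra_simps)
    have a2: "5 + A \<le> 5 * L + A * L" using a' by (simp add: algebra_simps)
    have "256 * (5 + 3 * L + L powr k + A + A * L powr k * real n powr (3 * \<xi> / 4)) \<le> N"
    proof -
      define X Y where "X = A * L powr k * real n powr (3 * \<xi> / 4)" and "Y = A * L"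
      show ?thesis using a1 a2 a(2) b unfolding X_def[symmetric] Y_def[symmetric] by (simp add: distrib_left)
    qed
    then have "L powr k * (5 + 3 * L + L powr k + A + A * L powr k * real n powr (3 * \<xi> / 4)) \<le> L powr k * (N / 256)"
      by (intro mult_left_mono) auto
    then show ?case unfolding L_def N_def by (simp add: mult.commute)
  qed
  have "eventually (\<lambda>n::nat. 256 * B\<^sup>2 * ln (real n) powr (2 * q + 2 * k) \<le> real n powr (\<xi>)) sequentially" using assms q by (auto intro!: P)
  with ln1 show ?G3 unfolding q_def[symmetric]
  proof (eventually_elim)
    case (elim n)
    have "64 * (4 * B\<^sup>2 * ln (real n) powr (2 * q + 2 * k)) \<le> real n powr \<xi>"
      using elim(2) assms q by (simp add: ac_simps)
    from up[OF elim(1) this] show ?case by simp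
  qed
  have "eventually (\<lambda>n::nat. 8 * B * ln (real n) powr (k + q) \<le> real n powr (\<xi> / 2)) sequentially" using assms q by (auto intro!: P)
  then show ?G4 unfolding q_def[symmetric]
  proof (eventually_elim)
    case (elim n)
    have "2 * (real n powr \<xi> * ln (real n) powr k) * (4 * (B * ln (real n) powr q)) = real n powr \<xi> * (8 * B * ln (real n) powr (k + q))"
      by (simp add: powr_add)
    also have "\<dots> \<le> real n powr \<xi> * real n powr (\<xi> / 2)" by (intro mult_left_mono elim) auto
    also have "\<dots> = real n powr (3 * \<xi> / 2)" by (simp add: powr_add[symmetric])
    finally show ?case .
  qed
  show "filterlim (\<lambda>n::nat. real n powr \<xi> * ln (real n) powr k) at_top sequentially"
    using assms by real_asymp
qed

section \<open>Posterior mass bounds by roots of likelihood ratios\<close>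

text \<open>Write \<open>p = q + (p - q)\<close>. The first part contributes the affinity of \<open>q\<close> and \<open>s\<close>. The second is at most
  the square root of the chi-square divergence, by Cauchy-Schwarz in the form of the
  arithmetic-geometric mean inequality with weight \<open>\<kappa>\<close>. So the root of the likelihood ratio of the
  representative \<open>q\<close> separates every density \<open>p\<close> close to \<open>q\<close> from \<open>s\<close>.\<close>

lemma cross_affinity:
  fixes p q s :: "'z \<Rightarrow> real"
  assumes [measurable]: "p \<in> borel_measurable \<mu>" "q \<in> borel_measurable \<mu>" "s \<in> borel_measurable \<mu>"
    and pos: "\<And>z. z \<in> space \<mu> \<Longrightarrow> 0 < p z" "\<And>z. z \<in> space \<mu> \<Longrightarrow> 0 < q z" "\<And>z. z \<in> space \<mu> \<Longrightarrow> 0 < s z"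
    and one: "(\<integral>\<^sup>+z. ennreal (p z) \<partial>\<mu>) = 1" "(\<integral>\<^sup>+z. ennreal (q z) \<partial>\<mu>) = 1" "(\<integral>\<^sup>+z. ennreal (s z) \<partial>\<mu>) = 1"
    and aff: "(\<integral>\<^sup>+z. ennreal (sqrt (q z * s z)) \<partial>\<mu>) \<le> ennreal a" and a: "0 \<le> a"
    and chi: "(\<integral>\<^sup>+z. ennreal ((p z)\<^sup>2 / q z) \<partial>\<mu>) \<le> ennreal (1 + \<kappa>\<^sup>2)" and \<kappa>: "0 < \<kappa>"
  shows "(\<integral>\<^sup>+z. ennreal (sqrt (s z / q z) * p z) \<partial>\<mu>) \<le> ennreal (a + \<kappa>)"
proof -
  define X where "X = (\<integral>\<^sup>+z. ennreal ((p z - q z)\<^sup>2 / q z) \<partial>\<mu>)"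
  have "X + 2 * 1 = (\<integral>\<^sup>+z. ennreal ((p z - q z)\<^sup>2 / q z) + 2 * ennreal (p z) \<partial>\<mu>)"
    unfolding X_def by (subst nn_integral_add) (auto simp: nn_integral_cmult one)
  also have "\<dots> = (\<integral>\<^sup>+z. ennreal ((p z)\<^sup>2 / q z) + ennreal (q z) \<partial>\<mu>)"
  proof (rule nn_integral_cong)
    fix z assume z: "z \<in> space \<mu>"
    \<comment> \<open>The identity is written with sums only, as subtraction of extended reals is truncated.\<close>
    have e: "(p z - q z)\<^sup>2 / q z + 2 * p z = (p z)\<^sup>2 / q z + q z"
      using pos(2)[OF z] by (simp add: field_simps power2_eq_square)
    have "ennreal ((p z - q z)\<^sup>2 / q z) + 2 * ennreal (p z) = ennreal ((p z - q z)\<^sup>2 / q z + 2 * p z)"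
      using pos(1,2)[OF z] by (simp add: ennreal_mult')
    also have "\<dots> = ennreal ((p z)\<^sup>2 / q z) + ennreal (q z)"
      unfolding e using pos(2)[OF z] by (subst ennreal_plus) auto
    finally show "ennreal ((p z - q z)\<^sup>2 / q z) + 2 * ennreal (p z) = ennreal ((p z)\<^sup>2 / q z) + ennreal (q z)" .
  qed
  also have "\<dots> = (\<integral>\<^sup>+z. ennreal ((p z)\<^sup>2 / q z) \<partial>\<mu>) + 1"
    by (subst nn_integral_add) (auto simp: one)
  also have "\<dots> \<le> ennreal (1 + \<kappa>\<^sup>2) + 1" using chi by (intro add_right_mono)
  also have "\<dots> = ennreal (\<kappa>\<^sup>2) + 2 * 1" by (simp add: add_ac) 
  finally have "2 + X \<le> 2 + ennreal (\<kappa>\<^sup>2)" by (simp add: add.commute)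
  then have X: "X \<le> ennreal (\<kappa>\<^sup>2)" by (simp add: ennreal_add_left_cancel_le)
  have "(\<integral>\<^sup>+z. ennreal (sqrt (s z / q z) * p z) \<partial>\<mu>)
      \<le> (\<integral>\<^sup>+z. ennreal (sqrt (q z * s z)) + (ennreal (1 / (2 * \<kappa>)) * ennreal ((p z - q z)\<^sup>2 / q z) + ennreal (\<kappa> / 2) * ennreal (s z)) \<partial>\<mu>)"
  proof (rule nn_integral_mono)
    fix z assume z: "z \<in> space \<mu>"
    note ps = pos(1)[OF z] pos(2)[OF z] pos(3)[OF z]
    define b where "b = sqrt (s z)"
    define c where "c = sqrt (q z)"
    have b: "0 < b" "s z = b\<^sup>2" and c: "0 < c" "q z = c\<^sup>2" unfolding b_def c_def using ps by auto
    define t where "t = \<bar>p z - c\<^sup>2\<bar> / c"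
    have t2: "t\<^sup>2 = (p z - q z)\<^sup>2 / q z" unfolding t_def c(2) by (simp add: power_divide)
    have "sqrt (s z / q z) * p z = b / c * p z" unfolding b(2) c(2) using b(1) c(1) by (simp add: real_sqrt_divide)
    also have "\<dots> \<le> b / c * (c\<^sup>2 + \<bar>p z - c\<^sup>2\<bar>)" using b c by (intro mult_left_mono) auto
    also have "\<dots> = c * b + t * b" unfolding t_def using c(1) by (simp add: power2_eq_square field_simps)
    also have "t * b \<le> 1 / (2 * \<kappa>) * t\<^sup>2 + \<kappa> / 2 * b\<^sup>2"
    proof -
      have "0 \<le> (t - \<kappa> * b)\<^sup>2" by simp
      then show ?thesis using \<kappa> by (simp add: field_simps power2_eq_square)
    qed
    finally have "sqrt (s z / q z) * p z \<le> sqrt (q z * s z) + (1 / (2 * \<kappa>) * ((p z - q z)\<^sup>2 / q z) + \<kappa> / 2 * s z)"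
      unfolding t2 using b c by (simp add: real_sqrt_mult)
    from ennreal_leI[OF this] show "ennreal (sqrt (s z / q z) * p z) \<le> ennreal (sqrt (q z * s z)) + (ennreal (1 / (2 * \<kappa>)) * ennreal ((p z - q z)\<^sup>2 / q z) + ennreal (\<kappa> / 2) * ennreal (s z))"
      using ps \<kappa> by (simp add: ennreal_mult[symmetric] ennreal_plus[symmetric] del: ennreal_plus)
  qed
  also have "\<dots> = (\<integral>\<^sup>+z. ennreal (sqrt (q z * s z)) \<partial>\<mu>) + (ennreal (1 / (2 * \<kappa>)) * X + ennreal (\<kappa> / 2))"
    unfolding X_def by (simp add: nn_integral_add nn_integral_cmult one)
  also have "\<dots> \<le> ennreal a + (ennreal (1 / (2 * \<kappa>)) * ennreal (\<kappa>\<^sup>2) + ennreal (\<kappa> / 2))"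
    by (intro add_mono aff mult_left_mono X order_refl) simp
  also have "\<dots> = ennreal (a + \<kappa>)"
    using \<kappa> a by (simp add: ennreal_mult[symmetric] ennreal_plus[symmetric] power2_eq_square del: ennreal_plus)
  finally show ?thesis .
qed

lemma ennreal_div_self_le_1: "(x::ennreal) / x \<le> 1"
  by (cases "x = 0 \<or> x = \<infinity>") (auto simp: ennreal_divide_self less_top[symmetric] infinity_ennreal_def)

lemma ennreal_inverse_antimono: "(c::ennreal) \<le> e \<Longrightarrow> inverse e \<le> inverse c"
  including ennreal.lifting by transfer (rule ereal_inverse_antimono)

lemma nn_integral_affine:
  fixes f g :: "'z \<Rightarrow> ennreal"
  assumes f: "f \<in> borel_measurable M" and g: "g \<in> borel_measurable M"
  shows "(\<integral>\<^sup>+z. f z + x * (y * g z) \<partial>M) = (\<integral>\<^sup>+z. f z \<partial>M) + x * (y * (\<integral>\<^sup>+z. g z \<partial>M))"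
proof -
  have g1: "(\<lambda>z. y * g z) \<in> borel_measurable M" using g by measurable
  then have g2: "(\<lambda>z. x * (y * g z)) \<in> borel_measurable M" by measurable
  show ?thesis unfolding nn_integral_add[OF f g2] nn_integral_cmult[OF g1] nn_integral_cmult[OF g] ..
qed

text \<open>One of \<open>r\<close> and \<open>1 / r\<close> is at least 1. For \<open>r\<close> the root of a likelihood ratio, the first term plays
  the role of the error of a test under the truth, the second that of its error under the alternatives.\<close>

lemma quotient_le_split:
  fixes x u :: ennreal and r :: real
  assumes "x \<le> 1" "x \<le> u" and s: "0 < r"
  shows "x \<le> ennreal r + ennreal (1 / r) * u"
proof (cases "1 \<le> r")
  case True
  have "x \<le> ennreal 1" using assms by simp
  also have "\<dots> \<le> ennreal r" using True by (rule ennreal_leI)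
  finally show ?thesis by (rule order_trans) simp
next
  case False
  have "x \<le> ennreal 1 * u" using assms by simp
  also have "\<dots> \<le> ennreal (1 / r) * u" using False s by (intro mult_right_mono ennreal_leI) auto
  finally show ?thesis by (rule order_trans) simp
qed

text \<open>Each \<open>\<gamma>\<close> in a finite set of models has prior weight \<open>w \<gamma>\<close> and a finite prior measure \<open>G \<gamma>\<close> on its
  parameters. The total mass of \<open>G \<gamma>\<close> may differ from 1, so that bounds for a density suffice to
  apply the results. All densities are positive, which makes likelihood ratios and their reciprocals finite.\<close>

locale bayes_model =
  fixes \<mu> :: "'z measure" and ps :: "'z \<Rightarrow> real" and \<Gamma> :: "'g set" and G :: "'g \<Rightarrow> 'b measure"
    and p :: "'g \<Rightarrow> 'b \<Rightarrow> 'z \<Rightarrow> real" and w :: "'g \<Rightarrow> real" and n :: nat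
  assumes sf: "sigma_finite_measure \<mu>"
    and fin: "finite \<Gamma>"
    and G_finite: "\<And>\<gamma>. \<gamma> \<in> \<Gamma> \<Longrightarrow> finite_measure (G \<gamma>)"
    and p_meas: "\<And>\<gamma>. \<gamma> \<in> \<Gamma> \<Longrightarrow> (\<lambda>(\<beta>, z). p \<gamma> \<beta> z) \<in> borel_measurable (G \<gamma> \<Otimes>\<^sub>M \<mu>)"
    and ps_meas [measurable]: "ps \<in> borel_measurable \<mu>"
    and ps_pos: "\<And>z. z \<in> space \<mu> \<Longrightarrow> 0 < ps z"
    and p_pos: "\<And>\<gamma> \<beta> z. \<gamma> \<in> \<Gamma> \<Longrightarrow> z \<in> space \<mu> \<Longrightarrow> 0 < p \<gamma> \<beta> z"
    and ps_one: "(\<integral>\<^sup>+z. ennreal (ps z) \<partial>\<mu>) = 1"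
    and p_one: "\<And>\<gamma> \<beta>. \<gamma> \<in> \<Gamma> \<Longrightarrow> \<beta> \<in> space (G \<gamma>) \<Longrightarrow> (\<integral>\<^sup>+z. ennreal (p \<gamma> \<beta> z) \<partial>\<mu>) = 1"
    and w_nonneg: "\<And>\<gamma>. \<gamma> \<in> \<Gamma> \<Longrightarrow> 0 \<le> w \<gamma>"
begin

definition obs :: "'z measure" where "obs = density \<mu> (\<lambda>z. ennreal (ps z))"
definition sample :: "(nat \<Rightarrow> 'z) measure" where "sample = PiM {1..n} (\<lambda>_. obs)"

text \<open>Likelihoods are taken relative to the true density, and masses are nonnegative
  extended reals, so that Tonelli's theorem applies to them directly.\<close>

definition lratio :: "'g \<Rightarrow> 'b \<Rightarrow> (nat \<Rightarrow> 'z) \<Rightarrow> ennreal" where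
  "lratio \<gamma> \<beta> D = (\<Prod>i\<in>{1..n}. ennreal (p \<gamma> \<beta> (D i) / ps (D i)))"
definition inv_lratio :: "'g \<Rightarrow> 'b \<Rightarrow> (nat \<Rightarrow> 'z) \<Rightarrow> ennreal" where
  "inv_lratio \<gamma> \<beta> D = (\<Prod>i\<in>{1..n}. ennreal (ps (D i) / p \<gamma> \<beta> (D i)))"
definition root_ratio :: "'g \<Rightarrow> 'b \<Rightarrow> (nat \<Rightarrow> 'z) \<Rightarrow> ennreal" where
  "root_ratio \<gamma> b D = (\<Prod>i\<in>{1..n}. ennreal (sqrt (p \<gamma> b (D i) / ps (D i))))"
definition inv_root_ratio :: "'g \<Rightarrow> 'b \<Rightarrow> (nat \<Rightarrow> 'z) \<Rightarrow> ennreal" where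
  "inv_root_ratio \<gamma> b D = (\<Prod>i\<in>{1..n}. ennreal (sqrt (ps (D i) / p \<gamma> b (D i))))"
definition mass :: "'g \<Rightarrow> 'b set \<Rightarrow> (nat \<Rightarrow> 'z) \<Rightarrow> ennreal" where
  "mass \<gamma> E D = (\<integral>\<^sup>+\<beta>. lratio \<gamma> \<beta> D * indicator E \<beta> \<partial>G \<gamma>)"
definition evidence :: "(nat \<Rightarrow> 'z) \<Rightarrow> ennreal" where
  "evidence D = (\<Sum>\<gamma>\<in>\<Gamma>. ennreal (w \<gamma>) * mass \<gamma> (space (G \<gamma>)) D)"
definition post_prob :: "('g \<Rightarrow> 'b set) \<Rightarrow> (nat \<Rightarrow> 'z) \<Rightarrow> ennreal" where
  "post_prob A D = (\<Sum>\<gamma>\<in>\<Gamma>. ennreal (w \<gamma>) * mass \<gamma> (A \<gamma>) D) / evidence D"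

lemma prob_space_obs: "prob_space obs"
  using ps_one by (intro prob_spaceI) (simp add: obs_def emeasure_density cong: nn_integral_cong)

lemma sets_obs [measurable_cong]: "sets obs = sets \<mu>" and space_obs [simp]: "space obs = space \<mu>"
  by (simp_all add: obs_def)

lemma prob_space_sample: "prob_space sample"
  unfolding sample_def by (rule prob_space_PiM) (rule prob_space_obs)

lemma space_sample: "D \<in> space sample \<Longrightarrow> i \<in> {1..n} \<Longrightarrow> D i \<in> space \<mu>"
  unfolding sample_def space_PiM by auto

lemma measurable_sample_component: "i \<in> {1..n} \<Longrightarrow> (\<lambda>D. D i) \<in> sample \<rightarrow>\<^sub>M \<mu>"
  unfolding sample_def using measurable_component_singleton[of i "{1..n}" "\<lambda>_. obs"]
  by (simp cong: measurable_cong_sets add: sets_obs)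

lemma measurable_family_sample:
  fixes q :: "'b \<Rightarrow> 'z \<Rightarrow> ennreal"
  assumes [measurable]: "(\<lambda>(\<beta>, z). q \<beta> z) \<in> borel_measurable (H \<Otimes>\<^sub>M \<mu>)" and i: "i \<in> {1..n}"
  shows "(\<lambda>x. q (snd x) (fst x i)) \<in> borel_measurable (sample \<Otimes>\<^sub>M H)"
proof -
  have "(\<lambda>x. (snd x, fst x i)) \<in> sample \<Otimes>\<^sub>M H \<rightarrow>\<^sub>M H \<Otimes>\<^sub>M \<mu>"
    using measurable_compose[OF measurable_fst measurable_sample_component[OF i]] by (intro measurable_Pair) auto
  from measurable_compose[OF this assms(1)] show ?thesis by simp
qed

text \<open>Tonelli's theorem moves the expectation inside the integral over the parameter, and independence
  of the observations turns it into an \<open>n\<close>-th power. All expectations below are instances.\<close>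

lemma expectation_prod:
  fixes q :: "'b \<Rightarrow> 'z \<Rightarrow> ennreal"
  assumes q: "(\<lambda>(\<beta>, z). q \<beta> z) \<in> borel_measurable (H \<Otimes>\<^sub>M \<mu>)"
    and H: "sigma_finite_measure H" and E [measurable]: "E \<in> sets H"
  shows "(\<integral>\<^sup>+D. (\<integral>\<^sup>+\<beta>. (\<Prod>i\<in>{1..n}. q \<beta> (D i)) * indicator E \<beta> \<partial>H) \<partial>sample)
    = (\<integral>\<^sup>+\<beta>. (\<integral>\<^sup>+z. q \<beta> z * ennreal (ps z) \<partial>\<mu>) ^ n * indicator E \<beta> \<partial>H)"
proof -
  interpret O: prob_space obs by (rule prob_space_obs)
  interpret S: prob_space sample by (rule prob_space_sample)
  interpret H: sigma_finite_measure H by (rule H)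
  interpret pair_sigma_finite sample H ..
  interpret prod: product_sigma_finite "\<lambda>_::nat. obs" ..
  have [measurable]: "(\<lambda>x. q (snd x) (fst x i)) \<in> borel_measurable (sample \<Otimes>\<^sub>M H)" if "i \<in> {1..n}" for i
    by (rule measurable_family_sample[OF q that])
  have "(\<lambda>(D, \<beta>). (\<Prod>i\<in>{1..n}. q \<beta> (D i)) * indicator E \<beta>) \<in> borel_measurable (sample \<Otimes>\<^sub>M H)"
    unfolding split_beta' by (intro borel_measurable_times_ennreal borel_measurable_prod_ennreal) measurable
  then have "(\<integral>\<^sup>+D. (\<integral>\<^sup>+\<beta>. (\<Prod>i\<in>{1..n}. q \<beta> (D i)) * indicator E \<beta> \<partial>H) \<partial>sample)
    = (\<integral>\<^sup>+\<beta>. (\<integral>\<^sup>+D. (\<Prod>i\<in>{1..n}. q \<beta> (D i)) * indicator E \<beta> \<partial>sample) \<partial>H)"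
    by (rule Fubini'[symmetric])
  also have "\<dots> = (\<integral>\<^sup>+\<beta>. (\<integral>\<^sup>+z. q \<beta> z * ennreal (ps z) \<partial>\<mu>) ^ n * indicator E \<beta> \<partial>H)"
  proof (rule nn_integral_cong)
    fix \<beta> assume \<beta>: "\<beta> \<in> space H"
    have q\<beta> [measurable]: "q \<beta> \<in> borel_measurable \<mu>"
      using measurable_Pair2[OF q \<beta>] by simp
    have q\<beta>' [measurable]: "q \<beta> \<in> borel_measurable obs" using q\<beta> by (simp add: obs_def)
    have "(\<integral>\<^sup>+D. (\<Prod>i\<in>{1..n}. q \<beta> (D i)) * indicator E \<beta> \<partial>sample)
        = (\<integral>\<^sup>+D. (\<Prod>i\<in>{1..n}. q \<beta> (D i)) \<partial>sample) * indicator E \<beta>"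
    proof (rule nn_integral_multc)
      have "(\<lambda>D. q \<beta> (D i)) \<in> borel_measurable sample" if "i \<in> {1..n}" for i
        by (rule measurable_compose[OF measurable_sample_component[OF that] q\<beta>])
      then show "(\<lambda>D. \<Prod>i\<in>{1..n}. q \<beta> (D i)) \<in> borel_measurable sample" by (intro borel_measurable_prod_ennreal)
    qed
    also have "(\<integral>\<^sup>+D. (\<Prod>i\<in>{1..n}. q \<beta> (D i)) \<partial>sample) = (\<Prod>i\<in>{1..n}. integral\<^sup>N obs (q \<beta>))"
      unfolding sample_def by (rule prod.product_nn_integral_prod) auto
    also have "\<dots> = (\<integral>\<^sup>+z. q \<beta> z * ennreal (ps z) \<partial>\<mu>) ^ n"
      unfolding obs_def by (subst nn_integral_density) (auto simp: mult.commute)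
    finally show "(\<integral>\<^sup>+D. (\<Prod>i\<in>{1..n}. q \<beta> (D i)) * indicator E \<beta> \<partial>sample)
       = (\<integral>\<^sup>+z. q \<beta> z * ennreal (ps z) \<partial>\<mu>) ^ n * indicator E \<beta>" .
  qed
  finally show ?thesis .
qed

lemma lratio_pos:
  assumes "\<gamma> \<in> \<Gamma>" "D \<in> space sample"
  obtains r where "0 < r" "lratio \<gamma> \<beta> D = ennreal r"
    "inv_lratio \<gamma> \<beta> D = ennreal (1 / r)"
proof (rule that[of "\<Prod>i\<in>{1..n}. p \<gamma> \<beta> (D i) / ps (D i)"])
  have pos: "0 < p \<gamma> \<beta> (D i)" "0 < ps (D i)" if "i \<in> {1..n}" for i
    using p_pos[OF assms(1)] ps_pos space_sample[OF assms(2) that] by auto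
  show "0 < (\<Prod>i\<in>{1..n}. p \<gamma> \<beta> (D i) / ps (D i))" using pos by (intro prod_pos) auto
  show "lratio \<gamma> \<beta> D = ennreal (\<Prod>i\<in>{1..n}. p \<gamma> \<beta> (D i) / ps (D i))"
    unfolding lratio_def using pos by (intro prod_ennreal) (auto intro: less_imp_le)
  show "inv_lratio \<gamma> \<beta> D = ennreal (1 / (\<Prod>i\<in>{1..n}. p \<gamma> \<beta> (D i) / ps (D i)))"
    unfolding inv_lratio_def using pos by (subst prod_ennreal) (auto intro: less_imp_le simp: prod_dividef)
qed

lemma measurable_p_section:
  assumes "\<gamma> \<in> \<Gamma>" "\<beta> \<in> space (G \<gamma>)" shows "p \<gamma> \<beta> \<in> borel_measurable \<mu>"
  using measurable_Pair2[OF p_meas[OF assms(1)] assms(2)] by simp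

lemma lratio_meas:
  assumes \<gamma>: "\<gamma> \<in> \<Gamma>" shows "(\<lambda>(D, \<beta>). lratio \<gamma> \<beta> D) \<in> borel_measurable (sample \<Otimes>\<^sub>M G \<gamma>)"
proof -
  have "(\<lambda>(\<beta>, z). ennreal (p \<gamma> \<beta> z / ps z)) \<in> borel_measurable (G \<gamma> \<Otimes>\<^sub>M \<mu>)"
    using p_meas[OF \<gamma>] unfolding split_beta' by measurable
  from measurable_family_sample[OF this] show ?thesis
    unfolding lratio_def split_beta' by (intro borel_measurable_prod_ennreal) auto
qed

lemma measurable_mass:
  assumes \<gamma>: "\<gamma> \<in> \<Gamma>" and E [measurable]: "E \<in> sets (G \<gamma>)"
  shows "mass \<gamma> E \<in> borel_measurable sample"
proof -
  interpret finite_measure "G \<gamma>" by (rule G_finite[OF \<gamma>])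
  note [measurable] = lratio_meas[OF \<gamma>]
  show ?thesis unfolding mass_def[abs_def] by measurable
qed

lemma mass_mono: "E \<subseteq> F \<Longrightarrow> mass \<gamma> E D \<le> mass \<gamma> F D"
  unfolding mass_def by (intro nn_integral_mono mult_left_mono) (auto simp: indicator_def)

lemma mass_le_evidence:
  assumes "\<gamma> \<in> \<Gamma>" "E \<subseteq> space (G \<gamma>)" shows "ennreal (w \<gamma>) * mass \<gamma> E D \<le> evidence D"
proof -
  have "ennreal (w \<gamma>) * mass \<gamma> E D \<le> ennreal (w \<gamma>) * mass \<gamma> (space (G \<gamma>)) D"
    by (intro mult_left_mono mass_mono assms) simp
  also have "\<dots> \<le> evidence D" unfolding evidence_def using assms fin by (intro member_le_sum) auto
  finally show ?thesis .
qed

text \<open>For every \<open>r > 0\<close>, \<open>r + \<tau>\<^sup>2 / r \<ge> 2 \<tau>\<close>. Integrated over \<open>N\<close> with \<open>r\<close> the likelihood ratio, this says that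
  when the evidence is below \<open>w \<tau> m\<close> the reciprocal ratio has average at least \<open>1 / \<tau>\<close>. The
  indicator of small evidence is thus dominated by a quantity with computable expectation.\<close>

lemma small_evidence:
  assumes \<gamma>: "\<gamma> \<in> \<Gamma>" and N: "N \<in> sets (G \<gamma>)" and D: "D \<in> space sample"
    and w: "0 < w \<gamma>" and \<tau>: "0 < \<tau>" and m: "m = measure (G \<gamma>) N" "0 < m"
    and small: "evidence D < ennreal (w \<gamma> * \<tau> * m)"
  shows "1 \<le> ennreal (\<tau> / m) * (\<integral>\<^sup>+\<beta>. inv_lratio \<gamma> \<beta> D * indicator N \<beta> \<partial>G \<gamma>)"
proof (rule ccontr)
  define I where "I = (\<integral>\<^sup>+\<beta>. inv_lratio \<gamma> \<beta> D * indicator N \<beta> \<partial>G \<gamma>)"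
  assume "\<not> 1 \<le> ennreal (\<tau> / m) * (\<integral>\<^sup>+\<beta>. inv_lratio \<gamma> \<beta> D * indicator N \<beta> \<partial>G \<gamma>)"
  then have I1: "ennreal (\<tau> / m) * I < 1" unfolding I_def by simp
  interpret finite_measure "G \<gamma>" by (rule G_finite[OF \<gamma>])
  have [measurable]: "(\<lambda>\<beta>. lratio \<gamma> \<beta> D) \<in> borel_measurable (G \<gamma>)"
    using measurable_Pair2[OF lratio_meas[OF \<gamma>] D] by simp
  have [measurable]: "(\<lambda>\<beta>. inv_lratio \<gamma> \<beta> D) \<in> borel_measurable (G \<gamma>)"
    unfolding inv_lratio_def
  proof (intro borel_measurable_prod_ennreal)
    fix i assume "i \<in> {1..n}"
    then have "D i \<in> space \<mu>" using space_sample[OF D] by simp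
    from measurable_Pair1[OF p_meas[OF \<gamma>] this] have [measurable]: "(\<lambda>\<beta>. p \<gamma> \<beta> (D i)) \<in> borel_measurable (G \<gamma>)" by simp
    show "(\<lambda>\<beta>. ennreal (ps (D i) / p \<gamma> \<beta> (D i))) \<in> borel_measurable (G \<gamma>)" by simp
  qed
  have "ennreal (w \<gamma>) * mass \<gamma> N D < ennreal (w \<gamma>) * ennreal (\<tau> * m)"
    using order.strict_trans1[OF mass_le_evidence[OF \<gamma> sets.sets_into_space[OF N]] small] w \<tau> m
    by (simp add: ennreal_mult[symmetric] mult.assoc)
  then have M: "mass \<gamma> N D < ennreal (\<tau> * m)"
    by (metis leD leI mult_left_mono zero_le)
  have "ennreal (2 * \<tau> * m) = (\<integral>\<^sup>+\<beta>. ennreal (2 * \<tau>) * indicator N \<beta> \<partial>G \<gamma>)"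
    using \<tau> m N by (subst nn_integral_cmult_indicator) (auto simp: emeasure_eq_measure ennreal_mult)
  also have "\<dots> \<le> (\<integral>\<^sup>+\<beta>. lratio \<gamma> \<beta> D * indicator N \<beta> +
      ennreal (\<tau>\<^sup>2) * (inv_lratio \<gamma> \<beta> D * indicator N \<beta>) \<partial>G \<gamma>)"
  proof (rule nn_integral_mono)
    fix \<beta>
    obtain r where r: "0 < r" "lratio \<gamma> \<beta> D = ennreal r"
      "inv_lratio \<gamma> \<beta> D = ennreal (1 / r)" by (rule lratio_pos[OF \<gamma> D])
    have "0 \<le> (r - \<tau>)\<^sup>2" by simp
    then have "2 * \<tau> \<le> r + \<tau>\<^sup>2 * (1 / r)" using r(1) by (simp add: field_simps power2_eq_square)
    then have "ennreal (2 * \<tau>) \<le> ennreal r + ennreal (\<tau>\<^sup>2) * ennreal (1 / r)"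
      using r(1) by (simp add: ennreal_mult[symmetric] ennreal_plus[symmetric] ennreal_leI del: ennreal_plus)
    then show "ennreal (2 * \<tau>) * indicator N \<beta> \<le> lratio \<gamma> \<beta> D * indicator N \<beta> +
      ennreal (\<tau>\<^sup>2) * (inv_lratio \<gamma> \<beta> D * indicator N \<beta>)"
      unfolding r by (cases "\<beta> \<in> N") auto
  qed
  also have "\<dots> = mass \<gamma> N D + ennreal (\<tau>\<^sup>2) * I"
    unfolding mass_def I_def using N by (subst nn_integral_add) (auto simp: nn_integral_cmult)
  finally have key: "ennreal (2 * \<tau> * m) \<le> mass \<gamma> N D + ennreal (\<tau>\<^sup>2) * I" .
  have "ennreal (\<tau>\<^sup>2) * I = ennreal (\<tau> * m) * (ennreal (\<tau> / m) * I)"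
    using \<tau> m by (simp add: mult.assoc[symmetric] ennreal_mult[symmetric] power2_eq_square)
  also have "\<dots> \<le> ennreal (\<tau> * m) * 1" using I1 by (intro mult_left_mono) auto
  finally have I2: "ennreal (\<tau>\<^sup>2) * I \<le> ennreal (\<tau> * m)" by simp
  from M obtain a where a: "0 \<le> a" "mass \<gamma> N D = ennreal a" "a < \<tau> * m"
    by (cases "mass \<gamma> N D") (auto simp: ennreal_less_iff)
  have "ennreal (2 * \<tau> * m) \<le> ennreal a + ennreal (\<tau> * m)"
    using key I2 unfolding a by (meson add_left_mono order_trans)
  then have "2 * \<tau> * m \<le> a + \<tau> * m" using a \<tau> m
    by (simp add: ennreal_plus[symmetric] del: ennreal_plus)
  then show False using a by simp
qed

lemma evidence_meas: "evidence \<in> borel_measurable sample"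
  unfolding evidence_def[abs_def] using measurable_mass by auto

lemma post_prob_le_1:
  assumes A: "\<And>\<gamma>. \<gamma> \<in> \<Gamma> \<Longrightarrow> A \<gamma> \<in> sets (G \<gamma>)"
  shows "post_prob A D \<le> 1"
proof -
  have "(\<Sum>\<gamma>\<in>\<Gamma>. ennreal (w \<gamma>) * mass \<gamma> (A \<gamma>) D) \<le> evidence D"
    unfolding evidence_def using sets.sets_into_space[OF A]
    by (intro sum_mono mult_left_mono mass_mono) auto
  then have "post_prob A D \<le> evidence D / evidence D"
    unfolding post_prob_def by (rule divide_right_mono_ennreal)
  also have "\<dots> \<le> 1" by (rule ennreal_div_self_le_1)
  finally show ?thesis .
qed

lemma measurable_sample_prod:
  fixes f :: "'z \<Rightarrow> ennreal"
  assumes "f \<in> borel_measurable \<mu>"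
  shows "(\<lambda>D. \<Prod>i\<in>{1..n}. f (D i)) \<in> borel_measurable sample"
  by (intro borel_measurable_prod_ennreal measurable_compose[OF measurable_sample_component assms])

lemma root_ratio_meas:
  assumes "\<gamma> \<in> \<Gamma>" "b \<in> space (G \<gamma>)"
  shows "root_ratio \<gamma> b \<in> borel_measurable sample" "inv_root_ratio \<gamma> b \<in> borel_measurable sample"
proof -
  note [measurable] = measurable_p_section[OF assms]
  have "(\<lambda>z. ennreal (sqrt (p \<gamma> b z / ps z))) \<in> borel_measurable \<mu>" by measurable
  from measurable_sample_prod[OF this] show "root_ratio \<gamma> b \<in> borel_measurable sample"
    unfolding root_ratio_def[abs_def] .
  have "(\<lambda>z. ennreal (sqrt (ps z / p \<gamma> b z))) \<in> borel_measurable \<mu>" by measurable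
  from measurable_sample_prod[OF this] show "inv_root_ratio \<gamma> b \<in> borel_measurable sample"
    unfolding inv_root_ratio_def[abs_def] .
qed

lemma root_ratio_pos:
  assumes "\<gamma> \<in> \<Gamma>" "D \<in> space sample"
  obtains r where "0 < r" "root_ratio \<gamma> b D = ennreal r" "inv_root_ratio \<gamma> b D = ennreal (1 / r)"
proof -
  have pos: "0 < p \<gamma> b (D i)" "0 < ps (D i)" if "i \<in> {1..n}" for i
    using p_pos[OF assms(1)] ps_pos space_sample[OF assms(2) that] by auto
  define r where "r = (\<Prod>i\<in>{1..n}. sqrt (p \<gamma> b (D i) / ps (D i)))"
  have r: "0 < r" unfolding r_def using pos by (intro prod_pos) auto
  have 1: "root_ratio \<gamma> b D = ennreal r"
    unfolding root_ratio_def r_def using pos by (intro prod_ennreal) (auto intro: less_imp_le)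
  have "inv_root_ratio \<gamma> b D = ennreal (\<Prod>i\<in>{1..n}. sqrt (ps (D i) / p \<gamma> b (D i)))"
    unfolding inv_root_ratio_def using pos by (intro prod_ennreal) (auto intro: less_imp_le)
  also have "(\<Prod>i\<in>{1..n}. sqrt (ps (D i) / p \<gamma> b (D i))) = (\<Prod>i\<in>{1..n}. 1 / sqrt (p \<gamma> b (D i) / ps (D i)))"
    by (simp add: real_sqrt_divide)
  also have "\<dots> = 1 / r" unfolding r_def by (simp only: prod_dividef prod.neutral_const)
  finally show thesis using that[OF r 1] by simp
qed

lemma inv_lratio_meas:
  assumes "\<gamma> \<in> \<Gamma>"
  shows "(\<lambda>(\<beta>, z). ennreal (ps z / p \<gamma> \<beta> z)) \<in> borel_measurable (G \<gamma> \<Otimes>\<^sub>M \<mu>)"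
    and "(\<lambda>(D, \<beta>). inv_lratio \<gamma> \<beta> D) \<in> borel_measurable (sample \<Otimes>\<^sub>M G \<gamma>)"
proof -
  show *: "(\<lambda>(\<beta>, z). ennreal (ps z / p \<gamma> \<beta> z)) \<in> borel_measurable (G \<gamma> \<Otimes>\<^sub>M \<mu>)"
    using p_meas[OF assms] unfolding split_beta' by measurable
  show "(\<lambda>(D, \<beta>). inv_lratio \<gamma> \<beta> D) \<in> borel_measurable (sample \<Otimes>\<^sub>M G \<gamma>)"
    using measurable_family_sample[OF *]
    unfolding inv_lratio_def split_beta' by (intro borel_measurable_prod_ennreal) auto
qed

lemma inv_mass_meas:
  assumes \<gamma>: "\<gamma> \<in> \<Gamma>" and N [measurable]: "N \<in> sets (G \<gamma>)"
  shows "(\<lambda>D. \<integral>\<^sup>+\<beta>. inv_lratio \<gamma> \<beta> D * indicator N \<beta> \<partial>G \<gamma>) \<in> borel_measurable sample"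
proof -
  interpret finite_measure "G \<gamma>" by (rule G_finite[OF \<gamma>])
  note [measurable] = inv_lratio_meas(2)[OF \<gamma>]
  show ?thesis by measurable
qed

text \<open>The expected reciprocal likelihood ratio of one observation is 1 plus the chi-square divergence.\<close>

lemma expected_inv_mass:
  assumes \<gamma>: "\<gamma> \<in> \<Gamma>" and N: "N \<in> sets (G \<gamma>)"
    and chi: "\<And>\<beta>. \<beta> \<in> N \<Longrightarrow> (\<integral>\<^sup>+z. ennreal ((ps z)\<^sup>2 / p \<gamma> \<beta> z) \<partial>\<mu>) \<le> ennreal c" and c: "0 \<le> c"
  shows "(\<integral>\<^sup>+D. (\<integral>\<^sup>+\<beta>. inv_lratio \<gamma> \<beta> D * indicator N \<beta> \<partial>G \<gamma>) \<partial>sample) \<le> ennreal (c ^ n) * emeasure (G \<gamma>) N"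
proof -
  interpret F: finite_measure "G \<gamma>" by (rule G_finite[OF \<gamma>])
  have "(\<integral>\<^sup>+D. (\<integral>\<^sup>+\<beta>. inv_lratio \<gamma> \<beta> D * indicator N \<beta> \<partial>G \<gamma>) \<partial>sample)
    = (\<integral>\<^sup>+\<beta>. (\<integral>\<^sup>+z. ennreal (ps z / p \<gamma> \<beta> z) * ennreal (ps z) \<partial>\<mu>) ^ n * indicator N \<beta> \<partial>G \<gamma>)"
    unfolding inv_lratio_def by (rule expectation_prod[OF inv_lratio_meas(1)[OF \<gamma>] F.sigma_finite_measure_axioms N])
  also have "\<dots> \<le> (\<integral>\<^sup>+\<beta>. ennreal (c ^ n) * indicator N \<beta> \<partial>G \<gamma>)"
  proof (rule nn_integral_mono)
    fix \<beta>
    show "(\<integral>\<^sup>+z. ennreal (ps z / p \<gamma> \<beta> z) * ennreal (ps z) \<partial>\<mu>) ^ n * indicator N \<beta> \<le> ennreal (c ^ n) * indicator N \<beta>"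
    proof (cases "\<beta> \<in> N")
      case True
      have "(\<integral>\<^sup>+z. ennreal (ps z / p \<gamma> \<beta> z) * ennreal (ps z) \<partial>\<mu>) = (\<integral>\<^sup>+z. ennreal ((ps z)\<^sup>2 / p \<gamma> \<beta> z) \<partial>\<mu>)"
        using p_pos[OF \<gamma>] ps_pos
        by (intro nn_integral_cong) (simp add: ennreal_mult[symmetric] power2_eq_square less_imp_le)
      also have "\<dots> \<le> ennreal c" by (rule chi[OF True])
      finally have "(\<integral>\<^sup>+z. ennreal (ps z / p \<gamma> \<beta> z) * ennreal (ps z) \<partial>\<mu>) ^ n \<le> ennreal c ^ n"
        by (intro power_mono) auto
      then show ?thesis using True c by (simp add: ennreal_power)
    qed simp
  qed
  also have "\<dots> = ennreal (c ^ n) * emeasure (G \<gamma>) N" by (rule nn_integral_cmult_indicator[OF N])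
  finally show ?thesis .
qed

lemma expected_root_ratio:
  assumes \<gamma>: "\<gamma> \<in> \<Gamma>" and b: "b \<in> space (G \<gamma>)"
    and aff: "(\<integral>\<^sup>+z. ennreal (sqrt (p \<gamma> b z * ps z)) \<partial>\<mu>) \<le> ennreal a" and a: "0 \<le> a"
  shows "(\<integral>\<^sup>+D. root_ratio \<gamma> b D \<partial>sample) \<le> ennreal (a ^ n)"
proof -
  interpret O: prob_space obs by (rule prob_space_obs)
  interpret prod: product_sigma_finite "\<lambda>_::nat. obs" ..
  note [measurable] = measurable_p_section[OF \<gamma> b]
  have "(\<integral>\<^sup>+D. root_ratio \<gamma> b D \<partial>sample) = (\<Prod>i\<in>{1..n}. \<integral>\<^sup>+z. ennreal (sqrt (p \<gamma> b z / ps z)) \<partial>obs)"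
    unfolding root_ratio_def sample_def by (rule prod.product_nn_integral_prod) (auto simp: obs_def)
  also have "\<dots> = (\<integral>\<^sup>+z. ennreal (sqrt (p \<gamma> b z / ps z)) \<partial>obs) ^ n" by simp
  also have "(\<integral>\<^sup>+z. ennreal (sqrt (p \<gamma> b z / ps z)) \<partial>obs) = (\<integral>\<^sup>+z. ennreal (ps z) * ennreal (sqrt (p \<gamma> b z / ps z)) \<partial>\<mu>)"
    unfolding obs_def by (rule nn_integral_density) measurable
  also have "\<dots> = (\<integral>\<^sup>+z. ennreal (sqrt (p \<gamma> b z * ps z)) \<partial>\<mu>)"
  proof (rule nn_integral_cong)
    fix z assume z: "z \<in> space \<mu>"
    have "sqrt (p \<gamma> b z / ps z) = sqrt (p \<gamma> b z * ps z / (ps z)\<^sup>2)"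
      using ps_pos[OF z] by (simp add: power2_eq_square)
    also have "\<dots> = sqrt (p \<gamma> b z * ps z) / ps z"
      using ps_pos[OF z] by (simp only: real_sqrt_divide real_sqrt_abs abs_of_pos)
    finally have "ps z * sqrt (p \<gamma> b z / ps z) = sqrt (p \<gamma> b z * ps z)" using ps_pos[OF z] by simp
    then show "ennreal (ps z) * ennreal (sqrt (p \<gamma> b z / ps z)) = ennreal (sqrt (p \<gamma> b z * ps z))"
      using ps_pos[OF z] p_pos[OF \<gamma> z, of b] by (simp add: ennreal_mult[symmetric] less_imp_le)
  qed
  also have "\<dots> ^ n \<le> ennreal a ^ n" by (intro power_mono aff) simp
  also have "\<dots> = ennreal (a ^ n)" using a by (simp add: ennreal_power)
  finally show ?thesis .
qed

text \<open>The factor \<open>1 / S\<close> for the representative \<open>b\<close> against the likelihood ratio of another point of \<open>E\<close>: the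
  expectation for one observation is the quantity in \<open>cross_affinity\<close>.\<close>

lemma expected_inv_root_mass:
  assumes \<gamma>: "\<gamma> \<in> \<Gamma>" and b: "b \<in> space (G \<gamma>)" and E: "E \<in> sets (G \<gamma>)"
    and aff: "(\<integral>\<^sup>+z. ennreal (sqrt (p \<gamma> b z * ps z)) \<partial>\<mu>) \<le> ennreal a" and a: "0 \<le> a"
    and chi: "\<And>\<beta>. \<beta> \<in> E \<Longrightarrow> (\<integral>\<^sup>+z. ennreal ((p \<gamma> \<beta> z)\<^sup>2 / p \<gamma> b z) \<partial>\<mu>) \<le> ennreal (1 + \<kappa>\<^sup>2)" and \<kappa>: "0 < \<kappa>"
  shows "(\<integral>\<^sup>+D. inv_root_ratio \<gamma> b D * mass \<gamma> E D \<partial>sample) \<le> ennreal ((a + \<kappa>) ^ n) * emeasure (G \<gamma>) E"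
proof -
  interpret F: finite_measure "G \<gamma>" by (rule G_finite[OF \<gamma>])
  define Q where "Q \<beta> z = ennreal (sqrt (ps z / p \<gamma> b z)) * ennreal (p \<gamma> \<beta> z / ps z)" for \<beta> z
  have Q: "(\<lambda>(\<beta>, z). Q \<beta> z) \<in> borel_measurable (G \<gamma> \<Otimes>\<^sub>M \<mu>)"
    using p_meas[OF \<gamma>] measurable_p_section[OF \<gamma> b] unfolding Q_def split_beta' by measurable
  have "(\<integral>\<^sup>+D. inv_root_ratio \<gamma> b D * mass \<gamma> E D \<partial>sample)
    = (\<integral>\<^sup>+D. (\<integral>\<^sup>+\<beta>. (\<Prod>i\<in>{1..n}. Q \<beta> (D i)) * indicator E \<beta> \<partial>G \<gamma>) \<partial>sample)"
  proof (rule nn_integral_cong)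
    fix D assume D: "D \<in> space sample"
    have [measurable]: "(\<lambda>\<beta>. lratio \<gamma> \<beta> D) \<in> borel_measurable (G \<gamma>)"
      using measurable_Pair2[OF lratio_meas[OF \<gamma>] D] by simp
    note [measurable] = E
    have "inv_root_ratio \<gamma> b D * mass \<gamma> E D = (\<integral>\<^sup>+\<beta>. inv_root_ratio \<gamma> b D * (lratio \<gamma> \<beta> D * indicator E \<beta>) \<partial>G \<gamma>)"
      unfolding mass_def by (rule nn_integral_cmult[symmetric]) measurable
    also have "\<dots> = (\<integral>\<^sup>+\<beta>. (\<Prod>i\<in>{1..n}. Q \<beta> (D i)) * indicator E \<beta> \<partial>G \<gamma>)"
      unfolding inv_root_ratio_def lratio_def Q_def prod.distrib by (simp only: mult.assoc)
    finally show "inv_root_ratio \<gamma> b D * mass \<gamma> E D = (\<integral>\<^sup>+\<beta>. (\<Prod>i\<in>{1..n}. Q \<beta> (D i)) * indicator E \<beta> \<partial>G \<gamma>)" .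
  qed
  also have "\<dots> = (\<integral>\<^sup>+\<beta>. (\<integral>\<^sup>+z. Q \<beta> z * ennreal (ps z) \<partial>\<mu>) ^ n * indicator E \<beta> \<partial>G \<gamma>)"
    by (rule expectation_prod[OF Q F.sigma_finite_measure_axioms E])
  also have "\<dots> \<le> (\<integral>\<^sup>+\<beta>. ennreal ((a + \<kappa>) ^ n) * indicator E \<beta> \<partial>G \<gamma>)"
  proof (rule nn_integral_mono)
    fix \<beta> assume sp: "\<beta> \<in> space (G \<gamma>)"
    show "(\<integral>\<^sup>+z. Q \<beta> z * ennreal (ps z) \<partial>\<mu>) ^ n * indicator E \<beta> \<le> ennreal ((a + \<kappa>) ^ n) * indicator E \<beta>"
    proof (cases "\<beta> \<in> E")
      case True
      have "(\<integral>\<^sup>+z. Q \<beta> z * ennreal (ps z) \<partial>\<mu>) = (\<integral>\<^sup>+z. ennreal (sqrt (ps z / p \<gamma> b z) * p \<gamma> \<beta> z) \<partial>\<mu>)"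
      proof (rule nn_integral_cong)
        fix z assume z: "z \<in> space \<mu>"
        have "sqrt (ps z / p \<gamma> b z) * (p \<gamma> \<beta> z / ps z) * ps z = sqrt (ps z / p \<gamma> b z) * p \<gamma> \<beta> z"
          using ps_pos[OF z] by simp
        then show "Q \<beta> z * ennreal (ps z) = ennreal (sqrt (ps z / p \<gamma> b z) * p \<gamma> \<beta> z)"
          unfolding Q_def using ps_pos[OF z] p_pos[OF \<gamma> z, of b] p_pos[OF \<gamma> z, of \<beta>]
          by (simp add: ennreal_mult[symmetric] less_imp_le)
      qed
      also have "\<dots> \<le> ennreal (a + \<kappa>)"
        by (rule cross_affinity[OF measurable_p_section[OF \<gamma> sp] measurable_p_section[OF \<gamma> b] ps_meas
            p_pos[OF \<gamma>] p_pos[OF \<gamma>] ps_pos p_one[OF \<gamma> sp] p_one[OF \<gamma> b] ps_one aff a chi[OF True] \<kappa>])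
      finally have "(\<integral>\<^sup>+z. Q \<beta> z * ennreal (ps z) \<partial>\<mu>) ^ n \<le> ennreal (a + \<kappa>) ^ n"
        by (intro power_mono) auto
      also have "\<dots> = ennreal ((a + \<kappa>) ^ n)" using a \<kappa> by (intro ennreal_power) simp
      finally show ?thesis by (rule mult_right_mono) simp
    qed simp
  qed
  also have "\<dots> = ennreal ((a + \<kappa>) ^ n) * emeasure (G \<gamma>) E" by (rule nn_integral_cmult_indicator[OF E])
  finally show ?thesis .
qed

lemma expected_mass:
  assumes g: "\<gamma> \<in> \<Gamma>" and E: "E \<in> sets (G \<gamma>)"
  shows "(\<integral>\<^sup>+D. mass \<gamma> E D \<partial>sample) = emeasure (G \<gamma>) E"
proof -
  interpret F: finite_measure "G \<gamma>" by (rule G_finite[OF g])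
  have Q: "(\<lambda>(\<beta>, z). ennreal (p \<gamma> \<beta> z / ps z)) \<in> borel_measurable (G \<gamma> \<Otimes>\<^sub>M \<mu>)"
    using p_meas[OF g] unfolding split_beta' by measurable
  have "(\<integral>\<^sup>+D. mass \<gamma> E D \<partial>sample) = (\<integral>\<^sup>+\<beta>. (\<integral>\<^sup>+z. ennreal (p \<gamma> \<beta> z / ps z) * ennreal (ps z) \<partial>\<mu>) ^ n * indicator E \<beta> \<partial>G \<gamma>)"
    unfolding mass_def lratio_def by (rule expectation_prod[OF Q F.sigma_finite_measure_axioms E])
  also have "\<dots> = (\<integral>\<^sup>+\<beta>. indicator E \<beta> \<partial>G \<gamma>)"
  proof (rule nn_integral_cong)
    fix \<beta> assume sp: "\<beta> \<in> space (G \<gamma>)"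
    have "(\<integral>\<^sup>+z. ennreal (p \<gamma> \<beta> z / ps z) * ennreal (ps z) \<partial>\<mu>) = (\<integral>\<^sup>+z. ennreal (p \<gamma> \<beta> z) \<partial>\<mu>)"
    proof (rule nn_integral_cong)
      fix z assume z: "z \<in> space \<mu>"
      show "ennreal (p \<gamma> \<beta> z / ps z) * ennreal (ps z) = ennreal (p \<gamma> \<beta> z)"
        using ps_pos[OF z] p_pos[OF g z, of \<beta>] by (simp add: ennreal_mult[symmetric])
    qed
    then have one: "(\<integral>\<^sup>+z. ennreal (p \<gamma> \<beta> z / ps z) * ennreal (ps z) \<partial>\<mu>) = 1"
      using p_one[OF g sp] by (simp only:)
    show "(\<integral>\<^sup>+z. ennreal (p \<gamma> \<beta> z / ps z) * ennreal (ps z) \<partial>\<mu>) ^ n * indicator E \<beta> = indicator E \<beta>"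
      unfolding one by simp
  qed
  also have "\<dots> = emeasure (G \<gamma>) E" by (rule nn_integral_indicator[OF E])
  finally show ?thesis .
qed

lemma expected_scaled_mass:
  assumes g: "\<gamma> \<in> \<Gamma>" and E: "E \<in> sets (G \<gamma>)"
  shows "(\<integral>\<^sup>+D. x * (y * mass \<gamma> E D) \<partial>sample) = x * (y * emeasure (G \<gamma>) E)"
proof -
  note m = measurable_mass[OF g E]
  have m': "(\<lambda>D. y * mass \<gamma> E D) \<in> borel_measurable sample" using m by measurable
  show ?thesis by (simp only: nn_integral_cmult[OF m'] nn_integral_cmult[OF m] expected_mass[OF g E])
qed

lemma mass_cover:
  assumes \<gamma>: "\<gamma> \<in> \<Gamma>" and D: "D \<in> space sample" and I: "finite I"
    and F: "F \<in> sets (G \<gamma>)" and c: "\<And>z. z \<in> I \<Longrightarrow> c z \<in> sets (G \<gamma>)" and cover: "E \<subseteq> F \<union> (\<Union>z\<in>I. c z)"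
  shows "mass \<gamma> E D \<le> (\<Sum>z\<in>I. mass \<gamma> (c z) D) + mass \<gamma> F D"
proof -
  note [measurable] = F c
  have [measurable]: "(\<lambda>\<beta>. lratio \<gamma> \<beta> D) \<in> borel_measurable (G \<gamma>)"
    using measurable_Pair2[OF lratio_meas[OF \<gamma>] D] by simp
  have "mass \<gamma> E D \<le> (\<integral>\<^sup>+\<beta>. (\<Sum>z\<in>I. lratio \<gamma> \<beta> D * indicator (c z) \<beta>) + lratio \<gamma> \<beta> D * indicator F \<beta> \<partial>G \<gamma>)"
    unfolding mass_def
  proof (rule nn_integral_mono)
    fix \<beta>
    show "lratio \<gamma> \<beta> D * indicator E \<beta> \<le> (\<Sum>z\<in>I. lratio \<gamma> \<beta> D * indicator (c z) \<beta>) + lratio \<gamma> \<beta> D * indicator F \<beta>"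
    proof (cases "\<beta> \<in> E \<and> \<beta> \<notin> F")
      case True
      then obtain z where z: "z \<in> I" "\<beta> \<in> c z" using cover by blast
      have "lratio \<gamma> \<beta> D * indicator E \<beta> = lratio \<gamma> \<beta> D * indicator (c z) \<beta>" using z True by simp
      also have "\<dots> \<le> (\<Sum>z\<in>I. lratio \<gamma> \<beta> D * indicator (c z) \<beta>)" using z I by (intro member_le_sum) auto
      finally show ?thesis by (rule order_trans) simp
    next
      case False
      then show ?thesis by (cases "\<beta> \<in> E") (simp_all add: indicator_def)
    qed
  qed
  also have "\<dots> = (\<Sum>z\<in>I. mass \<gamma> (c z) D) + mass \<gamma> F D"
    unfolding mass_def by (subst nn_integral_add) (auto simp: nn_integral_sum)
  finally show ?thesis .
qed

text \<open>The four terms come from the event of small evidence, from the roots of the likelihood ratios of the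
  cell representatives, from the cells divided by those roots, and from the part outside the sieve.
  Representatives are chosen in the intersection of a cell with \<open>A\<close>, since only points of \<open>A\<close> are
  known to be separated from the truth; cells that miss \<open>A\<close> are dropped.\<close>

theorem finite_sample_bound:
  fixes cell :: "'g \<Rightarrow> 'c \<Rightarrow> 'b set"
  assumes A: "\<And>\<gamma>. \<gamma> \<in> \<Gamma> \<Longrightarrow> A \<gamma> \<in> sets (G \<gamma>)"
    and aff: "\<And>\<gamma> \<beta>. \<gamma> \<in> \<Gamma> \<Longrightarrow> \<beta> \<in> A \<gamma> \<Longrightarrow> (\<integral>\<^sup>+z. ennreal (sqrt (p \<gamma> \<beta> z * ps z)) \<partial>\<mu>) \<le> ennreal a"
    and a: "0 \<le> a"
    and Z: "\<And>\<gamma>. \<gamma> \<in> \<Gamma> \<Longrightarrow> finite (Z \<gamma>)"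
    and cell: "\<And>\<gamma> z. \<gamma> \<in> \<Gamma> \<Longrightarrow> z \<in> Z \<gamma> \<Longrightarrow> cell \<gamma> z \<in> sets (G \<gamma>)"
    and chi: "\<And>\<gamma> z \<beta> \<beta>'. \<gamma> \<in> \<Gamma> \<Longrightarrow> z \<in> Z \<gamma> \<Longrightarrow> \<beta> \<in> cell \<gamma> z \<Longrightarrow> \<beta>' \<in> cell \<gamma> z \<Longrightarrow>
        (\<integral>\<^sup>+z. ennreal ((p \<gamma> \<beta> z)\<^sup>2 / p \<gamma> \<beta>' z) \<partial>\<mu>) \<le> ennreal (1 + \<kappa>\<^sup>2)"
    and \<kappa>: "0 < \<kappa>"
    and Out: "\<And>\<gamma>. \<gamma> \<in> \<Gamma> \<Longrightarrow> Out \<gamma> \<in> sets (G \<gamma>)"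
    and cover: "\<And>\<gamma>. \<gamma> \<in> \<Gamma> \<Longrightarrow> A \<gamma> \<subseteq> Out \<gamma> \<union> (\<Union>z\<in>Z \<gamma>. cell \<gamma> z)"
    and Out_mass: "\<And>\<gamma>. \<gamma> \<in> \<Gamma> \<Longrightarrow> emeasure (G \<gamma>) (Out \<gamma>) \<le> ennreal \<rho>" and \<rho>: "0 \<le> \<rho>"
    and total: "\<And>\<gamma>. \<gamma> \<in> \<Gamma> \<Longrightarrow> emeasure (G \<gamma>) (space (G \<gamma>)) \<le> ennreal T" and T: "0 \<le> T"
    and g0: "g0 \<in> \<Gamma>" "0 < w g0" and N: "N \<in> sets (G g0)" and m: "m = measure (G g0) N" "0 < m"
    and chi0: "\<And>\<beta>. \<beta> \<in> N \<Longrightarrow> (\<integral>\<^sup>+z. ennreal ((ps z)\<^sup>2 / p g0 \<beta> z) \<partial>\<mu>) \<le> ennreal (1 + \<kappa>0)" and \<kappa>0: "0 \<le> \<kappa>0"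
    and \<tau>: "0 < \<tau>" and w1: "(\<Sum>\<gamma>\<in>\<Gamma>. w \<gamma>) \<le> 1" and Ncells: "real (card (Sigma \<Gamma> Z)) \<le> Nc"
  shows "(\<integral>\<^sup>+D. post_prob A D \<partial>sample) \<le>
    ennreal (\<tau> * (1 + \<kappa>0) ^ n + Nc * (a ^ n + T * (a + \<kappa>) ^ n / (w g0 * \<tau> * m)) + \<rho> / (w g0 * \<tau> * m))"
proof -
  define c where "c = w g0 * \<tau> * m"
  have c: "0 < c" unfolding c_def using g0 \<tau> m by simp
  define Z' where "Z' \<gamma> = {z \<in> Z \<gamma>. cell \<gamma> z \<inter> A \<gamma> \<noteq> {}}" for \<gamma>
  have finZ': "finite (Z' \<gamma>)" if "\<gamma> \<in> \<Gamma>" for \<gamma> unfolding Z'_def using Z[OF that] by simp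
  define E where "E \<gamma> z = cell \<gamma> z \<inter> A \<gamma>" for \<gamma> z
  have E: "E \<gamma> z \<in> sets (G \<gamma>)" if "\<gamma> \<in> \<Gamma>" "z \<in> Z' \<gamma>" for \<gamma> z
    using cell[OF that(1)] A[OF that(1)] that(2) unfolding E_def Z'_def by auto
  define b where "b \<gamma> z = (SOME b. b \<in> E \<gamma> z)" for \<gamma> z
  have b: "b \<gamma> z \<in> E \<gamma> z" if "z \<in> Z' \<gamma>" for \<gamma> z
  proof -
    have "\<exists>b. b \<in> E \<gamma> z" using that unfolding Z'_def E_def by auto
    from someI_ex[OF this] show ?thesis unfolding b_def .
  qed
  have bG: "b \<gamma> z \<in> space (G \<gamma>)" if "\<gamma> \<in> \<Gamma>" "z \<in> Z' \<gamma>" for \<gamma> z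
    using b[OF that(2)] sets.sets_into_space[OF E[OF that]] by blast
  have Z'_in: "z \<in> Z \<gamma>" if "z \<in> Z' \<gamma>" for \<gamma> z using that unfolding Z'_def by simp
  define t0 where "t0 D = ennreal (\<tau> / m) * (\<integral>\<^sup>+\<beta>. inv_lratio g0 \<beta> D * indicator N \<beta> \<partial>G g0)" for D
  define t1 where "t1 \<gamma> z D = root_ratio \<gamma> (b \<gamma> z) D +
      ennreal (1 / c) * (ennreal (w \<gamma>) * (inv_root_ratio \<gamma> (b \<gamma> z) D * mass \<gamma> (E \<gamma> z) D))" for \<gamma> z D
  define t2 where "t2 \<gamma> D = ennreal (1 / c) * (ennreal (w \<gamma>) * mass \<gamma> (Out \<gamma>) D)" for \<gamma> D

  \<comment> \<open>If the evidence is small, the posterior mass is at most 1 and \<open>t0\<close> is at least 1; otherwise every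
    quotient by the evidence is bounded by the quotient by \<open>c\<close>.\<close>
  have pointwise: "post_prob A D \<le> t0 D + (\<Sum>\<gamma>\<in>\<Gamma>. (\<Sum>z\<in>Z' \<gamma>. t1 \<gamma> z D) + t2 \<gamma> D)"
    if D: "D \<in> space sample" for D
  proof (cases "evidence D < ennreal c")
    case True
    have "post_prob A D \<le> 1" by (rule post_prob_le_1[OF A])
    also have "\<dots> \<le> t0 D" unfolding t0_def
      by (rule small_evidence[OF g0(1) N D g0(2) \<tau> m]) (use True c_def in simp)
    finally show ?thesis by (rule order_trans) simp
  next
    case False
    then have ev: "ennreal c \<le> evidence D" by simp
    have div_c: "X / evidence D \<le> ennreal (1 / c) * X" for X
    proof -
      have "X / evidence D \<le> X / ennreal c" unfolding divide_ennreal_def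
        using ev by (intro mult_left_mono ennreal_inverse_antimono) auto
      also have "\<dots> = ennreal (1 / c) * X"
        using c by (simp add: divide_ennreal_def inverse_ennreal mult.commute inverse_eq_divide)
      finally show ?thesis .
    qed
    have cell_le: "ennreal (w \<gamma>) * mass \<gamma> (E \<gamma> z) D / evidence D \<le> t1 \<gamma> z D" if x: "\<gamma> \<in> \<Gamma>" "z \<in> Z' \<gamma>" for \<gamma> z
    proof -
      obtain r where r: "0 < r" "root_ratio \<gamma> (b \<gamma> z) D = ennreal r" "inv_root_ratio \<gamma> (b \<gamma> z) D = ennreal (1 / r)"
        by (rule root_ratio_pos[OF x(1) D])
      define u where "u = ennreal (w \<gamma>) * mass \<gamma> (E \<gamma> z) D"
      have "u \<le> evidence D" unfolding u_def
        by (rule mass_le_evidence[OF x(1) sets.sets_into_space[OF E[OF x]]])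
      then have "u / evidence D \<le> evidence D / evidence D" by (rule divide_right_mono_ennreal)
      also have "\<dots> \<le> 1" by (rule ennreal_div_self_le_1)
      finally have "u / evidence D \<le> ennreal r + ennreal (1 / r) * (ennreal (1 / c) * u)"
        by (rule quotient_le_split[OF _ div_c r(1)])
      then show ?thesis unfolding t1_def r u_def by (simp only: ac_simps)
    qed
    have "(\<Sum>\<gamma>\<in>\<Gamma>. ennreal (w \<gamma>) * mass \<gamma> (A \<gamma>) D)
        \<le> (\<Sum>\<gamma>\<in>\<Gamma>. ennreal (w \<gamma>) * ((\<Sum>z\<in>Z' \<gamma>. mass \<gamma> (E \<gamma> z) D) + mass \<gamma> (Out \<gamma>) D))"
    proof (intro sum_mono mult_left_mono mass_cover D)
      fix \<gamma> assume \<gamma>: "\<gamma> \<in> \<Gamma>"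
      show "A \<gamma> \<subseteq> Out \<gamma> \<union> (\<Union>z\<in>Z' \<gamma>. E \<gamma> z)" using cover[OF \<gamma>] unfolding Z'_def E_def by blast
    qed (use finZ' Out E in auto)
    then have "post_prob A D \<le> (\<Sum>\<gamma>\<in>\<Gamma>. ennreal (w \<gamma>) * ((\<Sum>z\<in>Z' \<gamma>. mass \<gamma> (E \<gamma> z) D) + mass \<gamma> (Out \<gamma>) D)) / evidence D"
      unfolding post_prob_def by (rule divide_right_mono_ennreal)
    also have "\<dots> = (\<Sum>\<gamma>\<in>\<Gamma>. (\<Sum>z\<in>Z' \<gamma>. ennreal (w \<gamma>) * mass \<gamma> (E \<gamma> z) D / evidence D) + ennreal (w \<gamma>) * mass \<gamma> (Out \<gamma>) D / evidence D)"
      unfolding divide_ennreal_def sum_distrib_right sum_distrib_left distrib_left distrib_right ..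
    also have "\<dots> \<le> (\<Sum>\<gamma>\<in>\<Gamma>. (\<Sum>z\<in>Z' \<gamma>. t1 \<gamma> z D) + t2 \<gamma> D)"
      unfolding t2_def by (intro sum_mono add_mono cell_le div_c)
    finally show ?thesis by (rule order_trans) simp
  qed

  have t0_meas: "t0 \<in> borel_measurable sample"
    unfolding t0_def[abs_def] using inv_mass_meas[OF g0(1) N] by measurable
  have t1_meas: "t1 \<gamma> z \<in> borel_measurable sample" if "\<gamma> \<in> \<Gamma>" "z \<in> Z' \<gamma>" for \<gamma> z
    unfolding t1_def[abs_def] using root_ratio_meas[OF that(1) bG[OF that]] measurable_mass[OF that(1) E[OF that]]
    by measurable
  have t2_meas: "t2 \<gamma> \<in> borel_measurable sample" if "\<gamma> \<in> \<Gamma>" for \<gamma>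
    unfolding t2_def[abs_def] using measurable_mass[OF that Out[OF that]] by measurable

  have e0: "(\<integral>\<^sup>+D. t0 D \<partial>sample) \<le> ennreal (\<tau> * (1 + \<kappa>0) ^ n)"
  proof -
    interpret F: finite_measure "G g0" by (rule G_finite[OF g0(1)])
    have "(\<integral>\<^sup>+D. t0 D \<partial>sample) = ennreal (\<tau> / m) * (\<integral>\<^sup>+D. (\<integral>\<^sup>+\<beta>. inv_lratio g0 \<beta> D * indicator N \<beta> \<partial>G g0) \<partial>sample)"
      unfolding t0_def by (rule nn_integral_cmult[OF inv_mass_meas[OF g0(1) N]])
    also have "\<dots> \<le> ennreal (\<tau> / m) * (ennreal ((1 + \<kappa>0) ^ n) * emeasure (G g0) N)"
      using \<kappa>0 by (intro mult_left_mono expected_inv_mass[OF g0(1) N chi0]) auto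
    also have "\<dots> = ennreal (\<tau> * (1 + \<kappa>0) ^ n)"
    proof -
      define X where "X = (1 + \<kappa>0) ^ n"
      have "0 \<le> X" unfolding X_def using \<kappa>0 by simp
      then have "ennreal (\<tau> / m) * (ennreal X * ennreal m) = ennreal (\<tau> * X)"
        using \<tau> m(2) by (simp add: ennreal_mult[symmetric])
      then show ?thesis unfolding X_def F.emeasure_eq_measure m(1) .
    qed
    finally show ?thesis .
  qed

  define Pn where "Pn = (a + \<kappa>) ^ n"
  have Pn: "0 \<le> Pn" unfolding Pn_def using a \<kappa> by simp
  define An where "An = a ^ n"
  have An: "0 \<le> An" unfolding An_def using a by simp
  have e1: "(\<integral>\<^sup>+D. t1 \<gamma> z D \<partial>sample) \<le> ennreal (An + T * Pn / c)" if x: "\<gamma> \<in> \<Gamma>" "z \<in> Z' \<gamma>" for \<gamma> z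
  proof -
    have bA: "b \<gamma> z \<in> A \<gamma>" "b \<gamma> z \<in> cell \<gamma> z" using b[OF x(2)] unfolding E_def by auto
    note aff_b = aff[OF x(1) bA(1)]
    have "w \<gamma> \<le> (\<Sum>\<gamma>\<in>\<Gamma>. w \<gamma>)" using w_nonneg fin x(1) by (intro member_le_sum) auto
    then have w01: "w \<gamma> \<le> 1" using w1 by linarith
    have "(\<integral>\<^sup>+D. inv_root_ratio \<gamma> (b \<gamma> z) D * mass \<gamma> (E \<gamma> z) D \<partial>sample) \<le> ennreal (Pn) * emeasure (G \<gamma>) (E \<gamma> z)"
      by (rule expected_inv_root_mass[OF x(1) bG[OF x] E[OF x] aff_b a _ \<kappa>, folded Pn_def])
        (rule chi[OF x(1) Z'_in[OF x(2)] _ bA(2)], simp add: E_def)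
    also have "\<dots> \<le> ennreal (Pn) * ennreal T"
      by (intro mult_left_mono order_trans[OF emeasure_space total[OF x(1)]]) simp
    also have "\<dots> = ennreal (T * Pn)" using T Pn by (simp add: ennreal_mult[symmetric] mult.commute)
    finally have two: "(\<integral>\<^sup>+D. inv_root_ratio \<gamma> (b \<gamma> z) D * mass \<gamma> (E \<gamma> z) D \<partial>sample) \<le> ennreal (T * Pn)" .
    have "(\<integral>\<^sup>+D. t1 \<gamma> z D \<partial>sample) = (\<integral>\<^sup>+D. root_ratio \<gamma> (b \<gamma> z) D \<partial>sample) +
        ennreal (1 / c) * (ennreal (w \<gamma>) * (\<integral>\<^sup>+D. inv_root_ratio \<gamma> (b \<gamma> z) D * mass \<gamma> (E \<gamma> z) D \<partial>sample))"
    proof -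
      note m1 = root_ratio_meas[OF x(1) bG[OF x]]
      note m2 = borel_measurable_times_ennreal[OF m1(2) measurable_mass[OF x(1) E[OF x]]]
      show ?thesis unfolding t1_def by (rule nn_integral_affine[OF m1(1) m2])
    qed
    also have "\<dots> \<le> ennreal (An) + ennreal (1 / c) * (ennreal 1 * ennreal (T * Pn))"
      by (intro add_mono expected_root_ratio[OF x(1) bG[OF x] aff_b a, folded An_def] mult_left_mono mult_mono two ennreal_leI w01) auto
    also have "\<dots> = ennreal (An + T * Pn / c)"
      using c T Pn An by (simp add: ennreal_mult[symmetric])
    finally show ?thesis .
  qed

  have e2: "(\<integral>\<^sup>+D. t2 \<gamma> D \<partial>sample) \<le> ennreal (w \<gamma> * (\<rho> / c))" if g: "\<gamma> \<in> \<Gamma>" for \<gamma>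
  proof -
    have "(\<integral>\<^sup>+D. t2 \<gamma> D \<partial>sample) = ennreal (1 / c) * (ennreal (w \<gamma>) * emeasure (G \<gamma>) (Out \<gamma>))"
      unfolding t2_def by (rule expected_scaled_mass[OF g Out[OF g]])
    also have "\<dots> \<le> ennreal (1 / c) * (ennreal (w \<gamma>) * ennreal \<rho>)"
      by (intro mult_left_mono Out_mass[OF g]) auto
    also have "\<dots> = ennreal (w \<gamma> * (\<rho> / c))"
      using c \<rho> w_nonneg[OF g] by (simp add: ennreal_mult[symmetric])
    finally show ?thesis .
  qed

  define K1 where "K1 = An + T * Pn / c"
  have K1: "0 \<le> K1" unfolding K1_def using c T An Pn by simp
  define K2 where "K2 = \<rho> / c"
  have K2: "0 \<le> K2" unfolding K2_def using c \<rho> by simp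
  define K3 where "K3 = \<tau> * (1 + \<kappa>0) ^ n"
  have K3: "0 \<le> K3" unfolding K3_def using \<tau> \<kappa>0 by simp
  have cards: "(\<Sum>\<gamma>\<in>\<Gamma>. real (card (Z' \<gamma>))) \<le> Nc"
  proof -
    have "(\<Sum>\<gamma>\<in>\<Gamma>. real (card (Z' \<gamma>))) \<le> (\<Sum>\<gamma>\<in>\<Gamma>. real (card (Z \<gamma>)))"
      using Z by (intro sum_mono of_nat_mono card_mono) (auto simp: Z'_def)
    also have "\<dots> = real (card (Sigma \<Gamma> Z))" using fin Z by (subst card_SigmaI) auto
    finally show ?thesis using Ncells by linarith
  qed
  have "(\<integral>\<^sup>+D. post_prob A D \<partial>sample) \<le> (\<integral>\<^sup>+D. t0 D + (\<Sum>\<gamma>\<in>\<Gamma>. (\<Sum>z\<in>Z' \<gamma>. t1 \<gamma> z D) + t2 \<gamma> D) \<partial>sample)"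
    by (rule nn_integral_mono) (rule pointwise)
  also have "\<dots> = (\<integral>\<^sup>+D. t0 D \<partial>sample) + (\<Sum>\<gamma>\<in>\<Gamma>. (\<Sum>z\<in>Z' \<gamma>. \<integral>\<^sup>+D. t1 \<gamma> z D \<partial>sample) + (\<integral>\<^sup>+D. t2 \<gamma> D \<partial>sample))"
  proof -
    have m1: "(\<lambda>D. \<Sum>z\<in>Z' \<gamma>. t1 \<gamma> z D) \<in> borel_measurable sample" if "\<gamma> \<in> \<Gamma>" for \<gamma>
      by (rule borel_measurable_sum) (rule t1_meas[OF that])
    have m2: "(\<lambda>D. (\<Sum>z\<in>Z' \<gamma>. t1 \<gamma> z D) + t2 \<gamma> D) \<in> borel_measurable sample" if "\<gamma> \<in> \<Gamma>" for \<gamma>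
      using m1[OF that] t2_meas[OF that] by measurable
    have m3: "(\<lambda>D. \<Sum>\<gamma>\<in>\<Gamma>. (\<Sum>z\<in>Z' \<gamma>. t1 \<gamma> z D) + t2 \<gamma> D) \<in> borel_measurable sample"
      by (rule borel_measurable_sum) (rule m2)
    have "(\<integral>\<^sup>+D. (\<Sum>\<gamma>\<in>\<Gamma>. (\<Sum>z\<in>Z' \<gamma>. t1 \<gamma> z D) + t2 \<gamma> D) \<partial>sample)
      = (\<Sum>\<gamma>\<in>\<Gamma>. \<integral>\<^sup>+D. (\<Sum>z\<in>Z' \<gamma>. t1 \<gamma> z D) + t2 \<gamma> D \<partial>sample)"
      by (rule nn_integral_sum) (rule m2)
    also have "\<dots> = (\<Sum>\<gamma>\<in>\<Gamma>. (\<Sum>z\<in>Z' \<gamma>. \<integral>\<^sup>+D. t1 \<gamma> z D \<partial>sample) + (\<integral>\<^sup>+D. t2 \<gamma> D \<partial>sample))"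
    proof (rule sum.cong[OF refl])
      fix \<gamma> assume g: "\<gamma> \<in> \<Gamma>"
      show "(\<integral>\<^sup>+D. (\<Sum>z\<in>Z' \<gamma>. t1 \<gamma> z D) + t2 \<gamma> D \<partial>sample) = (\<Sum>z\<in>Z' \<gamma>. \<integral>\<^sup>+D. t1 \<gamma> z D \<partial>sample) + (\<integral>\<^sup>+D. t2 \<gamma> D \<partial>sample)"
        unfolding nn_integral_add[OF m1[OF g] t2_meas[OF g]]
        by (rule arg_cong2[where f="(+)", OF nn_integral_sum refl]) (rule t1_meas[OF g])
    qed
    finally show ?thesis unfolding nn_integral_add[OF t0_meas m3] by (simp only:)
  qed
  also have "\<dots> \<le> ennreal K3 + (\<Sum>\<gamma>\<in>\<Gamma>. (\<Sum>z\<in>Z' \<gamma>. ennreal K1) + ennreal (w \<gamma> * K2))"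
    unfolding K1_def K2_def K3_def by (intro add_mono e0 sum_mono e1 e2)
  also have "\<dots> = ennreal K3 + (\<Sum>\<gamma>\<in>\<Gamma>. ennreal (real (card (Z' \<gamma>)) * K1 + w \<gamma> * K2))"
    using K1 K2 w_nonneg by (intro arg_cong2[where f="(+)"] sum.cong refl)
      (simp add: ennreal_mult ennreal_of_nat_eq_real_of_nat)
  also have "\<dots> = ennreal (K3 + (\<Sum>\<gamma>\<in>\<Gamma>. real (card (Z' \<gamma>)) * K1 + w \<gamma> * K2))"
  proof -
    have nn: "0 \<le> real (card (Z' \<gamma>)) * K1 + w \<gamma> * K2" if "\<gamma> \<in> \<Gamma>" for \<gamma>
      using K1 K2 w_nonneg[OF that] by simp
    show ?thesis using nn K3 by (subst sum_ennreal) (simp_all add: sum_nonneg ennreal_plus[symmetric] del: ennreal_plus)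
  qed
  also have "(\<Sum>\<gamma>\<in>\<Gamma>. real (card (Z' \<gamma>)) * K1 + w \<gamma> * K2) = (\<Sum>\<gamma>\<in>\<Gamma>. real (card (Z' \<gamma>))) * K1 + (\<Sum>\<gamma>\<in>\<Gamma>. w \<gamma>) * K2"
    by (simp only: sum.distrib sum_distrib_right)
  also have "ennreal (K3 + \<dots>) \<le> ennreal (K3 + (Nc * K1 + 1 * K2))"
    by (intro ennreal_leI add_left_mono add_mono mult_right_mono cards w1 K1 K2)
  finally show ?thesis unfolding K1_def An_def Pn_def K2_def K3_def c_def by (simp only: add.assoc mult_1)
qed

end

section \<open>Regression with random covariates\<close>

text \<open>Random covariates with values in \<open>[-1, 1]\<close>. The joint density of an observation with respect to
  \<open>\<nu> \<Otimes>\<^sub>M resp_measure M\<close> is the conditional density of the response.\<close>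

locale design =
  fixes M :: regression and \<nu> :: "(nat \<Rightarrow> real) measure" and K :: nat
  assumes adm: "admissible M"
    and \<nu>_sets: "sets \<nu> = sets (PiM {1..K} (\<lambda>_. borel))"
    and \<nu>_prob: "prob_space \<nu>"
    and \<nu>_bound: "AE x in \<nu>. \<forall>j\<in>{1..K}. \<bar>x j\<bar> \<le> 1"
begin

definition base :: "((nat \<Rightarrow> real) \<times> real) measure" where "base = \<nu> \<Otimes>\<^sub>M resp_measure M"
definition joint_density :: "nat set \<Rightarrow> (nat \<Rightarrow> real) \<Rightarrow> (nat \<Rightarrow> real) \<times> real \<Rightarrow> real" where
  "joint_density \<gamma> \<beta> z = fitted_density M \<gamma> \<beta> (snd z) (fst z)"
definition linear_predictor :: "nat set \<Rightarrow> (nat \<Rightarrow> real) \<Rightarrow> (nat \<Rightarrow> real) \<Rightarrow> real" where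
  "linear_predictor \<gamma> \<beta> x = (\<Sum>j\<in>\<gamma>. x j * \<beta> j)"

lemma joint_density_eq: "joint_density \<gamma> \<beta> z = resp_density M (snd z) (linear_predictor \<gamma> \<beta> (fst z))"
  by (simp add: joint_density_def fitted_density_def linear_predictor_def)

lemma sigma_finite_base: "sigma_finite_measure base"
proof -
  interpret \<nu>: prob_space \<nu> by (rule \<nu>_prob)
  interpret R: sigma_finite_measure "resp_measure M" by (rule sigma_finite_resp)
  interpret pair_sigma_finite \<nu> "resp_measure M" ..
  show ?thesis unfolding base_def by (rule sigma_finite_measure_axioms)
qed

lemma coordinate_meas:
  assumes "j \<in> {1..K}" shows "(\<lambda>x. x j) \<in> borel_measurable \<nu>"
  using measurable_component_singleton[OF assms, of "\<lambda>_. borel :: real measure"]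
  by (simp add: measurable_cong_sets[OF \<nu>_sets refl])

lemma linear_predictor_meas:
  assumes "\<gamma> \<subseteq> {1..K}" shows "linear_predictor \<gamma> \<beta> \<in> borel_measurable \<nu>"
  unfolding linear_predictor_def[abs_def] using coordinate_meas assms by (intro borel_measurable_sum borel_measurable_times) auto

lemma coefficient_meas:
  assumes "sets H = sets (PiM \<gamma> (\<lambda>_. lborel :: real measure))" "j \<in> \<gamma>"
  shows "(\<lambda>\<beta>. \<beta> j) \<in> borel_measurable H"
  using measurable_component_singleton[OF assms(2), of "\<lambda>_. lborel :: real measure"]
  by (simp add: measurable_cong_sets[OF assms(1) refl])

lemma linear_predictor_joint_meas:
  assumes "sets H = sets (PiM \<gamma> (\<lambda>_. lborel :: real measure))" "\<gamma> \<subseteq> {1..K}"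
  shows "(\<lambda>x. linear_predictor \<gamma> (fst x) (snd x)) \<in> borel_measurable (H \<Otimes>\<^sub>M \<nu>)"
  unfolding linear_predictor_def
proof (intro borel_measurable_sum borel_measurable_times)
  fix j assume j: "j \<in> \<gamma>"
  have "j \<in> {1..K}" using j assms(2) by blast
  from measurable_compose[OF measurable_snd coordinate_meas[OF this]]
  show "(\<lambda>x. snd x j) \<in> borel_measurable (H \<Otimes>\<^sub>M \<nu>)" .
  from measurable_compose[OF measurable_fst coefficient_meas[OF assms(1) j]]
  show "(\<lambda>x. fst x j) \<in> borel_measurable (H \<Otimes>\<^sub>M \<nu>)" .
qed

lemma joint_density_meas:
  assumes "sets H = sets (PiM \<gamma> (\<lambda>_. lborel :: real measure))" "\<gamma> \<subseteq> {1..K}"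
  shows "(\<lambda>(\<beta>, z). joint_density \<gamma> \<beta> z) \<in> borel_measurable (H \<Otimes>\<^sub>M base)"
  unfolding joint_density_eq split_beta' base_def
proof (rule measurable_resp_density)
  show "(\<lambda>x. snd (snd x)) \<in> H \<Otimes>\<^sub>M (\<nu> \<Otimes>\<^sub>M resp_measure M) \<rightarrow>\<^sub>M resp_measure M" by measurable
  have "(\<lambda>x. (fst x, fst (snd x))) \<in> H \<Otimes>\<^sub>M (\<nu> \<Otimes>\<^sub>M resp_measure M) \<rightarrow>\<^sub>M H \<Otimes>\<^sub>M \<nu>" by measurable
  from measurable_compose[OF this linear_predictor_joint_meas[OF assms]]
  show "(\<lambda>x. linear_predictor \<gamma> (fst x) (fst (snd x))) \<in> borel_measurable (H \<Otimes>\<^sub>M (\<nu> \<Otimes>\<^sub>M resp_measure M))" by simp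
qed

lemma joint_density_section_meas:
  assumes "\<gamma> \<subseteq> {1..K}" shows "joint_density \<gamma> \<beta> \<in> borel_measurable base"
  unfolding joint_density_eq[abs_def] base_def
  by (rule measurable_resp_density) (auto intro: measurable_compose[OF measurable_fst linear_predictor_meas[OF assms]])

lemma joint_density_pos: "0 < joint_density \<gamma> \<beta> z"
  unfolding joint_density_eq by (rule resp_density_pos[OF adm])

lemma nn_integral_base:
  assumes "f \<in> borel_measurable base"
  shows "(\<integral>\<^sup>+z. f z \<partial>base) = (\<integral>\<^sup>+x. (\<integral>\<^sup>+y. f (x, y) \<partial>resp_measure M) \<partial>\<nu>)"
proof -
  interpret R: sigma_finite_measure "resp_measure M" by (rule sigma_finite_resp)
  show ?thesis using R.nn_integral_fst[of f \<nu>] assms unfolding base_def by simp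
qed

lemma joint_density_one:
  assumes "\<gamma> \<subseteq> {1..K}" shows "(\<integral>\<^sup>+z. ennreal (joint_density \<gamma> \<beta> z) \<partial>base) = 1"
proof -
  interpret \<nu>: prob_space \<nu> by (rule \<nu>_prob)
  note [measurable] = joint_density_section_meas[OF assms]
  have "(\<integral>\<^sup>+z. ennreal (joint_density \<gamma> \<beta> z) \<partial>base) = (\<integral>\<^sup>+x. (\<integral>\<^sup>+y. ennreal (joint_density \<gamma> \<beta> (x, y)) \<partial>resp_measure M) \<partial>\<nu>)"
    by (rule nn_integral_base) measurable
  also have "\<dots> = 1" by (simp add: joint_density_eq nn_integral_resp_density[OF adm] \<nu>.emeasure_space_1)
  finally show ?thesis .
qed

text \<open>The bound for the response density holds for almost every value of the covariates and is
  averaged over their law.\<close>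

lemma joint_density_chi:
  assumes sub: "\<gamma> \<subseteq> {1..K}" "\<gamma>' \<subseteq> {1..K}" and chi: "log_lipschitz_chi A M" and H: "0 \<le> H" and D: "D \<le> exp (- A * (1 + H))"
    and close: "\<And>x. (\<forall>j\<in>{1..K}. \<bar>x j\<bar> \<le> 1) \<Longrightarrow> \<bar>linear_predictor \<gamma> \<beta> x\<bar> \<le> H \<and> \<bar>linear_predictor \<gamma>' \<beta>' x\<bar> \<le> H \<and> \<bar>linear_predictor \<gamma> \<beta> x - linear_predictor \<gamma>' \<beta>' x\<bar> \<le> D"
  shows "(\<integral>\<^sup>+z. ennreal ((joint_density \<gamma> \<beta> z)\<^sup>2 / joint_density \<gamma>' \<beta>' z) \<partial>base) \<le> ennreal (1 + exp (A * (1 + H)) * D)"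
proof -
  interpret \<nu>: prob_space \<nu> by (rule \<nu>_prob)
  note [measurable] = joint_density_section_meas[OF sub(1)] joint_density_section_meas[OF sub(2)]
  have "(\<integral>\<^sup>+z. ennreal ((joint_density \<gamma> \<beta> z)\<^sup>2 / joint_density \<gamma>' \<beta>' z) \<partial>base)
     = (\<integral>\<^sup>+x. (\<integral>\<^sup>+y. ennreal ((joint_density \<gamma> \<beta> (x, y))\<^sup>2 / joint_density \<gamma>' \<beta>' (x, y)) \<partial>resp_measure M) \<partial>\<nu>)"
    by (rule nn_integral_base) measurable
  also have "\<dots> \<le> (\<integral>\<^sup>+x. ennreal (1 + exp (A * (1 + H)) * D) \<partial>\<nu>)"
  proof (rule nn_integral_mono_AE, rule AE_mp[OF \<nu>_bound], rule AE_I2, rule impI)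
    fix x assume "x \<in> space \<nu>" and x: "\<forall>j\<in>{1..K}. \<bar>x j\<bar> \<le> 1"
    note c = close[OF x]
    have "(\<integral>\<^sup>+y. ennreal ((joint_density \<gamma> \<beta> (x, y))\<^sup>2 / joint_density \<gamma>' \<beta>' (x, y)) \<partial>resp_measure M)
       \<le> ennreal (1 + exp (A * (1 + H)) * \<bar>linear_predictor \<gamma> \<beta> x - linear_predictor \<gamma>' \<beta>' x\<bar>)"
      using chi H c D unfolding log_lipschitz_chi_def joint_density_eq by auto
    also have "\<dots> \<le> ennreal (1 + exp (A * (1 + H)) * D)"
      using c by (intro ennreal_leI add_left_mono mult_left_mono) auto
    finally show "(\<integral>\<^sup>+y. ennreal ((joint_density \<gamma> \<beta> (x, y))\<^sup>2 / joint_density \<gamma>' \<beta>' (x, y)) \<partial>resp_measure M) \<le> ennreal (1 + exp (A * (1 + H)) * D)" .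
  qed
  also have "\<dots> = ennreal (1 + exp (A * (1 + H)) * D)" by (simp add: \<nu>.emeasure_space_1 del: ennreal_plus)
  finally show ?thesis .
qed

text \<open>By expansion of the square, \<open>d\<^sup>2 = 2 - 2 \<rho>\<close> for the Hellinger affinity \<open>\<rho>\<close>. As \<open>d\<close> is defined by Bochner
  integrals, the expansion needs the integrability of the three terms.\<close>

lemma affinity_of_hellinger:
  assumes sub: "\<gamma> \<subseteq> {1..K}" "\<gamma>' \<subseteq> {1..K}" and e: "0 \<le> e" "e < hellinger M \<nu> (fitted_density M \<gamma> \<beta>) (fitted_density M \<gamma>' \<beta>')"
  shows "(\<integral>\<^sup>+z. ennreal (sqrt (joint_density \<gamma> \<beta> z * joint_density \<gamma>' \<beta>' z)) \<partial>base) \<le> ennreal (1 - e\<^sup>2 / 2)"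
proof -
  interpret \<nu>: prob_space \<nu> by (rule \<nu>_prob)
  interpret R: sigma_finite_measure "resp_measure M" by (rule sigma_finite_resp)
  note pm = joint_density_section_meas[OF sub(1), of \<beta>] joint_density_section_meas[OF sub(2), of \<beta>']
  note [measurable] = pm
  define a where "a x = (\<integral>y. sqrt (joint_density \<gamma> \<beta> (x, y) * joint_density \<gamma>' \<beta>' (x, y)) \<partial>resp_measure M)" for x
  have sec: "(\<lambda>y. joint_density \<gamma> \<beta> (x, y)) \<in> borel_measurable (resp_measure M)" for \<gamma> \<beta> x
    unfolding joint_density_eq by (rule measurable_resp_density) auto
  have int1: "integrable (resp_measure M) (\<lambda>y. joint_density \<gamma> \<beta> (x, y))" "(\<integral>y. joint_density \<gamma> \<beta> (x, y) \<partial>resp_measure M) = 1" for \<gamma> \<beta> x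
  proof -
    have one: "(\<integral>\<^sup>+y. ennreal (joint_density \<gamma> \<beta> (x, y)) \<partial>resp_measure M) = ennreal 1"
      unfolding joint_density_eq by (simp add: nn_integral_resp_density[OF adm])
    show "integrable (resp_measure M) (\<lambda>y. joint_density \<gamma> \<beta> (x, y))"
      by (rule integrableI_nn_integral_finite[OF sec _ one]) (simp add: joint_density_pos less_imp_le)
    show "(\<integral>y. joint_density \<gamma> \<beta> (x, y) \<partial>resp_measure M) = 1"
      by (rule integral_eq_nn_integral[OF sec, THEN trans]) (auto simp: joint_density_pos less_imp_le one)
  qed
  have am_gm: "sqrt (p * q) \<le> p + q" if "0 < p" "0 < q" for p q :: real
  proof -
    have "sqrt (p * q) \<le> sqrt ((p + q)\<^sup>2)"
      using that by (intro real_sqrt_le_mono) (simp add: power2_eq_square algebra_simps add_nonneg_nonneg)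
    then show ?thesis using that by simp
  qed
  have int2: "integrable (resp_measure M) (\<lambda>y. sqrt (joint_density \<gamma> \<beta> (x, y) * joint_density \<gamma>' \<beta>' (x, y)))" for x
  proof (rule Bochner_Integration.integrable_bound)
    show "integrable (resp_measure M) (\<lambda>y. joint_density \<gamma> \<beta> (x, y) + joint_density \<gamma>' \<beta>' (x, y))"
      by (intro Bochner_Integration.integrable_add int1)
    show "(\<lambda>y. sqrt (joint_density \<gamma> \<beta> (x, y) * joint_density \<gamma>' \<beta>' (x, y))) \<in> borel_measurable (resp_measure M)"
      using sec by measurable
    show "AE y in resp_measure M. norm (sqrt (joint_density \<gamma> \<beta> (x, y) * joint_density \<gamma>' \<beta>' (x, y))) \<le> norm (joint_density \<gamma> \<beta> (x, y) + joint_density \<gamma>' \<beta>' (x, y))"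
      using am_gm joint_density_pos by (intro AE_I2) (simp add: less_imp_le add_pos_pos)
  qed
  have inner: "(\<integral>y. \<bar>sqrt (fitted_density M \<gamma> \<beta> y x) - sqrt (fitted_density M \<gamma>' \<beta>' y x)\<bar>\<^sup>2 \<partial>resp_measure M) = 2 - 2 * a x" for x
  proof -
    have "\<bar>sqrt (fitted_density M \<gamma> \<beta> y x) - sqrt (fitted_density M \<gamma>' \<beta>' y x)\<bar>\<^sup>2
        = joint_density \<gamma> \<beta> (x, y) + joint_density \<gamma>' \<beta>' (x, y) - 2 * sqrt (joint_density \<gamma> \<beta> (x, y) * joint_density \<gamma>' \<beta>' (x, y))" for y
      using joint_density_pos[of \<gamma> \<beta> "(x, y)"] joint_density_pos[of \<gamma>' \<beta>' "(x, y)"]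
      by (simp add: joint_density_def power2_diff real_sqrt_mult)
    then show ?thesis unfolding a_def
      using int1[of \<gamma> \<beta> x] int1[of \<gamma>' \<beta>' x] int2[of x] by simp
  qed
  have a0: "0 \<le> a x" for x unfolding a_def by (intro integral_nonneg_AE AE_I2) (simp add: joint_density_pos less_imp_le)
  have a1: "a x \<le> 1" for x
  proof -
    have "0 \<le> (\<integral>y. \<bar>sqrt (fitted_density M \<gamma> \<beta> y x) - sqrt (fitted_density M \<gamma>' \<beta>' y x)\<bar>\<^sup>2 \<partial>resp_measure M)"
      by (intro integral_nonneg_AE AE_I2) simp
    then show ?thesis unfolding inner by simp
  qed
  have am: "a \<in> borel_measurable \<nu>"
  proof -
    have "(\<lambda>z. sqrt (joint_density \<gamma> \<beta> z * joint_density \<gamma>' \<beta>' z)) \<in> borel_measurable base" using pm by measurable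
    then have "(\<lambda>(x, y). sqrt (joint_density \<gamma> \<beta> (x, y) * joint_density \<gamma>' \<beta>' (x, y))) \<in> borel_measurable (\<nu> \<Otimes>\<^sub>M resp_measure M)"
      unfolding base_def by (simp add: split_beta')
    from R.borel_measurable_lebesgue_integral[OF this] show ?thesis unfolding a_def[abs_def] .
  qed
  have ai: "integrable \<nu> a"
    by (rule \<nu>.integrable_const_bound[of _ 1]) (use a0 a1 am in auto)
  have "hellinger M \<nu> (fitted_density M \<gamma> \<beta>) (fitted_density M \<gamma>' \<beta>') = sqrt (2 - 2 * (\<integral>x. a x \<partial>\<nu>))"
    unfolding hellinger_def inner using ai by (simp add: \<nu>.prob_space)
  then have "e < sqrt (2 - 2 * (\<integral>x. a x \<partial>\<nu>))" using e by simp
  then have "e\<^sup>2 < 2 - 2 * (\<integral>x. a x \<partial>\<nu>)" using e(1)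
    by (metis real_less_rsqrt real_sqrt_less_iff real_sqrt_abs abs_of_nonneg)
  then have ia: "(\<integral>x. a x \<partial>\<nu>) \<le> 1 - e\<^sup>2 / 2" by simp
  have "(\<integral>\<^sup>+z. ennreal (sqrt (joint_density \<gamma> \<beta> z * joint_density \<gamma>' \<beta>' z)) \<partial>base)
     = (\<integral>\<^sup>+x. (\<integral>\<^sup>+y. ennreal (sqrt (joint_density \<gamma> \<beta> (x, y) * joint_density \<gamma>' \<beta>' (x, y))) \<partial>resp_measure M) \<partial>\<nu>)"
    by (rule nn_integral_base) measurable
  also have "\<dots> = (\<integral>\<^sup>+x. ennreal (a x) \<partial>\<nu>)"
    unfolding a_def by (intro nn_integral_cong nn_integral_eq_integral int2 AE_I2) (simp add: joint_density_pos less_imp_le)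
  also have "\<dots> = ennreal (\<integral>x. a x \<partial>\<nu>)" by (intro nn_integral_eq_integral ai AE_I2 a0)
  also have "\<dots> \<le> ennreal (1 - e\<^sup>2 / 2)" by (rule ennreal_leI[OF ia])
  finally show ?thesis .
qed

lemma hellinger_meas:
  assumes H: "sets H = sets (PiM \<gamma> (\<lambda>_. lborel :: real measure))" "\<gamma> \<subseteq> {1..K}" and sub: "\<gamma>' \<subseteq> {1..K}"
  shows "(\<lambda>\<beta>. hellinger M \<nu> (fitted_density M \<gamma> \<beta>) (fitted_density M \<gamma>' \<beta>')) \<in> borel_measurable H"
proof -
  interpret \<nu>: prob_space \<nu> by (rule \<nu>_prob)
  interpret R: sigma_finite_measure "resp_measure M" by (rule sigma_finite_resp)
  have 1: "(\<lambda>w. fitted_density M \<gamma> (fst (fst w)) (snd w) (snd (fst w))) \<in> borel_measurable ((H \<Otimes>\<^sub>M \<nu>) \<Otimes>\<^sub>M resp_measure M)"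
  proof -
    have "(\<lambda>w. (fst (fst w), (snd (fst w), snd w))) \<in> (H \<Otimes>\<^sub>M \<nu>) \<Otimes>\<^sub>M resp_measure M \<rightarrow>\<^sub>M H \<Otimes>\<^sub>M base"
      unfolding base_def by measurable
    from measurable_compose[OF this joint_density_meas[OF H]] show ?thesis by (simp add: joint_density_def)
  qed
  have 2: "(\<lambda>w. fitted_density M \<gamma>' \<beta>' (snd w) (snd (fst w))) \<in> borel_measurable ((H \<Otimes>\<^sub>M \<nu>) \<Otimes>\<^sub>M resp_measure M)"
  proof -
    have "(\<lambda>w. (snd (fst w), snd w)) \<in> (H \<Otimes>\<^sub>M \<nu>) \<Otimes>\<^sub>M resp_measure M \<rightarrow>\<^sub>M base"
      unfolding base_def by measurable
    from measurable_compose[OF this joint_density_section_meas[OF sub, of \<beta>']] show ?thesis by (simp add: joint_density_def)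
  qed
  have 3: "(\<lambda>(v, y). \<bar>sqrt (fitted_density M \<gamma> (fst v) y (snd v)) - sqrt (fitted_density M \<gamma>' \<beta>' y (snd v))\<bar>\<^sup>2) \<in> borel_measurable ((H \<Otimes>\<^sub>M \<nu>) \<Otimes>\<^sub>M resp_measure M)"
    using 1 2 unfolding split_beta' by measurable
  have 4: "(\<lambda>(\<beta>, x). \<integral>y. \<bar>sqrt (fitted_density M \<gamma> \<beta> y x) - sqrt (fitted_density M \<gamma>' \<beta>' y x)\<bar>\<^sup>2 \<partial>resp_measure M) \<in> borel_measurable (H \<Otimes>\<^sub>M \<nu>)"
    using R.borel_measurable_lebesgue_integral[OF 3] by (simp add: split_beta')
  show ?thesis unfolding hellinger_def
    using \<nu>.borel_measurable_lebesgue_integral[OF 4] by measurable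
qed

end

section \<open>The variable selection prior and its posterior\<close>

lemma sum_model_weights_one:
  assumes "finite A"
  shows "(\<Sum>\<gamma>\<in>Pow A. \<Prod>j\<in>A. if j \<in> \<gamma> then (p::real) else 1 - p) = 1"
proof -
  have "(\<Prod>j\<in>A. if j \<in> \<gamma> then p else 1 - p) = (\<Prod>j\<in>\<gamma>. p) * (\<Prod>j\<in>A - \<gamma>. 1 - p)"
    if "\<gamma> \<in> Pow A" for \<gamma>
  proof -
    have "A \<inter> \<gamma> = \<gamma>" "A \<inter> - \<gamma> = A - \<gamma>" using that by auto
    then show ?thesis using prod.If_cases[OF assms, of "\<lambda>j. j \<in> \<gamma>" "\<lambda>_. p" "\<lambda>_. 1 - p"] by simp
  qed
  then have "(\<Sum>\<gamma>\<in>Pow A. \<Prod>j\<in>A. if j \<in> \<gamma> then p else 1 - p) = (\<Prod>j\<in>A. p + (1 - p))"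
    unfolding prod_add[OF assms] by (rule sum.cong[OF refl])
  then show ?thesis by simp
qed

lemma model_weight_nonneg: "r \<le> K \<Longrightarrow> 0 \<le> model_weight K r rbar \<gamma>"
  unfolding model_weight_def by (cases "K = 0") (auto intro!: mult_nonneg_nonneg prod_nonneg simp: divide_le_eq)

text \<open>Truncation to models of size at most \<open>rbar\<close> keeps the normalising constant at most 1, so it can
  only raise the prior probabilities of the models that remain.\<close>

lemma model_weight_le_one_sum:
  assumes "r \<le> K" shows "(\<Sum>\<gamma>\<in>Pow {1..K}. model_weight K r rbar \<gamma>) \<le> 1"
proof -
  have "(\<Sum>\<gamma>\<in>Pow {1..K}. model_weight K r rbar \<gamma>)
      \<le> (\<Sum>\<gamma>\<in>Pow {1..K}. \<Prod>j\<in>{1..K}. if j \<in> \<gamma> then real r / real K else 1 - real r / real K)"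
    unfolding model_weight_def using assms
    by (intro sum_mono mult_left_le prod_nonneg) (cases "K = 0", auto simp: divide_le_eq)
  also have "\<dots> = 1" by (rule sum_model_weights_one) simp
  finally show ?thesis .
qed

text \<open>The included coordinates contribute \<open>(r / K) ^ r \<ge> exp (- r ln K)\<close>, and the excluded ones
  \<open>(1 - r / K) ^ (K - r) \<ge> exp (- r)\<close>, since \<open>1 / (1 - r / K) = 1 + r / (K - r)\<close>.\<close>

lemma model_weight_lower:
  assumes r: "1 \<le> r" "r < K" "r \<le> rbar" and g: "\<gamma> \<subseteq> {1..K}" "card \<gamma> = r"
  shows "exp (- real r * ln (real K) - real r) \<le> model_weight K r rbar \<gamma>"
proof -
  define l where "l = real r / real K"
  have K: "0 < real K" using r by simp
  have l1: "0 < 1 - l" unfolding l_def using r by simp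
  have "(\<Prod>j\<in>{1..K}. if j \<in> \<gamma> then l else 1 - l) = (\<Prod>j\<in>\<gamma>. l) * (\<Prod>j\<in>{1..K} - \<gamma>. 1 - l)"
  proof -
    have "{1..K} \<inter> \<gamma> = \<gamma>" "{1..K} \<inter> - \<gamma> = {1..K} - \<gamma>" using g by auto
    then show ?thesis using prod.If_cases[of "{1..K}" "\<lambda>j. j \<in> \<gamma>" "\<lambda>_. l" "\<lambda>_. 1 - l"] by simp
  qed
  also have "\<dots> = l ^ r * (1 - l) ^ (K - r)"
    using g finite_subset[OF g(1)] by (simp add: card_Diff_subset)
  finally have w: "model_weight K r rbar \<gamma> = l ^ r * (1 - l) ^ (K - r)"
    using r g unfolding model_weight_def l_def[symmetric] by simp
  have "exp (- real r * ln (real K)) = (1 / real K) ^ r"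
  proof -
    have "exp (- real r * ln (real K)) = exp (real r * - ln (real K))" by simp
    also have "\<dots> = exp (- ln (real K)) ^ r" by (rule exp_of_nat_mult)
    also have "exp (- ln (real K)) = 1 / real K" using K by (simp add: exp_minus divide_inverse)
    finally show ?thesis .
  qed
  also have "\<dots> \<le> l ^ r" unfolding l_def using r by (intro power_mono divide_right_mono) auto
  finally have 1: "exp (- real r * ln (real K)) \<le> l ^ r" .
  define q where "q = real r / (real K - real r)"
  have q: "1 - l = 1 / (1 + q)" unfolding q_def l_def using r by (simp add: field_simps)
  have q0: "0 < q" unfolding q_def using r by simp
  have "exp (- q) \<le> 1 - l"
  proof -
    have "1 + q \<le> exp q" by (rule exp_ge_add_one_self)
    then have "1 / exp q \<le> 1 / (1 + q)" using q0 by (intro divide_left_mono) auto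
    then show ?thesis unfolding q by (simp add: exp_minus divide_inverse)
  qed
  then have "exp (- q) ^ (K - r) \<le> (1 - l) ^ (K - r)" by (intro power_mono) auto
  moreover have "exp (- q) ^ (K - r) = exp (- real r)"
  proof -
    have "exp (- q) ^ (K - r) = exp (real (K - r) * (- q))" by (rule exp_of_nat_mult[symmetric])
    also have "real (K - r) * (- q) = - real r" unfolding q_def using r by (simp add: of_nat_diff)
    finally show ?thesis .
  qed
  ultimately have 2: "exp (- real r) \<le> (1 - l) ^ (K - r)" by simp
  have "exp (- real r * ln (real K) - real r) = exp (- real r * ln (real K)) * exp (- real r)"
    by (simp flip: exp_add)
  also have "\<dots> \<le> l ^ r * (1 - l) ^ (K - r)" using 1 2 l1 by (intro mult_mono) (auto simp: l_def)
  finally show ?thesis unfolding w .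
qed

lemma model_prior_facts:
  assumes r: "1 \<le> r" "r < K" "r \<le> rbar"
  shows "0 \<le> model_prior K r rbar \<gamma>"
    and "(\<Sum>\<gamma>\<in>{\<gamma>. \<gamma> \<subseteq> {1..K} \<and> card \<gamma> \<le> rbar}. model_prior K r rbar \<gamma>) \<le> 1"
    and "\<gamma> \<subseteq> {1..K} \<Longrightarrow> card \<gamma> = r \<Longrightarrow> exp (- real r * ln (real K) - real r) \<le> model_prior K r rbar \<gamma>"
    and "rbar < card \<gamma> \<Longrightarrow> model_prior K r rbar \<gamma> = 0"
proof -
  define Z where "Z = (\<Sum>\<gamma>'\<in>Pow {1..K}. model_weight K r rbar \<gamma>')"
  note nn = model_weight_nonneg[of r K rbar]
  have Z1: "Z \<le> 1" unfolding Z_def using r by (intro model_weight_le_one_sum) simp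
  have le_Z: "model_weight K r rbar \<gamma> \<le> Z" if "\<gamma> \<subseteq> {1..K}" for \<gamma>
    unfolding Z_def using that r nn by (intro member_le_sum) auto
  have Z0: "0 < Z"
  proof -
    have "0 < exp (- real r * ln (real K) - real r)" by simp
    also have "\<dots> \<le> model_weight K r rbar {1..r}" using r by (intro model_weight_lower) auto
    also have "\<dots> \<le> Z" using r by (intro le_Z) auto
    finally show ?thesis .
  qed
  have prior: "model_prior K r rbar \<gamma> = model_weight K r rbar \<gamma> / Z" for \<gamma>
    unfolding model_prior_def Z_def ..
  show "0 \<le> model_prior K r rbar \<gamma>" unfolding prior using nn r Z0 by simp
  have "(\<Sum>\<gamma>\<in>{\<gamma>. \<gamma> \<subseteq> {1..K} \<and> card \<gamma> \<le> rbar}. model_weight K r rbar \<gamma>) \<le> Z"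
    unfolding Z_def using nn r by (intro sum_mono2) auto
  then show "(\<Sum>\<gamma>\<in>{\<gamma>. \<gamma> \<subseteq> {1..K} \<and> card \<gamma> \<le> rbar}. model_prior K r rbar \<gamma>) \<le> 1"
    unfolding prior sum_divide_distrib[symmetric] using Z0 by simp
  show "exp (- real r * ln (real K) - real r) \<le> model_prior K r rbar \<gamma>" if "\<gamma> \<subseteq> {1..K}" "card \<gamma> = r"
  proof -
    have w: "exp (- real r * ln (real K) - real r) \<le> model_weight K r rbar \<gamma>"
      using r that by (intro model_weight_lower) auto
    also have "\<dots> \<le> model_weight K r rbar \<gamma> / Z"
      using Z0 Z1 nn[of \<gamma>] r by (simp add: le_divide_eq mult_left_le)
    finally show ?thesis unfolding prior .
  qed
  show "rbar < card \<gamma> \<Longrightarrow> model_prior K r rbar \<gamma> = 0" unfolding prior model_weight_def by simp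
qed

text \<open>A set of at most \<open>R\<close> elements of \<open>{1..K}\<close> is the range of a list of length \<open>R\<close> over \<open>{0..K}\<close>,
  padded by zeros.\<close>

lemma card_small_subsets:
  "card {\<gamma>. \<gamma> \<subseteq> {1..K} \<and> card \<gamma> \<le> R} \<le> (K + 1) ^ R"
proof -
  define L where "L = {xs. set xs \<subseteq> {0..K} \<and> length xs = R}"
  have finL: "finite L" unfolding L_def by (rule finite_lists_length_eq) simp
  have "{\<gamma>. \<gamma> \<subseteq> {1..K} \<and> card \<gamma> \<le> R} \<subseteq> (\<lambda>xs. set xs - {0}) ` L"
  proof
    fix \<gamma> assume "\<gamma> \<in> {\<gamma>. \<gamma> \<subseteq> {1..K} \<and> card \<gamma> \<le> R}"
    then have g: "\<gamma> \<subseteq> {1..K}" "card \<gamma> \<le> R" by auto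
    have fin: "finite \<gamma>" using finite_subset[OF g(1)] by simp
    define xs where "xs = sorted_list_of_set \<gamma> @ replicate (R - card \<gamma>) 0"
    have "length xs = R" unfolding xs_def using g(2) by simp
    moreover have "set xs \<subseteq> {0..K}" unfolding xs_def using g(1) fin by auto
    moreover have "set xs - {0} = \<gamma>" unfolding xs_def using g(1) fin by auto
    ultimately show "\<gamma> \<in> (\<lambda>xs. set xs - {0}) ` L" unfolding L_def by blast
  qed
  from card_mono[OF finite_imageI[OF finL] this] have "card {\<gamma>. \<gamma> \<subseteq> {1..K} \<and> card \<gamma> \<le> R} \<le> card L"
    using card_image_le[OF finL, of "\<lambda>xs. set xs - {0}"] by linarith
  also have "card L = (K + 1) ^ R" unfolding L_def by (subst card_lists_length_eq) auto
  finally show ?thesis .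
qed

text \<open>A common bound \<open>\<Lambda>\<close> for the spectra of \<open>V \<gamma>\<close> and its inverse is all that the estimates use about the
  covariance matrices.\<close>

locale selection = design M \<nu> K for M \<nu> K +
  fixes \<beta>s :: "nat \<Rightarrow> real" and V :: "nat set \<Rightarrow> real mat" and r rbar n :: nat and \<Lambda> :: real
  assumes sizes: "1 \<le> r" "r \<le> rbar" "rbar < K"
    and V: "\<And>\<gamma>. \<gamma> \<subseteq> {1..K} \<Longrightarrow> card \<gamma> \<le> rbar \<Longrightarrow> spectrum_within \<Lambda> \<gamma> (V \<gamma>)"
    and \<Lambda>: "1 \<le> \<Lambda>"
begin

definition models :: "nat set set" where "models = {\<gamma>. \<gamma> \<subseteq> {1..K} \<and> card \<gamma> \<le> rbar}"
definition coef :: "nat set \<Rightarrow> (nat \<Rightarrow> real) measure" where "coef \<gamma> = gaussian \<gamma> (V \<gamma>)"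

lemma modelsD: "\<gamma> \<in> models \<Longrightarrow> \<gamma> \<subseteq> {1..K}" "\<gamma> \<in> models \<Longrightarrow> card \<gamma> \<le> rbar" "\<gamma> \<in> models \<Longrightarrow> finite \<gamma>"
  unfolding models_def by (auto intro: finite_subset)

lemma sets_coef: "sets (coef \<gamma>) = sets (PiM \<gamma> (\<lambda>_. lborel))"
  unfolding coef_def gaussian_eq by simp

lemma coef_mass:
  assumes g: "\<gamma> \<in> models" and E: "E \<in> sets (coef \<gamma>)" and t: "\<And>\<beta>. \<beta> \<in> E \<Longrightarrow> t\<^sup>2 \<le> (\<Sum>j\<in>\<gamma>. (\<beta> j)\<^sup>2)"
  shows "emeasure (coef \<gamma>) E \<le> ennreal (exp (- t\<^sup>2 / (4 * \<Lambda>)) * (4 * \<Lambda>\<^sup>2 * real rbar) ^ rbar)"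
  unfolding coef_def
  by (rule gaussian_tail_mass[OF modelsD(3)[OF g] V[OF modelsD(1,2)[OF g]] \<Lambda> modelsD(2)[OF g]])
    (use sizes E t in \<open>auto simp: sets_coef\<close>)

lemma coef_total:
  assumes g: "\<gamma> \<in> models"
  shows "emeasure (coef \<gamma>) (space (coef \<gamma>)) \<le> ennreal ((4 * \<Lambda>\<^sup>2 * real rbar) ^ rbar)"
  using coef_mass[OF g sets.top, of 0] by (simp add: sum_nonneg)

lemma finite_coef: "\<gamma> \<in> models \<Longrightarrow> finite_measure (coef \<gamma>)"
  using coef_total[of \<gamma>] by (intro finite_measureI) (auto simp: top_unique)

sublocale bayes_model base "joint_density {1..K} \<beta>s" models coef joint_density "model_prior K r rbar" n
proof (rule bayes_model.intro)
  show "sigma_finite_measure base" by (rule sigma_finite_base)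
  show "finite models" unfolding models_def by (rule finite_subset[of _ "Pow {1..K}"]) auto
  show "finite_measure (coef \<gamma>)" if "\<gamma> \<in> models" for \<gamma> by (rule finite_coef[OF that])
  show "(\<lambda>(\<beta>, z). joint_density \<gamma> \<beta> z) \<in> borel_measurable (coef \<gamma> \<Otimes>\<^sub>M base)" if "\<gamma> \<in> models" for \<gamma>
    by (rule joint_density_meas[OF sets_coef modelsD(1)[OF that]])
  show "joint_density {1..K} \<beta>s \<in> borel_measurable base" by (rule joint_density_section_meas) simp
  show "(\<integral>\<^sup>+z. ennreal (joint_density {1..K} \<beta>s z) \<partial>base) = 1" by (rule joint_density_one) simp
  show "(\<integral>\<^sup>+z. ennreal (joint_density \<gamma> \<beta> z) \<partial>base) = 1" if "\<gamma> \<in> models" for \<gamma> \<beta>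
    by (rule joint_density_one[OF modelsD(1)[OF that]])
  show "0 \<le> model_prior K r rbar \<gamma>" for \<gamma> using sizes by (intro model_prior_facts) auto
qed (rule joint_density_pos)+

lemma data_law_eq: "data_law M \<nu> K \<beta>s n = sample"
proof -
  have "obs_law M \<nu> K \<beta>s = obs" unfolding obs_law_def obs_def unfolding base_def joint_density_def split_beta' ..
  then show ?thesis unfolding data_law_def sample_def by simp
qed

lemma obs_response:
  assumes "D \<in> space sample" "i \<in> {1..n}"
  shows "snd (D i) \<in> space (resp_measure M)"
  using space_sample[OF assms] unfolding base_def by (auto simp: space_pair_measure)

lemma likelihood_eq: "likelihood M n D \<gamma> \<beta> = (\<Prod>i\<in>{1..n}. joint_density \<gamma> \<beta> (D i))"
  unfolding likelihood_def joint_density_def ..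

lemma likelihood_lratio:
  "ennreal (likelihood M n D \<gamma> \<beta>) = ennreal (\<Prod>i\<in>{1..n}. joint_density {1..K} \<beta>s (D i)) * lratio \<gamma> \<beta> D"
proof -
  have "lratio \<gamma> \<beta> D = ennreal (\<Prod>i\<in>{1..n}. joint_density \<gamma> \<beta> (D i) / joint_density {1..K} \<beta>s (D i))"
    unfolding lratio_def by (intro prod_ennreal) (auto simp: joint_density_pos less_imp_le)
  moreover have "(\<Prod>i\<in>{1..n}. joint_density {1..K} \<beta>s (D i)) * (\<Prod>i\<in>{1..n}. joint_density \<gamma> \<beta> (D i) / joint_density {1..K} \<beta>s (D i)) = likelihood M n D \<gamma> \<beta>"
    unfolding prod.distrib[symmetric] likelihood_eq using joint_density_pos by (intro prod.cong) (auto simp: less_imp_neq[THEN not_sym])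
  ultimately show ?thesis
    by (simp only: ennreal_mult[symmetric] prod_nonneg joint_density_pos less_imp_le divide_nonneg_nonneg)
qed

lemma likelihood_integrable:
  assumes g: "\<gamma> \<in> models" and D: "D \<in> space sample" and E: "E \<in> sets (coef \<gamma>)"
  shows "integrable (coef \<gamma>) (\<lambda>\<beta>. indicator E \<beta> * likelihood M n D \<gamma> \<beta>)"
    and "ennreal (\<integral>\<beta>. indicator E \<beta> * likelihood M n D \<gamma> \<beta> \<partial>coef \<gamma>)
      = ennreal (\<Prod>i\<in>{1..n}. joint_density {1..K} \<beta>s (D i)) * mass \<gamma> E D"
proof -
  interpret finite_measure "coef \<gamma>" by (rule finite_coef[OF g])
  have "\<forall>i\<in>{1..n}. \<exists>c. \<forall>\<beta>. joint_density \<gamma> \<beta> (D i) \<le> c"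
    using resp_density_bounded[OF adm obs_response[OF D]] unfolding joint_density_eq by blast
  then obtain c where c: "\<And>i \<beta>. i \<in> {1..n} \<Longrightarrow> joint_density \<gamma> \<beta> (D i) \<le> c i" by metis
  have bound: "0 \<le> likelihood M n D \<gamma> \<beta>" "likelihood M n D \<gamma> \<beta> \<le> (\<Prod>i\<in>{1..n}. c i)" for \<beta>
    unfolding likelihood_eq using c by (auto intro!: prod_nonneg prod_mono less_imp_le[OF joint_density_pos])
  have m: "likelihood M n D \<gamma> \<in> borel_measurable (coef \<gamma>)"
    unfolding likelihood_eq[abs_def]
  proof (rule borel_measurable_prod)
    fix i assume "i \<in> {1..n}"
    from measurable_Pair1[OF p_meas[OF g] space_sample[OF D this]]
    show "(\<lambda>\<beta>. joint_density \<gamma> \<beta> (D i)) \<in> borel_measurable (coef \<gamma>)" by simp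
  qed
  show int: "integrable (coef \<gamma>) (\<lambda>\<beta>. indicator E \<beta> * likelihood M n D \<gamma> \<beta>)"
  proof (rule integrable_const_bound[of _ "\<Prod>i\<in>{1..n}. c i"])
    show "AE \<beta> in coef \<gamma>. norm (indicator E \<beta> * likelihood M n D \<gamma> \<beta>) \<le> (\<Prod>i\<in>{1..n}. c i)"
      using bound order_trans[OF bound] by (intro AE_I2) (auto simp: indicator_def)
    show "(\<lambda>\<beta>. indicator E \<beta> * likelihood M n D \<gamma> \<beta>) \<in> borel_measurable (coef \<gamma>)"
      using m E by measurable
  qed
  have lm: "(\<lambda>\<beta>. lratio \<gamma> \<beta> D) \<in> borel_measurable (coef \<gamma>)"
    using measurable_Pair2[OF lratio_meas[OF g] D] by simp
  have "ennreal (\<integral>\<beta>. indicator E \<beta> * likelihood M n D \<gamma> \<beta> \<partial>coef \<gamma>) = (\<integral>\<^sup>+\<beta>. ennreal (indicator E \<beta> * likelihood M n D \<gamma> \<beta>) \<partial>coef \<gamma>)"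
    using bound by (intro nn_integral_eq_integral[symmetric] int AE_I2) (auto simp: indicator_def)
  also have "\<dots> = (\<integral>\<^sup>+\<beta>. ennreal (\<Prod>i\<in>{1..n}. joint_density {1..K} \<beta>s (D i)) * (lratio \<gamma> \<beta> D * indicator E \<beta>) \<partial>coef \<gamma>)"
  proof (rule nn_integral_cong)
    fix \<beta>
    show "ennreal (indicator E \<beta> * likelihood M n D \<gamma> \<beta>) = ennreal (\<Prod>i\<in>{1..n}. joint_density {1..K} \<beta>s (D i)) * (lratio \<gamma> \<beta> D * indicator E \<beta>)"
      using likelihood_lratio[of D \<gamma> \<beta>] by (cases "\<beta> \<in> E") auto
  qed
  also have "\<dots> = ennreal (\<Prod>i\<in>{1..n}. joint_density {1..K} \<beta>s (D i)) * mass \<gamma> E D"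
    unfolding mass_def by (rule nn_integral_cmult) (use lm E in measurable)
  finally show "ennreal (\<integral>\<beta>. indicator E \<beta> * likelihood M n D \<gamma> \<beta> \<partial>coef \<gamma>)
      = ennreal (\<Prod>i\<in>{1..n}. joint_density {1..K} \<beta>s (D i)) * mass \<gamma> E D" .
qed

text \<open>A vanishing evidence would make the quotient in the posterior meaningless. Positivity of the likelihood
  on one set of positive prior mass excludes this.\<close>

lemma evidence_pos:
  assumes g: "\<gamma> \<in> models" and D: "D \<in> space sample" and w: "0 < model_prior K r rbar \<gamma>"
    and N: "N \<in> sets (coef \<gamma>)" "0 < measure (coef \<gamma>) N"
  shows "0 < evidence D"
proof -
  interpret finite_measure "coef \<gamma>" by (rule finite_coef[OF g])
  have lm: "(\<lambda>\<beta>. lratio \<gamma> \<beta> D) \<in> borel_measurable (coef \<gamma>)"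
    using measurable_Pair2[OF lratio_meas[OF g] D] by simp
  have lmN: "(\<lambda>\<beta>. lratio \<gamma> \<beta> D * indicator N \<beta>) \<in> borel_measurable (coef \<gamma>)"
    using lm N(1) by measurable
  have "mass \<gamma> N D \<noteq> 0"
  proof
    assume "mass \<gamma> N D = 0"
    then have "AE \<beta> in coef \<gamma>. lratio \<gamma> \<beta> D * indicator N \<beta> = 0"
      unfolding mass_def nn_integral_0_iff_AE[OF lmN] .
    moreover have "lratio \<gamma> \<beta> D \<noteq> 0" for \<beta> by (rule lratio_pos[OF g D, of \<beta>]) simp
    ultimately have "AE \<beta> in coef \<gamma>. \<beta> \<notin> N" by (auto simp: indicator_def split: if_splits)
    then have "emeasure (coef \<gamma>) N = 0"
      using N(1) sets.sets_into_space[OF N(1)] by (subst (asm) AE_iff_measurable[OF N(1)]) auto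
    then show False using N(2) by (simp add: measure_def)
  qed
  then have "0 < ennreal (model_prior K r rbar \<gamma>) * mass \<gamma> N D"
    using w by (auto simp: zero_less_iff_neq_zero)
  also have "\<dots> \<le> evidence D" by (rule mass_le_evidence[OF g sets.sets_into_space[OF N(1)]])
  finally show ?thesis .
qed

text \<open>Restricting to \<open>space (coef \<gamma>)\<close> does not change the integrals, and it turns the event into a set that
  can be measurable.\<close>

definition numerator :: "(nat set \<Rightarrow> (nat \<Rightarrow> real) \<Rightarrow> bool) \<Rightarrow> (nat \<Rightarrow> (nat \<Rightarrow> real) \<times> real) \<Rightarrow> real" where
  "numerator A D = (\<Sum>\<gamma>\<in>models. model_prior K r rbar \<gamma> *
     (\<integral>\<beta>. indicator {\<beta>\<in>space (coef \<gamma>). A \<gamma> \<beta>} \<beta> * likelihood M n D \<gamma> \<beta> \<partial>coef \<gamma>))"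

lemma posterior_numerator:
  "posterior M K r rbar V n D A = numerator A D / numerator (\<lambda>_ _. True) D"
proof -
  have *: "(\<Sum>\<gamma>\<in>Pow {1..K}. model_prior K r rbar \<gamma> * F \<gamma>) = (\<Sum>\<gamma>\<in>models. model_prior K r rbar \<gamma> * F' \<gamma>)"
    if "\<And>\<gamma>. F \<gamma> = F' \<gamma>" for F F' :: "nat set \<Rightarrow> real"
    unfolding that models_def using sizes model_prior_facts(4)[of r K rbar]
    by (intro sum.mono_neutral_right) (auto simp: not_le)
  show ?thesis
    unfolding posterior_def numerator_def coef_def
    by (intro arg_cong2[where f="(/)"] * Bochner_Integration.integral_cong refl) (auto simp: indicator_def)
qed

lemma numerator_eq:
  assumes D: "D \<in> space sample" and A: "\<And>\<gamma>. \<gamma> \<in> models \<Longrightarrow> {\<beta>\<in>space (coef \<gamma>). A \<gamma> \<beta>} \<in> sets (coef \<gamma>)"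
  shows "0 \<le> numerator A D"
    and "ennreal (numerator A D) = ennreal (\<Prod>i\<in>{1..n}. joint_density {1..K} \<beta>s (D i)) *
      (\<Sum>\<gamma>\<in>models. ennreal (model_prior K r rbar \<gamma>) * mass \<gamma> {\<beta>\<in>space (coef \<gamma>). A \<gamma> \<beta>} D)"
proof -
  define I where "I \<gamma> = (\<integral>\<beta>. indicator {\<beta>\<in>space (coef \<gamma>). A \<gamma> \<beta>} \<beta> * likelihood M n D \<gamma> \<beta> \<partial>coef \<gamma>)" for \<gamma>
  have w: "0 \<le> model_prior K r rbar \<gamma>" for \<gamma> using sizes by (intro model_prior_facts) auto
  have I0: "0 \<le> I \<gamma>" for \<gamma> unfolding I_def likelihood_eq
    by (intro integral_nonneg_AE AE_I2 mult_nonneg_nonneg prod_nonneg) (auto simp: less_imp_le[OF joint_density_pos])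
  have N: "numerator A D = (\<Sum>\<gamma>\<in>models. model_prior K r rbar \<gamma> * I \<gamma>)" unfolding numerator_def I_def ..
  show "0 \<le> numerator A D" unfolding N using w I0 by (intro sum_nonneg mult_nonneg_nonneg)
  have "ennreal (numerator A D) = (\<Sum>\<gamma>\<in>models. ennreal (model_prior K r rbar \<gamma> * I \<gamma>))"
    unfolding N using w I0 by (intro sum_ennreal[symmetric] mult_nonneg_nonneg)
  also have "\<dots> = (\<Sum>\<gamma>\<in>models. ennreal (\<Prod>i\<in>{1..n}. joint_density {1..K} \<beta>s (D i)) *
      (ennreal (model_prior K r rbar \<gamma>) * mass \<gamma> {\<beta>\<in>space (coef \<gamma>). A \<gamma> \<beta>} D))"
  proof (rule sum.cong[OF refl])
    fix \<gamma> assume g: "\<gamma> \<in> models"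
    have "ennreal (model_prior K r rbar \<gamma> * I \<gamma>) = ennreal (model_prior K r rbar \<gamma>) * ennreal (I \<gamma>)"
      using w I0 by (intro ennreal_mult)
    also have "ennreal (I \<gamma>) = ennreal (\<Prod>i\<in>{1..n}. joint_density {1..K} \<beta>s (D i)) * mass \<gamma> {\<beta>\<in>space (coef \<gamma>). A \<gamma> \<beta>} D"
      unfolding I_def by (rule likelihood_integrable(2)[OF g D A[OF g]])
    finally show "ennreal (model_prior K r rbar \<gamma> * I \<gamma>) = ennreal (\<Prod>i\<in>{1..n}. joint_density {1..K} \<beta>s (D i)) *
      (ennreal (model_prior K r rbar \<gamma>) * mass \<gamma> {\<beta>\<in>space (coef \<gamma>). A \<gamma> \<beta>} D)" by (simp only: ac_simps)
  qed
  finally show "ennreal (numerator A D) = ennreal (\<Prod>i\<in>{1..n}. joint_density {1..K} \<beta>s (D i)) *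
      (\<Sum>\<gamma>\<in>models. ennreal (model_prior K r rbar \<gamma>) * mass \<gamma> {\<beta>\<in>space (coef \<gamma>). A \<gamma> \<beta>} D)"
    unfolding sum_distrib_left .
qed

text \<open>The likelihood of the true density cancels between numerator and denominator of the posterior.\<close>

lemma ennreal_scaled_quotient:
  fixes X Y :: ennreal
  assumes "ennreal a = ennreal c * X" "ennreal b = ennreal c * Y" "0 < c" "0 \<le> a" "0 \<le> b" "0 < Y"
  shows "ennreal (a / b) = X / Y" "0 < b"
proof -
  obtain x where x: "X = ennreal x" "0 \<le> x" using assms(1,3) by (cases X) (auto simp: ennreal_mult_top)
  obtain y where y: "Y = ennreal y" "0 \<le> y" using assms(2,3) by (cases Y) (auto simp: ennreal_mult_top)
  have a: "a = c * x" using assms(1,3,4) x by (simp add: ennreal_mult[symmetric])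
  have b: "b = c * y" using assms(2,3,5) y by (simp add: ennreal_mult[symmetric])
  have y0: "0 < y" using assms(6) y by (simp add: ennreal_less_zero_iff)
  show "0 < b" unfolding b using y0 assms(3) by simp
  show "ennreal (a / b) = X / Y"
    unfolding a b x y using assms(3) x(2) y0 by (simp add: divide_ennreal)
qed

lemma posterior_eq:
  assumes D: "D \<in> space sample" and A: "\<And>\<gamma>. \<gamma> \<in> models \<Longrightarrow> {\<beta>\<in>space (coef \<gamma>). A \<gamma> \<beta>} \<in> sets (coef \<gamma>)"
    and ev: "0 < evidence D"
  shows "ennreal (posterior M K r rbar V n D A) = post_prob (\<lambda>\<gamma>. {\<beta>\<in>space (coef \<gamma>). A \<gamma> \<beta>}) D"
    and "0 \<le> posterior M K r rbar V n D A"
    and "posterior M K r rbar V n D (\<lambda>\<gamma> \<beta>. \<not> A \<gamma> \<beta>) = 1 - posterior M K r rbar V n D A"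
proof -
  note nA = numerator_eq[OF D A]
  have T: "{\<beta>\<in>space (coef \<gamma>). True} \<in> sets (coef \<gamma>)" for \<gamma> by simp
  note nT = numerator_eq[OF D T]
  have e: "ennreal (numerator (\<lambda>_ _. True) D) = ennreal (\<Prod>i\<in>{1..n}. joint_density {1..K} \<beta>s (D i)) * evidence D"
    unfolding nT(2) evidence_def by simp
  have P0: "0 < (\<Prod>i\<in>{1..n}. joint_density {1..K} \<beta>s (D i))" by (intro prod_pos) (simp add: joint_density_pos)
  note q = ennreal_scaled_quotient[OF nA(2) e P0 nA(1) nT(1) ev]
  show "ennreal (posterior M K r rbar V n D A) = post_prob (\<lambda>\<gamma>. {\<beta>\<in>space (coef \<gamma>). A \<gamma> \<beta>}) D"
    unfolding posterior_numerator post_prob_def by (rule q(1))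
  show "0 \<le> posterior M K r rbar V n D A" unfolding posterior_numerator using nA(1) nT(1) by simp
  have "numerator A D + numerator (\<lambda>\<gamma> \<beta>. \<not> A \<gamma> \<beta>) D = numerator (\<lambda>_ _. True) D"
    unfolding numerator_def sum.distrib[symmetric] distrib_left[symmetric]
  proof (intro sum.cong refl arg_cong2[where f="(*)"])
    fix \<gamma> assume g: "\<gamma> \<in> models"
    have nAm: "{\<beta>\<in>space (coef \<gamma>). \<not> A \<gamma> \<beta>} \<in> sets (coef \<gamma>)" using A[OF g] by (rule sets.sets_Collect_neg)
    note i = likelihood_integrable(1)[OF g D]
    have "(\<integral>\<beta>. indicator {\<beta>\<in>space (coef \<gamma>). A \<gamma> \<beta>} \<beta> * likelihood M n D \<gamma> \<beta> \<partial>coef \<gamma>)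
        + (\<integral>\<beta>. indicator {\<beta>\<in>space (coef \<gamma>). \<not> A \<gamma> \<beta>} \<beta> * likelihood M n D \<gamma> \<beta> \<partial>coef \<gamma>)
      = (\<integral>\<beta>. indicator {\<beta>\<in>space (coef \<gamma>). A \<gamma> \<beta>} \<beta> * likelihood M n D \<gamma> \<beta>
        + indicator {\<beta>\<in>space (coef \<gamma>). \<not> A \<gamma> \<beta>} \<beta> * likelihood M n D \<gamma> \<beta> \<partial>coef \<gamma>)"
      by (rule Bochner_Integration.integral_add[symmetric, OF i[OF A[OF g]] i[OF nAm]])
    also have "\<dots> = (\<integral>\<beta>. indicator {\<beta>\<in>space (coef \<gamma>). True} \<beta> * likelihood M n D \<gamma> \<beta> \<partial>coef \<gamma>)"
      by (rule Bochner_Integration.integral_cong[OF refl]) (auto simp: indicator_def)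
    finally show "(\<integral>\<beta>. indicator {\<beta>\<in>space (coef \<gamma>). A \<gamma> \<beta>} \<beta> * likelihood M n D \<gamma> \<beta> \<partial>coef \<gamma>)
        + (\<integral>\<beta>. indicator {\<beta>\<in>space (coef \<gamma>). \<not> A \<gamma> \<beta>} \<beta> * likelihood M n D \<gamma> \<beta> \<partial>coef \<gamma>)
      = (\<integral>\<beta>. indicator {\<beta>\<in>space (coef \<gamma>). True} \<beta> * likelihood M n D \<gamma> \<beta> \<partial>coef \<gamma>)" .
  qed
  then show "posterior M K r rbar V n D (\<lambda>\<gamma> \<beta>. \<not> A \<gamma> \<beta>) = 1 - posterior M K r rbar V n D A"
    unfolding posterior_numerator using q(2) by (simp add: field_simps)
qed

end

section \<open>The sieve of boxes\<close>

context design
begin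

lemma linear_predictor_bounded:
  assumes "\<gamma> \<subseteq> {1..K}" "\<forall>j\<in>{1..K}. \<bar>x j\<bar> \<le> 1"
  shows "\<bar>linear_predictor \<gamma> \<beta> x\<bar> \<le> (\<Sum>j\<in>\<gamma>. \<bar>\<beta> j\<bar>)"
proof -
  have "\<bar>linear_predictor \<gamma> \<beta> x\<bar> \<le> (\<Sum>j\<in>\<gamma>. \<bar>x j * \<beta> j\<bar>)" unfolding linear_predictor_def by (rule sum_abs)
  also have "\<dots> \<le> (\<Sum>j\<in>\<gamma>. \<bar>\<beta> j\<bar>)"
    using assms by (intro sum_mono) (auto simp: abs_mult intro!: mult_left_le_one_le)
  finally show ?thesis .
qed

lemma linear_predictor_diff: "linear_predictor \<gamma> \<beta> x - linear_predictor \<gamma> \<beta>' x = linear_predictor \<gamma> (\<lambda>j. \<beta> j - \<beta>' j) x"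
  unfolding linear_predictor_def by (simp add: sum_subtractf algebra_simps)

end

context selection
begin

definition distance_to_truth :: "nat set \<Rightarrow> (nat \<Rightarrow> real) \<Rightarrow> real" where
  "distance_to_truth \<gamma> \<beta> = hellinger M \<nu> (fitted_density M \<gamma> \<beta>) (true_density M K \<beta>s)"

definition far :: "real \<Rightarrow> nat set \<Rightarrow> (nat \<Rightarrow> real) set" where
  "far e \<gamma> = {\<beta>\<in>space (coef \<gamma>). e < distance_to_truth \<gamma> \<beta>}"

lemma far_sets: "\<gamma> \<in> models \<Longrightarrow> far e \<gamma> \<in> sets (coef \<gamma>)"
  unfolding far_def distance_to_truth_def
  using hellinger_meas[OF sets_coef modelsD(1), of \<gamma> "{1..K}" \<beta>s] by measurable

text \<open>The cube \<open>[-T, T]\<^sup>\<gamma>\<close> is cut along the grid of mesh \<open>\<eta>\<close>; a cell is indexed by the integer parts of its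
  scaled coordinates.\<close>

definition box_cell :: "real \<Rightarrow> real \<Rightarrow> nat set \<Rightarrow> (nat \<Rightarrow> int) \<Rightarrow> (nat \<Rightarrow> real) set" where
  "box_cell T \<eta> \<gamma> z = {\<beta>\<in>space (coef \<gamma>). \<forall>j\<in>\<gamma>. \<bar>\<beta> j\<bar> \<le> T \<and> \<lfloor>\<beta> j / \<eta>\<rfloor> = z j}"

definition box_out :: "real \<Rightarrow> nat set \<Rightarrow> (nat \<Rightarrow> real) set" where
  "box_out T \<gamma> = {\<beta>\<in>space (coef \<gamma>). \<exists>j\<in>\<gamma>. T < \<bar>\<beta> j\<bar>}"

definition box_index :: "int \<Rightarrow> nat set \<Rightarrow> (nat \<Rightarrow> int) set" where
  "box_index Zb \<gamma> = PiE \<gamma> (\<lambda>_. {- Zb..Zb})"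

lemma box_sets:
  assumes "\<gamma> \<in> models"
  shows "box_cell T \<eta> \<gamma> z \<in> sets (coef \<gamma>)" "box_out T \<gamma> \<in> sets (coef \<gamma>)"
proof -
  have fin: "finite \<gamma>" by (rule modelsD(3)[OF assms])
  have [measurable]: "(\<lambda>\<beta>. \<beta> j) \<in> borel_measurable (coef \<gamma>)" if "j \<in> \<gamma>" for j
    by (rule coefficient_meas[OF sets_coef that])
  have "{\<beta>\<in>space (coef \<gamma>). \<bar>\<beta> j\<bar> \<le> T \<and> \<lfloor>\<beta> j / \<eta>\<rfloor> = z j} \<in> sets (coef \<gamma>)" if "j \<in> \<gamma>" for j
    using that by measurable
  then show "box_cell T \<eta> \<gamma> z \<in> sets (coef \<gamma>)"
    unfolding box_cell_def by (intro sets.sets_Collect_finite_All fin)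
  have "{\<beta>\<in>space (coef \<gamma>). T < \<bar>\<beta> j\<bar>} \<in> sets (coef \<gamma>)" if "j \<in> \<gamma>" for j
    using that by measurable
  then show "box_out T \<gamma> \<in> sets (coef \<gamma>)"
    unfolding box_out_def by (intro sets.sets_Collect_finite_Ex fin)
qed

lemma box_cover:
  assumes \<eta>: "0 < \<eta>" and Zb: "T / \<eta> \<le> of_int Zb"
  shows "space (coef \<gamma>) \<subseteq> box_out T \<gamma> \<union> (\<Union>z\<in>box_index Zb \<gamma>. box_cell T \<eta> \<gamma> z)"
proof
  fix \<beta> assume \<beta>: "\<beta> \<in> space (coef \<gamma>)"
  show "\<beta> \<in> box_out T \<gamma> \<union> (\<Union>z\<in>box_index Zb \<gamma>. box_cell T \<eta> \<gamma> z)"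
  proof (cases "\<beta> \<in> box_out T \<gamma>")
    case False
    then have b: "\<bar>\<beta> j\<bar> \<le> T" if "j \<in> \<gamma>" for j using that \<beta> unfolding box_out_def by auto
    define z where "z = restrict (\<lambda>j. \<lfloor>\<beta> j / \<eta>\<rfloor>) \<gamma>"
    have "\<lfloor>\<beta> j / \<eta>\<rfloor> \<in> {- Zb..Zb}" if "j \<in> \<gamma>" for j
    proof -
      have "\<bar>\<beta> j / \<eta>\<bar> \<le> T / \<eta>" using b[OF that] \<eta> by (simp add: divide_right_mono)
      then have "- of_int Zb \<le> \<beta> j / \<eta>" "\<beta> j / \<eta> \<le> of_int Zb" using Zb by linarith+
      then show ?thesis by (auto simp: le_floor_iff floor_le_iff)
    qed
    then have "z \<in> box_index Zb \<gamma>" unfolding z_def box_index_def by auto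
    moreover have "\<beta> \<in> box_cell T \<eta> \<gamma> z" using \<beta> b unfolding box_cell_def z_def by auto
    ultimately show ?thesis by blast
  qed simp
qed

lemma card_box_index:
  assumes "\<gamma> \<in> models" "0 \<le> Zb"
  shows "finite (box_index Zb \<gamma>)" "real (card (box_index Zb \<gamma>)) \<le> (2 * of_int Zb + 1) ^ rbar"
proof -
  have fin: "finite \<gamma>" by (rule modelsD(3)[OF assms(1)])
  show "finite (box_index Zb \<gamma>)" unfolding box_index_def using fin by (intro finite_PiE) auto
  have "card (box_index Zb \<gamma>) = nat (2 * Zb + 1) ^ card \<gamma>"
    unfolding box_index_def using fin assms(2) by (simp add: card_PiE)
  then have "real (card (box_index Zb \<gamma>)) = (2 * of_int Zb + 1) ^ card \<gamma>" using assms(2) by simp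
  also have "\<dots> \<le> (2 * of_int Zb + 1) ^ rbar"
    using modelsD(2)[OF assms(1)] assms(2) by (intro power_increasing) auto
  finally show "real (card (box_index Zb \<gamma>)) \<le> (2 * of_int Zb + 1) ^ rbar" .
qed

lemma card_cells:
  assumes "0 \<le> Zb"
  shows "real (card (Sigma models (box_index Zb))) \<le> (real K + 1) ^ rbar * (2 * of_int Zb + 1) ^ rbar"
proof -
  have finm: "finite models" unfolding models_def by (rule finite_subset[of _ "Pow {1..K}"]) auto
  have "real (card (Sigma models (box_index Zb))) = (\<Sum>\<gamma>\<in>models. real (card (box_index Zb \<gamma>)))"
    using finm card_box_index(1)[OF _ assms] by (subst card_SigmaI) auto
  also have "\<dots> \<le> (\<Sum>\<gamma>\<in>models. (2 * of_int Zb + 1) ^ rbar)" by (intro sum_mono card_box_index(2) assms)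
  also have "\<dots> = real (card models) * (2 * of_int Zb + 1) ^ rbar" by simp
  also have "\<dots> \<le> (real K + 1) ^ rbar * (2 * of_int Zb + 1) ^ rbar"
  proof (rule mult_right_mono)
    have "real (card models) \<le> real ((K + 1) ^ rbar)"
      unfolding models_def using card_small_subsets[of K rbar] by (rule of_nat_mono)
    then show "real (card models) \<le> (real K + 1) ^ rbar" by (simp add: add.commute)
  qed (use assms in simp)
  finally show ?thesis .
qed

text \<open>Inside a cell the linear predictors are at most \<open>rbar T\<close> and differ by at most \<open>rbar \<eta>\<close>.\<close>

lemma box_cell_chi:
  assumes g: "\<gamma> \<in> models" and \<beta>: "\<beta> \<in> box_cell T \<eta> \<gamma> z" "\<beta>' \<in> box_cell T \<eta> \<gamma> z"
    and chi: "log_lipschitz_chi A M" and \<eta>: "0 < \<eta>" "real rbar * \<eta> \<le> exp (- A * (1 + real rbar * T))" and T: "0 \<le> T"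
  shows "(\<integral>\<^sup>+z. ennreal ((joint_density \<gamma> \<beta> z)\<^sup>2 / joint_density \<gamma> \<beta>' z) \<partial>base) \<le> ennreal (1 + exp (A * (1 + real rbar * T)) * (real rbar * \<eta>))"
proof (rule joint_density_chi[OF modelsD(1)[OF g] modelsD(1)[OF g] chi _ \<eta>(2)])
  show "0 \<le> real rbar * T" using T by simp
  fix x :: "nat \<Rightarrow> real" assume x: "\<forall>j\<in>{1..K}. \<bar>x j\<bar> \<le> 1"
  have card: "real (card \<gamma>) \<le> real rbar" using modelsD(2)[OF g] by simp
  have box: "\<bar>linear_predictor \<gamma> b x\<bar> \<le> real rbar * T" if "b \<in> box_cell T \<eta> \<gamma> z" for b
  proof -
    have "\<bar>linear_predictor \<gamma> b x\<bar> \<le> (\<Sum>j\<in>\<gamma>. \<bar>b j\<bar>)" by (rule linear_predictor_bounded[OF modelsD(1)[OF g] x])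
    also have "\<dots> \<le> (\<Sum>j\<in>\<gamma>. T)" using that unfolding box_cell_def by (intro sum_mono) auto
    also have "\<dots> \<le> real rbar * T" using mult_right_mono[OF card T] by simp
    finally show ?thesis .
  qed
  have "\<bar>linear_predictor \<gamma> \<beta> x - linear_predictor \<gamma> \<beta>' x\<bar> \<le> (\<Sum>j\<in>\<gamma>. \<bar>\<beta> j - \<beta>' j\<bar>)"
    unfolding linear_predictor_diff by (rule linear_predictor_bounded[OF modelsD(1)[OF g] x])
  also have "\<dots> \<le> (\<Sum>j\<in>\<gamma>. \<eta>)"
  proof (rule sum_mono)
    fix j assume j: "j \<in> \<gamma>"
    have "\<lfloor>\<beta> j / \<eta>\<rfloor> = \<lfloor>\<beta>' j / \<eta>\<rfloor>" using \<beta> j unfolding box_cell_def by auto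
    then have "\<bar>\<beta> j / \<eta> - \<beta>' j / \<eta>\<bar> \<le> 1" by linarith
    then have "\<bar>\<beta> j - \<beta>' j\<bar> / \<eta> \<le> 1" using \<eta>(1) by (simp add: diff_divide_distrib[symmetric])
    then show "\<bar>\<beta> j - \<beta>' j\<bar> \<le> \<eta>" using \<eta>(1) by (simp add: divide_le_eq)
  qed
  also have "\<dots> \<le> real rbar * \<eta>" using mult_right_mono[OF card, of \<eta>] \<eta>(1) by simp
  finally show "\<bar>linear_predictor \<gamma> \<beta> x\<bar> \<le> real rbar * T \<and> \<bar>linear_predictor \<gamma> \<beta>' x\<bar> \<le> real rbar * T \<and> \<bar>linear_predictor \<gamma> \<beta> x - linear_predictor \<gamma> \<beta>' x\<bar> \<le> real rbar * \<eta>"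
    using box \<beta> by simp
qed

text \<open>The radius \<open>1 / (r n)\<close> keeps the sum of the \<open>r\<close> deviations below \<open>1 / n\<close>.\<close>

definition truth_box :: "nat set \<Rightarrow> (nat \<Rightarrow> real) set" where
  "truth_box g0 = PiE g0 (\<lambda>j. {\<beta>s j - 1 / (real r * real n)..\<beta>s j + 1 / (real r * real n)})"

context
  fixes g0 :: "nat set" and S :: real
  assumes g0: "g0 \<subseteq> {1..K}" "card g0 = r" and n: "1 \<le> n"
    and S: "(\<Sum>j\<in>{1..K}. \<bar>\<beta>s j\<bar>) \<le> S" and tail: "(\<Sum>j\<in>{1..K} - g0. \<bar>\<beta>s j\<bar>) \<le> 1 / real n"
begin

lemma g0_model: "g0 \<in> models"
  unfolding models_def using g0 sizes by auto

lemma truth_box_radius: "real r * (1 / (real r * real n)) = 1 / real n"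
  using sizes n by simp

lemma S_nonneg: "0 \<le> S"
  using S by (rule order_trans[rotated]) (simp add: sum_nonneg)

lemma g0_sum: "(\<Sum>j\<in>g0. \<bar>\<beta>s j\<bar>) \<le> S"
  using order_trans[OF sum_mono2[of "{1..K}" g0 "\<lambda>j. \<bar>\<beta>s j\<bar>"] S] g0 by auto

lemma truth_box_sum: "(\<Sum>j\<in>g0. \<bar>\<beta>s j\<bar> + 1 / (real r * real n)) \<le> S + 1"
proof -
  have "(\<Sum>j\<in>g0. \<bar>\<beta>s j\<bar> + 1 / (real r * real n)) = (\<Sum>j\<in>g0. \<bar>\<beta>s j\<bar>) + 1 / real n"
    using truth_box_radius g0(2) by (simp add: sum.distrib)
  moreover have "1 / real n \<le> 1" using n by simp
  ultimately show ?thesis using g0_sum by linarith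
qed

lemma truth_box_sets: "truth_box g0 \<in> sets (coef g0)"
  unfolding truth_box_def sets_coef by (rule sets_PiM_I_finite[OF modelsD(3)[OF g0_model]]) auto

lemma truth_box_mass:
  "exp (- \<Lambda> * (S + 1)\<^sup>2 / 2) / (2 * pi * real r * \<Lambda>) ^ r * (1 / (real r * real n)) ^ r \<le> measure (coef g0) (truth_box g0)"
proof -
  interpret finite_measure "coef g0" by (rule finite_coef[OF g0_model])
  have "0 < 1 / (real r * real n)" using sizes n by simp
  from gaussian_box_mass[OF modelsD(3)[OF g0_model] V[OF modelsD(1,2)[OF g0_model]] \<Lambda> this truth_box_sum]
  have "ennreal (exp (- \<Lambda> * (S + 1)\<^sup>2 / 2) / (2 * pi * real r * \<Lambda>) ^ r * (1 / (real r * real n)) ^ r) \<le> emeasure (coef g0) (truth_box g0)"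
    unfolding truth_box_def coef_def g0(2) .
  then show ?thesis unfolding emeasure_eq_measure by (simp add: ennreal_le_iff)
qed

lemma truth_box_mass_pos: "0 < exp (- \<Lambda> * (S + 1)\<^sup>2 / 2) / (2 * pi * real r * \<Lambda>) ^ r * (1 / (real r * real n)) ^ r"
  using sizes n \<Lambda> by simp

text \<open>The linear predictors differ by \<open>1 / n\<close> from the coefficients left out by \<open>g0\<close> and by \<open>1 / n\<close> from
  the deviations inside the box.\<close>

lemma truth_box_chi:
  assumes chi: "log_lipschitz_chi A M" and D: "2 / real n \<le> exp (- A * (1 + (S + 2)))" and \<beta>: "\<beta> \<in> truth_box g0"
  shows "(\<integral>\<^sup>+z. ennreal ((joint_density {1..K} \<beta>s z)\<^sup>2 / joint_density g0 \<beta> z) \<partial>base) \<le> ennreal (1 + exp (A * (1 + (S + 2))) * (2 / real n))"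
proof (rule joint_density_chi[OF order_refl g0(1) chi _ D])
  show "0 \<le> S + 2" using S_nonneg by simp
  fix x :: "nat \<Rightarrow> real" assume x: "\<forall>j\<in>{1..K}. \<bar>x j\<bar> \<le> 1"
  define \<eta> where "\<eta> = 1 / (real r * real n)"
  have b: "\<bar>\<beta>s j - \<beta> j\<bar> \<le> \<eta>" if "j \<in> g0" for j
    using PiE_mem[OF \<beta>[unfolded truth_box_def] that] unfolding \<eta>_def[symmetric] by auto
  have 1: "\<bar>linear_predictor {1..K} \<beta>s x\<bar> \<le> S + 2" using linear_predictor_bounded[OF order_refl x, of \<beta>s] S by linarith
  have "\<bar>linear_predictor g0 \<beta> x\<bar> \<le> (\<Sum>j\<in>g0. \<bar>\<beta> j\<bar>)" by (rule linear_predictor_bounded[OF g0(1) x])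
  also have "\<dots> \<le> (\<Sum>j\<in>g0. \<bar>\<beta>s j\<bar> + \<eta>)" by (rule sum_mono) (use b in \<open>fastforce simp: abs_le_iff\<close>)
  also have "\<dots> \<le> S + 1" unfolding \<eta>_def by (rule truth_box_sum)
  finally have 2: "\<bar>linear_predictor g0 \<beta> x\<bar> \<le> S + 2" by simp
  have "linear_predictor {1..K} \<beta>s x = linear_predictor g0 \<beta>s x + linear_predictor ({1..K} - g0) \<beta>s x"
    unfolding linear_predictor_def using g0(1) by (subst sum.subset_diff[of g0]) auto
  then have "\<bar>linear_predictor {1..K} \<beta>s x - linear_predictor g0 \<beta> x\<bar> \<le> \<bar>linear_predictor g0 \<beta>s x - linear_predictor g0 \<beta> x\<bar> + \<bar>linear_predictor ({1..K} - g0) \<beta>s x\<bar>" by linarith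
  also have "\<bar>linear_predictor ({1..K} - g0) \<beta>s x\<bar> \<le> 1 / real n"
    using linear_predictor_bounded[of "{1..K} - g0", OF _ x, of \<beta>s] tail by auto
  also have "\<bar>linear_predictor g0 \<beta>s x - linear_predictor g0 \<beta> x\<bar> \<le> 1 / real n"
  proof -
    have "\<bar>linear_predictor g0 \<beta>s x - linear_predictor g0 \<beta> x\<bar> \<le> (\<Sum>j\<in>g0. \<bar>\<beta>s j - \<beta> j\<bar>)"
      unfolding linear_predictor_diff by (rule linear_predictor_bounded[OF g0(1) x])
    also have "\<dots> \<le> (\<Sum>j\<in>g0. \<eta>)" by (rule sum_mono) (rule b)
    also have "\<dots> = 1 / real n" using truth_box_radius g0(2) unfolding \<eta>_def by simp
    finally show ?thesis .
  qed
  finally have 3: "\<bar>linear_predictor {1..K} \<beta>s x - linear_predictor g0 \<beta> x\<bar> \<le> 2 / real n" by simp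
  show "\<bar>linear_predictor {1..K} \<beta>s x\<bar> \<le> S + 2 \<and> \<bar>linear_predictor g0 \<beta> x\<bar> \<le> S + 2 \<and> \<bar>linear_predictor {1..K} \<beta>s x - linear_predictor g0 \<beta> x\<bar> \<le> 2 / real n"
    using 1 2 3 by simp
qed

lemma g0_prior: "exp (- real r * ln (real K) - real r) \<le> model_prior K r rbar g0"
  using sizes g0 by (intro model_prior_facts) auto

lemma evidence_positive: "D \<in> space sample \<Longrightarrow> 0 < evidence D"
  by (rule evidence_pos[OF g0_model _ _ truth_box_sets])
    (auto intro: less_le_trans[OF truth_box_mass_pos truth_box_mass] less_le_trans[OF exp_gt_zero g0_prior])

text \<open>The mesh \<open>\<eta>\<close> is chosen such that the chi-square divergence within a cell is \<open>\<kappa>\<^sup>2\<close> with \<open>\<kappa> = \<epsilon>\<^sup>2 / 4\<close>. The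
  affinity \<open>1 - \<epsilon>\<^sup>2 / 2\<close> outside the Hellinger ball then loses only half of its gap to 1.\<close>

theorem expected_post_prob_bound:
  fixes A \<epsilon> T \<tau> :: real
  defines "\<eta> \<equiv> exp (- A * (1 + real rbar * T)) * \<epsilon> ^ 4 / (16 * real rbar)"
    and "m0 \<equiv> exp (- \<Lambda> * (S + 1)\<^sup>2 / 2) / (2 * pi * real r * \<Lambda>) ^ r * (1 / (real r * real n)) ^ r"
    and "w0 \<equiv> exp (- real r * ln (real K) - real r)"
    and "Ms \<equiv> (4 * \<Lambda>\<^sup>2 * real rbar) ^ rbar"
  assumes chi: "log_lipschitz_chi A M" and \<epsilon>: "0 < \<epsilon>" "\<epsilon> \<le> 1" and T: "0 < T" and \<tau>: "0 < \<tau>"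
    and D: "2 / real n \<le> exp (- A * (1 + (S + 2)))"
  shows "(\<integral>\<^sup>+D. post_prob (far \<epsilon>) D \<partial>sample) \<le>
    ennreal (\<tau> * (1 + exp (A * (1 + (S + 2))) * (2 / real n)) ^ n
      + (real K + 1) ^ rbar * (2 * of_int \<lceil>T / \<eta>\<rceil> + 1) ^ rbar * ((1 - \<epsilon>\<^sup>2 / 2) ^ n + Ms * (1 - \<epsilon>\<^sup>2 / 4) ^ n / (w0 * \<tau> * m0))
      + exp (- T\<^sup>2 / (4 * \<Lambda>)) * Ms / (w0 * \<tau> * m0))"
proof -
  define w m where "w = model_prior K r rbar g0" and "m = measure (coef g0) (truth_box g0)"
  define Nc where "Nc = (real K + 1) ^ rbar * (2 * of_int \<lceil>T / \<eta>\<rceil> + 1) ^ rbar"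
  have rb: "1 \<le> real rbar" using sizes by simp
  have \<eta>0: "0 < \<eta>" unfolding \<eta>_def using \<epsilon> rb by simp
  have \<eta>1: "real rbar * \<eta> = exp (- A * (1 + real rbar * T)) * (\<epsilon>\<^sup>2 / 4)\<^sup>2"
    unfolding \<eta>_def using rb by (simp add: power2_eq_square power4_eq_xxxx)
  have e4: "\<epsilon>\<^sup>2 \<le> 1" using \<epsilon> by (simp add: power_le_one)
  have \<eta>2: "real rbar * \<eta> \<le> exp (- A * (1 + real rbar * T))"
    unfolding \<eta>1 using e4 by (intro mult_left_le power_le_one) auto
  have \<eta>3: "exp (A * (1 + real rbar * T)) * (real rbar * \<eta>) = (\<epsilon>\<^sup>2 / 4)\<^sup>2"
    unfolding \<eta>1 by (simp add: mult.assoc[symmetric] mult_exp_exp)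
  have Zb0: "0 \<le> \<lceil>T / \<eta>\<rceil>" using T \<eta>0 by (simp add: le_ceiling_iff less_le_trans[of _ 0])
  have Zb1: "T / \<eta> \<le> of_int \<lceil>T / \<eta>\<rceil>" by (rule le_of_int_ceiling)
  have Ms: "0 \<le> Ms" unfolding Ms_def using \<Lambda> by simp
  have m0: "0 < m0" unfolding m0_def by (rule truth_box_mass_pos)
  have m: "m0 \<le> m" unfolding m0_def m_def by (rule truth_box_mass)
  have w0: "0 < w0" unfolding w0_def by simp
  have w: "w0 \<le> w" unfolding w0_def w_def by (rule g0_prior)
  have \<kappa>0: "0 \<le> exp (A * (1 + (S + 2))) * (2 / real n)" by simp
  have r3: "1 \<le> r" "r < K" "r \<le> rbar" using sizes by auto
  have Nc: "0 \<le> Nc" unfolding Nc_def using Zb0 by simp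
  have "(\<integral>\<^sup>+D. post_prob (far \<epsilon>) D \<partial>sample) \<le>
    ennreal (\<tau> * (1 + exp (A * (1 + (S + 2))) * (2 / real n)) ^ n
      + Nc * ((1 - \<epsilon>\<^sup>2 / 2) ^ n + Ms * (1 - \<epsilon>\<^sup>2 / 2 + \<epsilon>\<^sup>2 / 4) ^ n / (w * \<tau> * m))
      + exp (- T\<^sup>2 / (4 * \<Lambda>)) * Ms / (w * \<tau> * m))"
    unfolding w_def
  proof (rule finite_sample_bound[where cell = "box_cell T \<eta>" and Z = "box_index \<lceil>T / \<eta>\<rceil>" and Out = "box_out T" and N = "truth_box g0"])
    show "far \<epsilon> \<gamma> \<in> sets (coef \<gamma>)" if "\<gamma> \<in> models" for \<gamma> by (rule far_sets[OF that])
    show "(\<integral>\<^sup>+z. ennreal (sqrt (joint_density \<gamma> \<beta> z * joint_density {1..K} \<beta>s z)) \<partial>base) \<le> ennreal (1 - \<epsilon>\<^sup>2 / 2)"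
      if "\<gamma> \<in> models" "\<beta> \<in> far \<epsilon> \<gamma>" for \<gamma> \<beta>
      by (rule affinity_of_hellinger[OF modelsD(1)[OF that(1)] order_refl less_imp_le[OF \<epsilon>(1)]])
        (use that(2) in \<open>simp add: far_def distance_to_truth_def\<close>)
    show "finite (box_index \<lceil>T / \<eta>\<rceil> \<gamma>)" if "\<gamma> \<in> models" for \<gamma> by (rule card_box_index(1)[OF that Zb0])
    show "(\<integral>\<^sup>+z. ennreal ((joint_density \<gamma> \<beta> z)\<^sup>2 / joint_density \<gamma> \<beta>' z) \<partial>base) \<le> ennreal (1 + (\<epsilon>\<^sup>2 / 4)\<^sup>2)"
      if "\<gamma> \<in> models" "z \<in> box_index \<lceil>T / \<eta>\<rceil> \<gamma>" "\<beta> \<in> box_cell T \<eta> \<gamma> z" "\<beta>' \<in> box_cell T \<eta> \<gamma> z" for \<gamma> z \<beta> \<beta>'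
      using box_cell_chi[OF that(1) that(3) that(4) chi \<eta>0 \<eta>2 less_imp_le[OF T]] unfolding \<eta>3 .
    show "far \<epsilon> \<gamma> \<subseteq> box_out T \<gamma> \<union> (\<Union>z\<in>box_index \<lceil>T / \<eta>\<rceil> \<gamma>. box_cell T \<eta> \<gamma> z)" if "\<gamma> \<in> models" for \<gamma>
      using box_cover[OF \<eta>0 Zb1] sets.sets_into_space[OF far_sets[OF that]] by blast
    show "emeasure (coef \<gamma>) (box_out T \<gamma>) \<le> ennreal (exp (- T\<^sup>2 / (4 * \<Lambda>)) * Ms)" if "\<gamma> \<in> models" for \<gamma>
      unfolding Ms_def
    proof (rule coef_mass[OF that box_sets(2)[OF that]])
      fix \<beta> assume "\<beta> \<in> box_out T \<gamma>"
      then obtain j where j: "j \<in> \<gamma>" "T < \<bar>\<beta> j\<bar>" unfolding box_out_def by auto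
      have "T\<^sup>2 \<le> (\<beta> j)\<^sup>2" using j T power_mono[of T "\<bar>\<beta> j\<bar>" 2] by simp
      also have "\<dots> \<le> (\<Sum>j\<in>\<gamma>. (\<beta> j)\<^sup>2)" using j modelsD(3)[OF that] by (intro member_le_sum) auto
      finally show "T\<^sup>2 \<le> (\<Sum>j\<in>\<gamma>. (\<beta> j)\<^sup>2)" .
    qed
    show "emeasure (coef \<gamma>) (space (coef \<gamma>)) \<le> ennreal Ms" if "\<gamma> \<in> models" for \<gamma>
      unfolding Ms_def by (rule coef_total[OF that])
    show "(\<integral>\<^sup>+z. ennreal ((joint_density {1..K} \<beta>s z)\<^sup>2 / joint_density g0 \<beta> z) \<partial>base) \<le> ennreal (1 + exp (A * (1 + (S + 2))) * (2 / real n))"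
      if "\<beta> \<in> truth_box g0" for \<beta> by (rule truth_box_chi[OF chi D that])
    show "(\<Sum>\<gamma>\<in>models. model_prior K r rbar \<gamma>) \<le> 1"
      unfolding models_def by (rule model_prior_facts(2)[OF r3])
    show "real (card (Sigma models (box_index \<lceil>T / \<eta>\<rceil>))) \<le> Nc" unfolding Nc_def by (rule card_cells[OF Zb0])
    show "m = measure (coef g0) (truth_box g0)" by (rule m_def)
    show "0 \<le> 1 - \<epsilon>\<^sup>2 / 2" using e4 by simp
    show "0 < \<epsilon>\<^sup>2 / 4" using \<epsilon> by simp
    show "0 \<le> exp (- T\<^sup>2 / (4 * \<Lambda>)) * Ms" using Ms by simp
    show "0 < model_prior K r rbar g0" using w w0 unfolding w_def by linarith
    show "0 < m" using m m0 by linarith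
  qed (use box_sets truth_box_sets g0_model Ms \<tau> \<kappa>0 in auto)
  also have "\<dots> \<le> ennreal (\<tau> * (1 + exp (A * (1 + (S + 2))) * (2 / real n)) ^ n
      + Nc * ((1 - \<epsilon>\<^sup>2 / 2) ^ n + Ms * (1 - \<epsilon>\<^sup>2 / 4) ^ n / (w0 * \<tau> * m0))
      + exp (- T\<^sup>2 / (4 * \<Lambda>)) * Ms / (w0 * \<tau> * m0))"
  proof -
    have c: "0 < w0 * \<tau> * m0" using w0 \<tau> m0 by simp
    have c': "w0 * \<tau> * m0 \<le> w * \<tau> * m" using w m w0 m0 \<tau> by (intro mult_mono) auto
    have d: "x / (w * \<tau> * m) \<le> x / (w0 * \<tau> * m0)" if "0 \<le> x" for x
      using that c c' less_le_trans[OF c c'] by (intro divide_left_mono mult_pos_pos[OF _ c]) auto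
    have e: "1 - \<epsilon>\<^sup>2 / 2 + \<epsilon>\<^sup>2 / 4 = 1 - \<epsilon>\<^sup>2 / 4" by simp
    have q: "0 \<le> (1 - \<epsilon>\<^sup>2 / 4) ^ n" using e4 by simp
    show ?thesis unfolding e using Nc Ms q
      by (intro ennreal_leI add_mono mult_left_mono d order_refl mult_nonneg_nonneg) auto
  qed
  finally show ?thesis unfolding Nc_def .
qed

end

end

section \<open>Contraction at a fixed sample size\<close>

lemma spectrum_within_of_sup:
  assumes V: "\<And>\<gamma>. \<gamma> \<subseteq> {1..K} \<Longrightarrow> pos_def (card \<gamma>) (V \<gamma>)"
    and sup: "max (SUP \<gamma>\<in>nonempty_models K rbar. ch1 (V \<gamma>)) (SUP \<gamma>\<in>nonempty_models K rbar. ch1 (inv_mat (V \<gamma>))) \<le> \<Lambda>"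
    and g: "\<gamma> \<subseteq> {1..K}" "card \<gamma> \<le> rbar"
  shows "spectrum_within \<Lambda> \<gamma> (V \<gamma>)"
proof -
  have fin: "finite (nonempty_models K rbar)"
    unfolding nonempty_models_def by (rule finite_subset[of _ "Pow {1..K}"]) auto
  have "ch1 (V \<gamma>) \<le> \<Lambda> \<and> ch1 (inv_mat (V \<gamma>)) \<le> \<Lambda>" if "\<gamma> \<noteq> {}"
  proof -
    have m: "\<gamma> \<in> nonempty_models K rbar" using that g unfolding nonempty_models_def by simp
    have up: "f \<gamma> \<le> (SUP \<gamma>\<in>nonempty_models K rbar. f \<gamma>)" for f :: "nat set \<Rightarrow> real"
      by (rule cSUP_upper[OF m bdd_above_finite[OF finite_imageI[OF fin]]])
    show ?thesis
      using order_trans[OF up[of "\<lambda>\<gamma>. ch1 (V \<gamma>)"] order_trans[OF max.cobounded1 sup]]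
        order_trans[OF up[of "\<lambda>\<gamma>. ch1 (inv_mat (V \<gamma>))"] order_trans[OF max.cobounded2 sup]] by (rule conjI)
  qed
  then show ?thesis unfolding spectrum_within_def using V[OF g(1)] by blast
qed

text \<open>The infimum ranges over a finite nonempty set of models, as \<open>r \<le> K\<close>.\<close>

lemma tail_sum_attained:
  assumes "r \<le> K" "tail_sum K \<beta>s r \<le> t"
  obtains g0 where "g0 \<subseteq> {1..K}" "card g0 = r" "(\<Sum>j\<in>{1..K} - g0. \<bar>\<beta>s j\<bar>) \<le> t"
proof -
  define G where "G = {\<gamma>. \<gamma> \<subseteq> {1..K} \<and> card \<gamma> = r}"
  define F where "F = (\<lambda>\<gamma>. \<Sum>j\<in>{1..K} - \<gamma>. \<bar>\<beta>s j\<bar>) ` G"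
  have "finite G" unfolding G_def by (rule finite_subset[of _ "Pow {1..K}"]) auto
  then have fin: "finite F" unfolding F_def by (rule finite_imageI)
  have "{1..r} \<in> G" unfolding G_def using assms by auto
  then have ne: "F \<noteq> {}" unfolding F_def by auto
  have "Inf F \<in> F" unfolding cInf_eq_Min[OF fin ne] by (rule Min_in[OF fin ne])
  moreover have "tail_sum K \<beta>s r = Inf F" unfolding tail_sum_def F_def G_def ..
  ultimately have "tail_sum K \<beta>s r \<in> F" by (simp only:)
  then obtain g0 where g0: "g0 \<in> G" "tail_sum K \<beta>s r = (\<Sum>j\<in>{1..K} - g0. \<bar>\<beta>s j\<bar>)"
    unfolding F_def by (rule imageE)
  show thesis
  proof (rule that)
    show "g0 \<subseteq> {1..K}" "card g0 = r" using g0(1) unfolding G_def by simp_all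
    show "(\<Sum>j\<in>{1..K} - g0. \<bar>\<beta>s j\<bar>) \<le> t" using assms(2) unfolding g0(2) .
  qed
qed

context selection
begin

lemma post_prob_meas: "post_prob (far e) \<in> borel_measurable sample"
proof -
  have "(\<lambda>D. \<Sum>\<gamma>\<in>models. ennreal (model_prior K r rbar \<gamma>) * mass \<gamma> (far e \<gamma>) D) \<in> borel_measurable sample"
  proof (rule borel_measurable_sum)
    fix \<gamma> assume g: "\<gamma> \<in> models"
    show "(\<lambda>D. ennreal (model_prior K r rbar \<gamma>) * mass \<gamma> (far e \<gamma>) D) \<in> borel_measurable sample"
      by (rule borel_measurable_times_ennreal[OF borel_measurable_const measurable_mass[OF g far_sets[OF g]]])
  qed
  from borel_measurable_divide_ennreal[OF this evidence_meas] show ?thesis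
    unfolding post_prob_def[abs_def] .
qed

text \<open>Markov's inequality: a nonnegative variable of mean at most \<open>b\<^sup>2\<close> exceeds \<open>b\<close> with probability at
  most \<open>b\<close>, and the posterior masses of \<open>{d > e}\<close> and \<open>{d \<le> e}\<close> add up to 1.\<close>

lemma posterior_consequences:
  fixes e b :: real
  assumes ev: "\<And>D. D \<in> space sample \<Longrightarrow> 0 < evidence D"
    and bound: "(\<integral>\<^sup>+D. post_prob (far e) D \<partial>sample) \<le> ennreal (b\<^sup>2)" and b: "0 < b"
  defines "X \<equiv> \<lambda>D. posterior M K r rbar V n D (\<lambda>\<gamma> \<beta>. distance_to_truth \<gamma> \<beta> > e)"
  shows "measure sample {D \<in> space sample. X D \<ge> b} \<le> b"
    and "(\<integral>D. X D \<partial>sample) \<le> b\<^sup>2"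
    and "1 - b \<le> measure sample {D \<in> space sample. posterior M K r rbar V n D (\<lambda>\<gamma> \<beta>. distance_to_truth \<gamma> \<beta> \<le> e) \<ge> 1 - b}"
proof -
  interpret P: prob_space sample by (rule prob_space_sample)
  have A: "{\<beta>\<in>space (coef \<gamma>). e < distance_to_truth \<gamma> \<beta>} \<in> sets (coef \<gamma>)" if "\<gamma> \<in> models" for \<gamma>
    using far_sets[OF that] unfolding far_def .
  have X: "ennreal (X D) = post_prob (far e) D" "0 \<le> X D"
    "posterior M K r rbar V n D (\<lambda>\<gamma> \<beta>. distance_to_truth \<gamma> \<beta> \<le> e) = 1 - X D" if D: "D \<in> space sample" for D
    using posterior_eq[where A="\<lambda>\<gamma> \<beta>. e < distance_to_truth \<gamma> \<beta>", OF D A ev[OF D]] unfolding X_def far_def[abs_def] not_less by auto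
  have Xm [measurable]: "X \<in> borel_measurable sample"
  proof -
    have m: "(\<lambda>D. enn2real (post_prob (far e) D)) \<in> borel_measurable sample"
      using post_prob_meas by measurable
    have eq: "X D = enn2real (post_prob (far e) D)" if "D \<in> space sample" for D
      using X(2)[OF that] unfolding X(1)[OF that, symmetric] by simp
    show ?thesis by (rule measurable_cong[OF eq, THEN iffD2, OF _ m])
  qed
  have "(\<integral>\<^sup>+D. ennreal (X D) \<partial>sample) = (\<integral>\<^sup>+D. post_prob (far e) D \<partial>sample)"
    by (rule nn_integral_cong) (rule X(1))
  with bound have int: "(\<integral>\<^sup>+D. ennreal (X D) \<partial>sample) \<le> ennreal (b\<^sup>2)" by (simp only:)
  have "(\<integral>D. X D \<partial>sample) = enn2real (\<integral>\<^sup>+D. ennreal (X D) \<partial>sample)"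
    by (rule integral_eq_nn_integral[OF Xm AE_I2[OF X(2)]])
  also have "\<dots> \<le> b\<^sup>2" using int by (intro enn2real_leI) auto
  finally show "(\<integral>D. X D \<partial>sample) \<le> b\<^sup>2" .
  define W where "W = {D \<in> space sample. X D \<ge> b}"
  have W: "W \<in> sets sample" unfolding W_def by measurable
  have "ennreal b * emeasure sample W = (\<integral>\<^sup>+D. ennreal b * indicator W D \<partial>sample)"
    by (rule nn_integral_cmult_indicator[OF W, symmetric])
  also have "\<dots> \<le> (\<integral>\<^sup>+D. ennreal (X D) \<partial>sample)"
    by (intro nn_integral_mono) (auto simp: W_def indicator_def intro: ennreal_leI)
  also have "\<dots> \<le> ennreal (b\<^sup>2)" by (rule int)
  finally have "b * measure sample W \<le> b * b"
    using b unfolding P.emeasure_eq_measure by (simp add: ennreal_mult[symmetric] ennreal_le_iff power2_eq_square)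
  then have Wb: "measure sample W \<le> b" using b by simp
  then show "measure sample {D \<in> space sample. X D \<ge> b} \<le> b" unfolding W_def .
  have "1 - b \<le> 1 - measure sample W" using Wb by simp
  also have "\<dots> = measure sample (space sample - W)" by (rule P.prob_compl[OF W, symmetric])
  also have "\<dots> \<le> measure sample {D \<in> space sample. posterior M K r rbar V n D (\<lambda>\<gamma> \<beta>. distance_to_truth \<gamma> \<beta> \<le> e) \<ge> 1 - b}"
  proof (rule P.finite_measure_mono)
    show "space sample - W \<subseteq> {D \<in> space sample. posterior M K r rbar V n D (\<lambda>\<gamma> \<beta>. distance_to_truth \<gamma> \<beta> \<le> e) \<ge> 1 - b}"
      using X(3) unfolding W_def by auto
    have "{D \<in> space sample. 1 - X D \<ge> 1 - b} \<in> sets sample" by measurable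
    moreover have "{D \<in> space sample. 1 - X D \<ge> 1 - b} = {D \<in> space sample. posterior M K r rbar V n D (\<lambda>\<gamma> \<beta>. distance_to_truth \<gamma> \<beta> \<le> e) \<ge> 1 - b}"
      using X(3) by auto
    ultimately show "{D \<in> space sample. posterior M K r rbar V n D (\<lambda>\<gamma> \<beta>. distance_to_truth \<gamma> \<beta> \<le> e) \<ge> 1 - b} \<in> sets sample" by simp
  qed
  finally show "1 - b \<le> measure sample {D \<in> space sample. posterior M K r rbar V n D (\<lambda>\<gamma> \<beta>. distance_to_truth \<gamma> \<beta> \<le> e) \<ge> 1 - b}" .
qed

text \<open>The last four hypotheses are the budget: prior mass near the truth, number of cells, total mass of
  the Gaussian bounds and tail outside the sieve, each as a share of the exponent \<open>s = n \<epsilon>\<^sup>2\<close>.\<close>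

theorem contraction_at:
  fixes A \<epsilon> S T s l :: real
  assumes g0: "g0 \<subseteq> {1..K}" "card g0 = r" and n: "1 \<le> n"
    and S: "(\<Sum>j\<in>{1..K}. \<bar>\<beta>s j\<bar>) \<le> S" and tail: "(\<Sum>j\<in>{1..K} - g0. \<bar>\<beta>s j\<bar>) \<le> 1 / real n"
    and chi: "log_lipschitz_chi A M" and A: "0 \<le> A" and \<epsilon>: "0 < \<epsilon>" "\<epsilon> \<le> 1" and T: "1 \<le> T" "T \<le> real n"
    and D: "2 / real n \<le> exp (- A * (1 + (S + 2)))"
    and l: "l = ln (real n)" and s: "s = real n * \<epsilon>\<^sup>2" "128 \<le> s" "64 * exp (A * (1 + (S + 2))) \<le> s"
    and prior: "real r * ln (real K) + real r + \<Lambda> * (S + 1)\<^sup>2 / 2 + real r * (2 * pi * real r * \<Lambda>) + real r * (real r + l) \<le> s / 16"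
    and cells: "real rbar * (1 + ln (real K)) + real rbar * (5 + 3 * l + real rbar + A + A * real rbar * T) \<le> s / 32"
    and mass: "real rbar * (4 * \<Lambda>\<^sup>2 * real rbar) \<le> s / 32"
    and out: "s * (4 * \<Lambda>) \<le> T\<^sup>2"
  shows "measure sample {D \<in> space sample. posterior M K r rbar V n D (\<lambda>\<gamma> \<beta>. distance_to_truth \<gamma> \<beta> > \<epsilon>) \<ge> exp (- s / 128)} \<le> exp (- s / 128)"
    and "(\<integral>D. posterior M K r rbar V n D (\<lambda>\<gamma> \<beta>. distance_to_truth \<gamma> \<beta> > \<epsilon>) \<partial>sample) \<le> exp (- s / 64)"
    and "1 - exp (- s / 128) \<le> measure sample {D \<in> space sample. posterior M K r rbar V n D (\<lambda>\<gamma> \<beta>. distance_to_truth \<gamma> \<beta> \<le> \<epsilon>) \<ge> 1 - exp (- s / 128)}"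
proof -
  define \<eta> where "\<eta> = exp (- A * (1 + real rbar * T)) * \<epsilon> ^ 4 / (16 * real rbar)"
  have rb: "1 \<le> rbar" "1 \<le> real K" using sizes by auto
  have "128 * 1 \<le> s" using s by simp
  then have \<epsilon>n: "1 / real n \<le> \<epsilon>\<^sup>2" using n s(1) by (simp add: divide_le_eq mult.commute)
  have \<eta>0: "0 < \<eta>" unfolding \<eta>_def using \<epsilon> rb by simp
  have ceil0: "0 \<le> real_of_int \<lceil>T / \<eta>\<rceil>" using T \<eta>0 by (simp add: less_le_trans[of _ 0])
  have Ms: "(4 * \<Lambda>\<^sup>2 * real rbar) ^ rbar \<le> exp (s / 32)"
    by (rule order_trans[OF power_le_exp[OF _ le_exp_self]]) (use mass \<Lambda> in auto)
  have Q: "exp (- T\<^sup>2 / (4 * \<Lambda>)) \<le> exp (- s)" using out \<Lambda> by (simp add: le_divide_eq)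
  define w0 where "w0 = exp (- real r * ln (real K) - real r)"
  define m0 where "m0 = exp (- \<Lambda> * (S + 1)\<^sup>2 / 2) / (2 * pi * real r * \<Lambda>) ^ r * (1 / (real r * real n)) ^ r"
  define Nc where "Nc = (real K + 1) ^ rbar * (2 * of_int \<lceil>T / \<eta>\<rceil> + 1) ^ rbar"
  define M1 where "M1 = (4 * \<Lambda>\<^sup>2 * real rbar) ^ rbar"
  have wm: "exp (- s / 16) \<le> w0 * m0"
    using prior_mass_lower[OF sizes(1) \<Lambda> n l prior] unfolding w0_def m0_def minus_divide_left .
  have Nc: "0 \<le> Nc" "Nc \<le> exp (s / 32)"
    unfolding Nc_def using ceil0 covering_number_upper[OF rb n l A \<epsilon> \<epsilon>n T cells, folded \<eta>_def]
    by (auto intro!: mult_nonneg_nonneg zero_le_power)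
  have M1: "0 \<le> M1" "M1 \<le> exp (s / 32)" unfolding M1_def using Ms by (auto intro!: zero_le_power)
  have T0: "0 < T" using T by simp
  note expected_post_prob_bound[OF g0 n S tail chi \<epsilon> T0 exp_gt_zero[of "- s / 16"] D, folded \<eta>_def w0_def m0_def Nc_def M1_def]
  also note ennreal_leI[OF combine_bounds[OF n \<epsilon> s exp_ge_zero wm Nc M1 exp_ge_zero Q]]
  also have "exp (- s / 64) = (exp (- s / 128))\<^sup>2" by (simp add: exp_double[symmetric])
  finally have b: "(\<integral>\<^sup>+D. post_prob (far \<epsilon>) D \<partial>sample) \<le> ennreal ((exp (- s / 128))\<^sup>2)" .
  have e2: "(exp (- s / 128))\<^sup>2 = exp (- s / 64)" by (simp add: exp_double[symmetric])
  note c = posterior_consequences[OF evidence_positive[OF g0 n S tail] b exp_gt_zero]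
  show "measure sample {D \<in> space sample. posterior M K r rbar V n D (\<lambda>\<gamma> \<beta>. distance_to_truth \<gamma> \<beta> > \<epsilon>) \<ge> exp (- s / 128)} \<le> exp (- s / 128)"
    by (rule c(1))
  show "(\<integral>D. posterior M K r rbar V n D (\<lambda>\<gamma> \<beta>. distance_to_truth \<gamma> \<beta> > \<epsilon>) \<partial>sample) \<le> exp (- s / 64)"
    using c(2) unfolding e2 .
  show "1 - exp (- s / 128) \<le> measure sample {D \<in> space sample. posterior M K r rbar V n D (\<lambda>\<gamma> \<beta>. distance_to_truth \<gamma> \<beta> \<le> \<epsilon>) \<ge> 1 - exp (- s / 128)}"
    by (rule c(3))
qed

end

text \<open>In the first two bounds the term with \<open>ln K \<le> C n\<^sup>\<xi>\<close> is critical, being of the order of \<open>s\<close> up to the factor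
  \<open>R / (ln n)\<^sup>k\<close>. This is why \<open>R = o((ln n)\<^sup>k)\<close> is needed, here as \<open>R \<le> (ln n)\<^sup>k / (1024 (C + 1))\<close>. All
  other terms are of smaller order by a power of \<open>n\<close>, which is the content of \<open>g1\<close> to \<open>g4\<close>.\<close>

lemma rates_at:
  fixes B S k v \<xi> A C s l N Lk lnK \<Lambda> T :: real and r R n :: nat
  assumes par: "0 < B" "1 < k" "0 < v" "0 < \<xi>" "1 \<le> A" "0 < C"
    and l: "1 \<le> l" "l = ln (real n)" and N: "N = real n powr \<xi>" "1 \<le> N" and Lk: "Lk = l powr k"
    and s: "N * Lk / 2 \<le> s" "s \<le> 2 * (N * Lk)"
    and R: "r \<le> R" "real R \<le> Lk / (1024 * (C + 1))" and lnK: "0 \<le> lnK" "lnK \<le> C * N"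
    and \<Lambda>: "\<Lambda> = B * real R powr v" and T: "T = real n powr (3 * \<xi> / 4)"
    and g1: "l powr k + B * l powr (k * v) * (S + 1)\<^sup>2 / 2 + 2 * pi * B * l powr (2 * k + k * v) + l powr (2 * k) + l powr (k + 1)
           \<le> N * l powr k / 256"
    and g2: "l powr k * (5 + 3 * l + l powr k + A + A * l powr k * T) \<le> N * l powr k / 256"
    and g3: "4 * B\<^sup>2 * l powr (2 * (k * v) + 2 * k) \<le> N * l powr k / 64"
    and g4: "2 * (N * l powr k) * (4 * (B * l powr (k * v))) \<le> real n powr (3 * \<xi> / 2)"
  shows "real r * lnK + real r + \<Lambda> * (S + 1)\<^sup>2 / 2 + real r * (2 * pi * real r * \<Lambda>) + real r * (real r + l) \<le> s / 16"
    and "real R * (1 + lnK) + real R * (5 + 3 * l + real R + A + A * real R * T) \<le> s / 32"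
    and "real R * (4 * \<Lambda>\<^sup>2 * real R) \<le> s / 32"
    and "s * (4 * \<Lambda>) \<le> T\<^sup>2"
proof -
  have Lk1: "1 \<le> Lk" unfolding Lk using l par by (intro ge_one_powr_ge_zero) auto
  have C1: "0 < 1024 * (C + 1)" using par by simp
  have "1 * Lk \<le> 1024 * (C + 1) * Lk" using par Lk1 by (intro mult_right_mono) auto
  then have "Lk / (1024 * (C + 1)) \<le> Lk" using C1 by (simp add: divide_le_eq mult.commute)
  then have RL: "real R \<le> Lk" using R(2) by linarith
  have rR: "real r \<le> real R" using R(1) by simp
  have rL: "real r \<le> Lk" using rR RL by linarith
  define q where "q = l powr (k * v)"
  have q0: "0 \<le> q" unfolding q_def by simp
  have "real R powr v \<le> Lk powr v" using RL par by (intro powr_mono2) auto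
  also have "\<dots> = q" unfolding Lk q_def by (simp add: powr_powr)
  finally have \<Lambda>q: "\<Lambda> \<le> B * q" unfolding \<Lambda> using par by simp
  have \<Lambda>0: "0 \<le> \<Lambda>" unfolding \<Lambda> using par by simp
  have pw: "l powr (2 * k) = Lk * Lk" "l powr (k + 1) = Lk * l" "l powr (2 * k + k * v) = Lk * Lk * q"
    "l powr (2 * (k * v) + 2 * k) = q * q * (Lk * Lk)"
  proof -
    have l0: "l powr 1 = l" using l(1) by (intro powr_one) linarith
    have "2 * k = k + k" "2 * k + k * v = k + k + k * v" "2 * (k * v) + 2 * k = k * v + k * v + (k + k)" by simp_all
    then show "l powr (2 * k) = Lk * Lk" "l powr (k + 1) = Lk * l" "l powr (2 * k + k * v) = Lk * Lk * q"
      "l powr (2 * (k * v) + 2 * k) = q * q * (Lk * Lk)"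
      unfolding Lk q_def by (simp_all only: powr_add l0)
  qed
  have RN: "real R * (C * N + 1) \<le> N * Lk / 1024"
  proof -
    have "real R * (C * N + 1) \<le> Lk / (1024 * (C + 1)) * ((C + 1) * N)"
      using R(2) par N Lk1 by (intro mult_mono) (auto simp: algebra_simps)
    also have "\<dots> = N * Lk / 1024" using par by (simp add: field_simps)
    finally show ?thesis .
  qed
  have RK: "real R * (1 + lnK) \<le> N * Lk / 1024"
    using mult_left_mono[of "1 + lnK" "C * N + 1" "real R"] lnK RN by linarith
  have NL: "0 \<le> N * Lk" using N Lk1 by simp
  show "real r * lnK + real r + \<Lambda> * (S + 1)\<^sup>2 / 2 + real r * (2 * pi * real r * \<Lambda>) + real r * (real r + l) \<le> s / 16"
  proof -
    have 1: "real r * lnK \<le> N * Lk / 1024"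
    proof -
      have "real r * lnK \<le> real R * (1 + lnK)" using rR lnK by (intro mult_mono) auto
      then show ?thesis using RK by linarith
    qed
    have 2: "\<Lambda> * (S + 1)\<^sup>2 / 2 \<le> B * q * (S + 1)\<^sup>2 / 2"
      using \<Lambda>q by (intro divide_right_mono mult_right_mono) auto
    have 3: "real r * (2 * pi * real r * \<Lambda>) \<le> 2 * pi * B * (Lk * Lk * q)"
    proof -
      have "real r * (2 * pi * real r * \<Lambda>) \<le> Lk * (2 * pi * Lk * (B * q))"
        using rL \<Lambda>q \<Lambda>0 Lk1 by (intro mult_mono) auto
      then show ?thesis by (simp add: ac_simps)
    qed
    have 4: "real r * (real r + l) \<le> Lk * Lk + Lk * l"
      using mult_mono[OF rL, of "real r + l" "Lk + l"] rL Lk1 l by (simp add: distrib_left)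
    have "Lk + B * q * (S + 1)\<^sup>2 / 2 + 2 * pi * B * (Lk * Lk * q) + Lk * Lk + Lk * l \<le> N * Lk / 256"
      using g1 unfolding pw q_def[symmetric] Lk[symmetric] .
    then have "real r * lnK + real r + \<Lambda> * (S + 1)\<^sup>2 / 2 + real r * (2 * pi * real r * \<Lambda>) + real r * (real r + l)
        \<le> N * Lk / 1024 + N * Lk / 256"
      using 1 2 3 4 rL by linarith
    also have "\<dots> \<le> s / 16" using s(1) NL by linarith
    finally show ?thesis .
  qed
  show "real R * (1 + lnK) + real R * (5 + 3 * l + real R + A + A * real R * T) \<le> s / 32"
  proof -
    have T0: "0 \<le> T" unfolding T by simp
    have "A * real R * T \<le> A * Lk * T" using RL par T0 by (intro mult_right_mono mult_left_mono) auto
    then have "5 + 3 * l + real R + A + A * real R * T \<le> 5 + 3 * l + Lk + A + A * Lk * T" using RL by linarith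
    then have "real R * (5 + 3 * l + real R + A + A * real R * T) \<le> Lk * (5 + 3 * l + Lk + A + A * Lk * T)"
      using RL par T0 l Lk1 by (intro mult_mono) auto
    also have "\<dots> \<le> N * Lk / 256" using g2 unfolding Lk[symmetric] .
    finally show ?thesis using RK s(1) NL by linarith
  qed
  show "real R * (4 * \<Lambda>\<^sup>2 * real R) \<le> s / 32"
  proof -
    have "\<Lambda>\<^sup>2 \<le> (B * q)\<^sup>2" using \<Lambda>q \<Lambda>0 by (intro power_mono)
    then have "real R * (4 * \<Lambda>\<^sup>2 * real R) \<le> Lk * (4 * (B * q)\<^sup>2 * Lk)"
      using RL Lk1 by (intro mult_mono) auto
    also have "\<dots> = 4 * B\<^sup>2 * (q * q * (Lk * Lk))" by (simp add: power2_eq_square ac_simps)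
    also have "\<dots> \<le> N * Lk / 64" using g3 unfolding pw Lk[symmetric] .
    finally show ?thesis using s(1) by linarith
  qed
  show "s * (4 * \<Lambda>) \<le> T\<^sup>2"
  proof -
    have "s * (4 * \<Lambda>) \<le> 2 * (N * Lk) * (4 * (B * q))"
      using s \<Lambda>q \<Lambda>0 NL by (intro mult_mono) auto
    also have "\<dots> \<le> real n powr (3 * \<xi> / 2)" using g4 unfolding q_def[symmetric] Lk[symmetric] .
    also have "\<dots> = T\<^sup>2" unfolding T by (simp add: power2_eq_square powr_add[symmetric])
    finally show ?thesis .
  qed
qed

section \<open>The contraction theorem\<close>

theorem corollary1:
  fixes M :: regression
    and K r rbar :: "nat \<Rightarrow> nat"
    and \<nu>x :: "nat \<Rightarrow> (nat \<Rightarrow> real) measure"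
    and \<beta>s :: "nat \<Rightarrow> nat \<Rightarrow> real"
    and V :: "nat \<Rightarrow> nat set \<Rightarrow> real mat"
    and \<epsilon> :: "nat \<Rightarrow> real"
    and B v \<delta> C \<xi> C' k :: real
  defines "P \<equiv> \<lambda>n. data_law M (\<nu>x n) (K n) (\<beta>s n) n"
    and "d \<equiv> \<lambda>n \<gamma> \<beta>. hellinger M (\<nu>x n) (fitted_density M \<gamma> \<beta>) (true_density M (K n) (\<beta>s n))"
    and "post \<equiv> \<lambda>n. posterior M (K n) (r n) (rbar n) (V n) n"
  assumes model: "admissible M"
    and x_space: "\<And>n. n \<ge> 1 \<Longrightarrow> sets (\<nu>x n) = sets (PiM {1..K n} (\<lambda>_. borel))"
    and x_prob: "\<And>n. n \<ge> 1 \<Longrightarrow> prob_space (\<nu>x n)"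
    and x_bound: "\<And>n. n \<ge> 1 \<Longrightarrow> AE x in \<nu>x n. \<forall>j\<in>{1..K n}. \<bar>x j\<bar> \<le> 1"
    and sizes: "\<And>n. n \<ge> 1 \<Longrightarrow> 1 \<le> r n \<and> r n \<le> rbar n \<and> rbar n < K n"
    and V_pos_def: "\<And>n \<gamma>. n \<ge> 1 \<Longrightarrow> \<gamma> \<subseteq> {1..K n} \<Longrightarrow> pos_def (card \<gamma>) (V n \<gamma>)"
    and "B > 0" and "v > 0"
    and V_eigen: "\<exists>R. \<forall>n\<ge>1. real (rbar n) \<ge> R \<longrightarrow>
          max (SUP \<gamma>\<in>nonempty_models (K n) (rbar n). ch1 (V n \<gamma>))
              (SUP \<gamma>\<in>nonempty_models (K n) (rbar n). ch1 (inv_mat (V n \<gamma>)))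
          \<le> B * real (rbar n) powr v"
    and K_mono: "mono_on {1..} K"
    and "\<delta> > 0" and K_lower: "(\<lambda>n. real n powr \<delta> / real (K n)) \<longlonglongrightarrow> 0"
    and "C > 0" and "0 < \<xi>" and "\<xi> < 1"
    and K_upper: "eventually (\<lambda>n. real (K n) \<le> exp (C * real n powr \<xi>)) sequentially"
    and beta_sum: "convergent (\<lambda>n. \<Sum>j\<in>{1..K n}. \<bar>\<beta>s n j\<bar>)"
    and "C' > 0"
    and beta_tail: "eventually (\<lambda>n. tail_sum (K n) (\<beta>s n) (r n) \<le> exp (- C' * real (r n))) sequentially"
    and r_lower: "\<And>n. n \<ge> 1 \<Longrightarrow> ln (real n) / C' \<le> real (r n)"
    and "k > 1" and rbar_upper: "(\<lambda>n. real (rbar n) / ln (real n) powr k) \<longlonglongrightarrow> 0"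
    and eps_range: "\<And>n. n \<ge> 1 \<Longrightarrow> 0 < \<epsilon> n \<and> \<epsilon> n \<le> 1"
    and eps_rate: "(\<lambda>n. \<epsilon> n / (real n powr (- (1 - \<xi>) / 2) * ln (real n) powr (k / 2))) \<longlonglongrightarrow> 1"
  shows "(\<exists>r0>0. (\<lambda>n. measure (P n) {D \<in> space (P n).
             post n D (\<lambda>\<gamma> \<beta>. d n \<gamma> \<beta> \<le> \<epsilon> n) \<ge> 1 - exp (- r0 * real n * (\<epsilon> n)\<^sup>2)}) \<longlonglongrightarrow> 1)
       \<and> (\<exists>c1>0. eventually (\<lambda>n. measure (P n) {D \<in> space (P n).
             post n D (\<lambda>\<gamma> \<beta>. d n \<gamma> \<beta> > \<epsilon> n) \<ge> exp (- 0.5 * c1 * real n * (\<epsilon> n)\<^sup>2)}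
             \<le> exp (- 0.5 * c1 * real n * (\<epsilon> n)\<^sup>2)) sequentially)
       \<and> (\<exists>c1>0. eventually (\<lambda>n. (\<integral>D. post n D (\<lambda>\<gamma> \<beta>. d n \<gamma> \<beta> > \<epsilon> n) \<partial>P n)
             \<le> exp (- c1 * real n * (\<epsilon> n)\<^sup>2)) sequentially)"
proof -
  obtain S where S: "\<And>n. (\<Sum>j\<in>{1..K n}. \<bar>\<beta>s n j\<bar>) \<le> S"
  proof -
    have "Bseq (\<lambda>n. \<Sum>j\<in>{1..K n}. \<bar>\<beta>s n j\<bar>)" by (rule convergent_imp_Bseq[OF beta_sum])
    then obtain S where "\<And>n. norm (\<Sum>j\<in>{1..K n}. \<bar>\<beta>s n j\<bar>) \<le> S" by (auto simp: Bseq_def)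
    then show thesis by (intro that[of S]) (metis abs_le_D1 real_norm_def)
  qed
  obtain A where A: "1 \<le> A" "log_lipschitz_chi A M" using log_lipschitz_chi_exists[OF model] by blast
  obtain R0 where R0: "\<And>n. 1 \<le> n \<Longrightarrow> R0 \<le> real (rbar n) \<Longrightarrow>
          max (SUP \<gamma>\<in>nonempty_models (K n) (rbar n). ch1 (V n \<gamma>))
              (SUP \<gamma>\<in>nonempty_models (K n) (rbar n). ch1 (inv_mat (V n \<gamma>)))
          \<le> B * real (rbar n) powr v" using V_eigen by blast
  define c0 where "c0 = exp (A * (1 + (S + 2)))"
  define L where "L n = real n powr \<xi> * ln (real n) powr k" for n :: nat
  define s where "s n = real n * (\<epsilon> n)\<^sup>2" for n
  \<comment> \<open>Above \<open>x0\<close> the eigenvalue bound applies and \<open>B rbar\<^sup>v \<ge> 1\<close>; the size \<open>rbar \<ge> r \<ge> ln n / C'\<close> grows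
    beyond it.\<close>
  define x0 where "x0 = max (max R0 1) ((1 / B) powr (1 / v))"
  have growth: "eventually (\<lambda>n::nat. ln (real n) powr k + B * ln (real n) powr (k * v) * (S + 1)\<^sup>2 / 2
           + 2 * pi * B * ln (real n) powr (2 * k + k * v) + ln (real n) powr (2 * k) + ln (real n) powr (k + 1)
           \<le> real n powr \<xi> * ln (real n) powr k / 256) sequentially"
    "eventually (\<lambda>n::nat. ln (real n) powr k * (5 + 3 * ln (real n) + ln (real n) powr k + A + A * ln (real n) powr k * real n powr (3 * \<xi> / 4))
           \<le> real n powr \<xi> * ln (real n) powr k / 256) sequentially"
    "eventually (\<lambda>n::nat. 4 * B\<^sup>2 * ln (real n) powr (2 * (k * v) + 2 * k) \<le> real n powr \<xi> * ln (real n) powr k / 64) sequentially"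
    "eventually (\<lambda>n::nat. 2 * (real n powr \<xi> * ln (real n) powr k) * (4 * (B * ln (real n) powr (k * v))) \<le> real n powr (3 * \<xi> / 2)) sequentially"
    "filterlim L at_top sequentially"
    unfolding L_def
    by (rule growth_facts[OF \<open>B > 0\<close> \<open>k > 1\<close> \<open>v > 0\<close> \<open>0 < \<xi>\<close> \<open>\<xi> < 1\<close> A(1)])+
  have E0: "eventually (\<lambda>n::nat. 1 \<le> ln (real n)) sequentially" by real_asymp
  \<comment> \<open>A ratio between \<open>3/4\<close> and \<open>5/4\<close> has a square between \<open>1/2\<close> and \<open>2\<close>, so \<open>s\<close> is comparable
    to \<open>L\<close> up to a factor of 2.\<close>
  have E1: "eventually (\<lambda>n. L n / 2 \<le> s n \<and> s n \<le> 2 * L n) sequentially"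
    using order_tendstoD(1)[OF eps_rate, of "3 / 4", simplified] order_tendstoD(2)[OF eps_rate, of "5 / 4", simplified] E0
  proof eventually_elim
    case (elim n)
    define e where "e = real n powr (- (1 - \<xi>) / 2) * ln (real n) powr (k / 2)"
    define q where "q = \<epsilon> n / e"
    have n0: "0 < real n" using elim(3) by (cases n) auto
    have "0 < ln (real n)" using elim(3) by linarith
    then have e0: "0 < e" unfolding e_def using n0 by (intro mult_pos_pos) (simp_all only: powr_gt_zero less_imp_neq[THEN not_sym] not_False_eq_True)
    have q: "3 / 4 \<le> q" "q \<le> 5 / 4" using elim(1,2) unfolding q_def e_def by simp_all
    have q2: "(3 / 4)\<^sup>2 \<le> q\<^sup>2" "q\<^sup>2 \<le> (5 / 4)\<^sup>2" using q by (intro power_mono; simp)+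
    have "real n * e\<^sup>2 = real n powr 1 * (real n powr (- (1 - \<xi>) / 2) * real n powr (- (1 - \<xi>) / 2)) * (ln (real n) powr (k / 2) * ln (real n) powr (k / 2))"
      unfolding e_def using n0 by (simp add: power2_eq_square)
    also have "\<dots> = L n" unfolding L_def powr_add[symmetric] by (simp add: field_simps)
    finally have "s n = q\<^sup>2 * L n"
      unfolding s_def q_def using e0 by (simp add: power_divide field_simps)
    moreover have "0 \<le> L n" unfolding L_def by simp
    ultimately show ?case
      using mult_right_mono[OF q2(1), of "L n"] mult_right_mono[OF q2(2), of "L n"] by (simp add: power2_eq_square)
  qed
  have E2: "eventually (\<lambda>n. real (rbar n) / ln (real n) powr k < 1 / (1024 * (C + 1))) sequentially"
    by (rule order_tendstoD(2)[OF rbar_upper]) (use \<open>C > 0\<close> in simp)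
  have E5: "eventually (\<lambda>n. 2 * max 128 (64 * c0) \<le> L n) sequentially"
    using growth(5) unfolding filterlim_at_top by blast
  have E6: "eventually (\<lambda>n::nat. C' * x0 \<le> ln (real n)) sequentially" by real_asymp
  have "0 < exp (- A * (1 + (S + 2)))" by simp
  then have E7: "eventually (\<lambda>n::nat. 2 / real n \<le> exp (- A * (1 + (S + 2)))) sequentially" by real_asymp

  have main: "eventually (\<lambda>n. prob_space (P n) \<and>
      measure (P n) {D \<in> space (P n). post n D (\<lambda>\<gamma> \<beta>. d n \<gamma> \<beta> > \<epsilon> n) \<ge> exp (- s n / 128)} \<le> exp (- s n / 128) \<and>
      (\<integral>D. post n D (\<lambda>\<gamma> \<beta>. d n \<gamma> \<beta> > \<epsilon> n) \<partial>P n) \<le> exp (- s n / 64) \<and>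
      1 - exp (- s n / 128) \<le> measure (P n) {D \<in> space (P n). post n D (\<lambda>\<gamma> \<beta>. d n \<gamma> \<beta> \<le> \<epsilon> n) \<ge> 1 - exp (- s n / 128)}) sequentially"
    using growth(1-4) E0 E1 E2 E5 E6 E7 K_upper beta_tail
  proof eventually_elim
    case (elim n)
    define l where "l = ln (real n)"
    define \<Lambda> where "\<Lambda> = B * real (rbar n) powr v"
    define T where "T = real n powr (3 * \<xi> / 4)"
    have l: "1 \<le> l" using elim(5) unfolding l_def .
    have n: "1 \<le> n" using elim(5) by (cases n) auto
    have n1: "1 \<le> real n" using n by simp
    note sz = sizes[OF n]
    have xr: "x0 \<le> real (rbar n)"
    proof -
      have "x0 \<le> ln (real n) / C'" using elim(9) \<open>C' > 0\<close> by (simp add: le_divide_eq mult.commute)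
      also have "\<dots> \<le> real (r n)" by (rule r_lower[OF n])
      also have "\<dots> \<le> real (rbar n)" using sz by simp
      finally show ?thesis .
    qed
    have \<Lambda>1: "1 \<le> \<Lambda>"
    proof -
      have "(1 / B) powr (1 / v) \<le> real (rbar n)" using xr unfolding x0_def by simp
      then have "((1 / B) powr (1 / v)) powr v \<le> real (rbar n) powr v" using \<open>v > 0\<close> by (intro powr_mono2) auto
      then have "1 / B \<le> real (rbar n) powr v" using \<open>v > 0\<close> \<open>B > 0\<close> by (simp add: powr_powr)
      then show ?thesis unfolding \<Lambda>_def using \<open>B > 0\<close> by (simp add: divide_le_eq mult.commute)
    qed
    interpret selection M "\<nu>x n" "K n" "\<beta>s n" "V n" "r n" "rbar n" n \<Lambda>
    proof (intro selection.intro design.intro selection_axioms.intro)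
      show "admissible M" by (rule model)
      show "sets (\<nu>x n) = sets (PiM {1..K n} (\<lambda>_. borel))" by (rule x_space[OF n])
      show "prob_space (\<nu>x n)" by (rule x_prob[OF n])
      show "AE x in \<nu>x n. \<forall>j\<in>{1..K n}. \<bar>x j\<bar> \<le> 1" by (rule x_bound[OF n])
      show "1 \<le> r n" "r n \<le> rbar n" "rbar n < K n" using sz by simp_all
      show "1 \<le> \<Lambda>" by (rule \<Lambda>1)
      have "R0 \<le> real (rbar n)" using xr unfolding x0_def by simp
      note sup = R0[OF n this]
      show "spectrum_within \<Lambda> \<gamma> (V n \<gamma>)" if g: "\<gamma> \<subseteq> {1..K n}" "card \<gamma> \<le> rbar n" for \<gamma>
        unfolding \<Lambda>_def by (rule spectrum_within_of_sup[OF _ sup g]) (rule V_pos_def[OF n])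
    qed
    obtain g0 where g0: "g0 \<subseteq> {1..K n}" "card g0 = r n" "(\<Sum>j\<in>{1..K n} - g0. \<bar>\<beta>s n j\<bar>) \<le> exp (- C' * real (r n))"
      by (rule tail_sum_attained[OF _ elim(12)]) (use sz in simp)
    \<comment> \<open>The lower bound on \<open>r\<close> makes the coefficients outside \<open>g0\<close> negligible at the scale \<open>1 / n\<close>.\<close>
    have tail: "(\<Sum>j\<in>{1..K n} - g0. \<bar>\<beta>s n j\<bar>) \<le> 1 / real n"
    proof -
      have "ln (real n) \<le> C' * real (r n)" using r_lower[OF n] \<open>C' > 0\<close> by (simp add: divide_le_eq mult.commute)
      then have "exp (- C' * real (r n)) \<le> exp (- ln (real n))" by simp
      also have "\<dots> = 1 / real n" using n1 by (simp add: exp_minus inverse_eq_divide)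
      finally show ?thesis using g0(3) by linarith
    qed
    have K1: "1 \<le> real (K n)" using sz by simp
    have lnK: "0 \<le> ln (real (K n))" "ln (real (K n)) \<le> C * real n powr \<xi>"
    proof -
      show "0 \<le> ln (real (K n))" using K1 by simp
      have "ln (real (K n)) \<le> ln (exp (C * real n powr \<xi>))" using elim(11) K1 by (subst ln_le_cancel_iff) auto
      then show "ln (real (K n)) \<le> C * real n powr \<xi>" by simp
    qed
    have lk: "0 < ln (real n) powr k" using elim(5) by simp
    have R: "real (rbar n) \<le> ln (real n) powr k / (1024 * (C + 1))"
    proof -
      have "real (rbar n) < 1 / (1024 * (C + 1)) * ln (real n) powr k" using elim(7) lk by (simp only: pos_divide_less_eq)
      then show ?thesis by simp
    qed
    have N1: "1 \<le> real n powr \<xi>" using n1 \<open>0 < \<xi>\<close> by (intro ge_one_powr_ge_zero) auto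
    have T1: "1 \<le> T" unfolding T_def using n1 \<open>0 < \<xi>\<close> by (intro ge_one_powr_ge_zero) auto
    have T2: "T \<le> real n"
    proof -
      have "T \<le> real n powr 1" unfolding T_def using n1 \<open>\<xi> < 1\<close> by (intro powr_mono) auto
      then show ?thesis using n1 by simp
    qed
    have rR: "r n \<le> rbar n" using sz by simp
    note rt = rates_at[OF \<open>B > 0\<close> \<open>k > 1\<close> \<open>v > 0\<close> \<open>0 < \<xi>\<close> A(1) \<open>C > 0\<close> elim(5) refl refl N1 refl
        elim(6)[THEN conjunct1, unfolded L_def] elim(6)[THEN conjunct2, unfolded L_def] rR R lnK \<Lambda>_def T_def
        elim(1) elim(2)[folded T_def] elim(3) elim(4)]
    have s1: "128 \<le> s n" "64 * exp (A * (1 + (S + 2))) \<le> s n"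
      using elim(6,8) unfolding c0_def by linarith+
    have A0: "0 \<le> A" using A(1) by simp
    have eps: "0 < \<epsilon> n" "\<epsilon> n \<le> 1" using eps_range[OF n] by simp_all
    note c = contraction_at[OF g0(1,2) n S tail A(2) A0 eps T1 T2 elim(10) refl s_def s1 rt]
    show ?case
      unfolding P_def post_def d_def data_law_eq
      using c prob_space_sample unfolding distance_to_truth_def by (intro conjI)
  qed

  have slim: "filterlim s at_top sequentially"
    unfolding filterlim_at_top
  proof
    fix Z :: real
    have "eventually (\<lambda>n. 2 * Z \<le> L n) sequentially" using growth(5) unfolding filterlim_at_top by blast
    with E1 show "eventually (\<lambda>n. Z \<le> s n) sequentially" by eventually_elim linarith
  qed
  \<comment> \<open>The posterior bound \<open>exp (- s / 64)\<close> fixes \<open>c1 = 1 / 64\<close>, and Markov's inequality splits it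
    into two factors \<open>exp (- s / 128)\<close>.\<close>
  have e128: "exp (- (1 / 128) * real n * (\<epsilon> n)\<^sup>2) = exp (- s n / 128)"
    "exp (- 0.5 * (1 / 64) * real n * (\<epsilon> n)\<^sup>2) = exp (- s n / 128)"
    "exp (- (1 / 64) * real n * (\<epsilon> n)\<^sup>2) = exp (- s n / 64)" for n
    unfolding s_def by simp_all
  show ?thesis
  proof (intro conjI)
    show "\<exists>r0>0. (\<lambda>n. measure (P n) {D \<in> space (P n).
             post n D (\<lambda>\<gamma> \<beta>. d n \<gamma> \<beta> \<le> \<epsilon> n) \<ge> 1 - exp (- r0 * real n * (\<epsilon> n)\<^sup>2)}) \<longlonglongrightarrow> 1"
    proof (intro exI[of _ "1 / 128"] conjI)
      have "((\<lambda>n. 1 - exp (- s n / 128)) \<longlongrightarrow> 1 - 0) sequentially"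
      proof (intro tendsto_diff tendsto_const)
        have "filterlim (\<lambda>n. s n / 128) at_top sequentially"
          by (rule filterlim_at_top_mult_tendsto_pos[OF tendsto_const _ slim, of "1 / 128", simplified])
        then have "filterlim (\<lambda>n. - (s n / 128)) at_bot sequentially" by (simp add: filterlim_uminus_at_top)
        from filterlim_compose[OF exp_at_bot this] show "((\<lambda>n. exp (- s n / 128)) \<longlongrightarrow> 0) sequentially" by simp
      qed
      then have lim: "((\<lambda>n. 1 - exp (- s n / 128)) \<longlongrightarrow> 1) sequentially" by simp
      show "(\<lambda>n. measure (P n) {D \<in> space (P n).
             post n D (\<lambda>\<gamma> \<beta>. d n \<gamma> \<beta> \<le> \<epsilon> n) \<ge> 1 - exp (- (1 / 128) * real n * (\<epsilon> n)\<^sup>2)}) \<longlonglongrightarrow> 1"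
        unfolding e128
      proof (rule tendsto_sandwich[OF _ _ lim tendsto_const])
        show "eventually (\<lambda>n. 1 - exp (- s n / 128) \<le> measure (P n) {D \<in> space (P n).
             post n D (\<lambda>\<gamma> \<beta>. d n \<gamma> \<beta> \<le> \<epsilon> n) \<ge> 1 - exp (- s n / 128)}) sequentially"
          using main by (rule eventually_mono) (elim conjE)
        show "eventually (\<lambda>n. measure (P n) {D \<in> space (P n).
             post n D (\<lambda>\<gamma> \<beta>. d n \<gamma> \<beta> \<le> \<epsilon> n) \<ge> 1 - exp (- s n / 128)} \<le> 1) sequentially"
          using main by (rule eventually_mono) (elim conjE, rule prob_space.prob_le_1)
      qed
    qed simp
    show "\<exists>c1>0. eventually (\<lambda>n. measure (P n) {D \<in> space (P n).
             post n D (\<lambda>\<gamma> \<beta>. d n \<gamma> \<beta> > \<epsilon> n) \<ge> exp (- 0.5 * c1 * real n * (\<epsilon> n)\<^sup>2)}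
             \<le> exp (- 0.5 * c1 * real n * (\<epsilon> n)\<^sup>2)) sequentially"
    proof (intro exI[of _ "1 / 64"] conjI)
      show "eventually (\<lambda>n. measure (P n) {D \<in> space (P n).
             post n D (\<lambda>\<gamma> \<beta>. d n \<gamma> \<beta> > \<epsilon> n) \<ge> exp (- 0.5 * (1 / 64) * real n * (\<epsilon> n)\<^sup>2)}
             \<le> exp (- 0.5 * (1 / 64) * real n * (\<epsilon> n)\<^sup>2)) sequentially"
        unfolding e128 using main by (rule eventually_mono) (elim conjE)
    qed simp
    show "\<exists>c1>0. eventually (\<lambda>n. (\<integral>D. post n D (\<lambda>\<gamma> \<beta>. d n \<gamma> \<beta> > \<epsilon> n) \<partial>P n)
             \<le> exp (- c1 * real n * (\<epsilon> n)\<^sup>2)) sequentially"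
    proof (intro exI[of _ "1 / 64"] conjI)
      show "eventually (\<lambda>n. (\<integral>D. post n D (\<lambda>\<gamma> \<beta>. d n \<gamma> \<beta> > \<epsilon> n) \<partial>P n)
             \<le> exp (- (1 / 64) * real n * (\<epsilon> n)\<^sup>2)) sequentially"
        unfolding e128 using main by (rule eventually_mono) (elim conjE)
    qed simp
  qed
qed

end
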